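(* Let $n,m\ge 1$ and let $X$ be a nonempty finite set of points in $\mathbb{P}^n\times\mathbb{P}^m$. Let $\pi_1\colon \mathbb{P}^n\times\mathbb{P}^m\to\mathbb{P}^n$ be the first projection and let $\ell=|\pi_1(X)|$ be the number of distinct first coordinates among the points of $X$. Then for all integers $t\ge \ell-1$, the minimal free resolution of $S/(I_X\cap\langle x_0,\dots,x_n\rangle^t)$ is a virtual resolution of $S/I_X$ of length $n+m$.
   Context: $\Bbbk$ is an algebraically closed field and $S=\Bbbk[x_0,\dots,x_n,y_0,\dots,y_m]$ is the Cox ring of $\mathbb{P}^n\times\mathbb{P}^m$ over $\Bbbk$, with $\mathbb{Z}^2$-grading $\deg(x_i)=(1,0)$, $\deg(y_j)=(0,1)$. The irrelevant ideal is $B=\langle x_0,\dots,x_n\rangle\cap\langle y_0,\dots,y_m\rangle$. $I_X\subseteq S$ denotes the bihomogeneous vanishing ideal of $X$. By convention $\langle x_0,\dots,x_n\rangle^0=S$. For an $S$-module $M$, $\Gamma_B(M)=\{u\in M\mid B^tu=0\text{ for some }t\in\mathbb{N}\}$. A $\mathbb{Z}^2$-graded complex of free $S$-modules $F_\bullet\colon F_0\leftarrow F_1\leftarrow F_2\leftarrow\cdots$ is a virtual resolution of a finitely generated $\mathbb{Z}^2$-graded $S$-module $M$ if (1) for each $i>0$ there is some $t$ with $B^tH_i(F_\bullet)=0$, and (2) $H_0(F_\bullet)/\Gamma_B(H_0(F_\bullet))\cong M/\Gamma_B(M)$. The length of a complex is the largest $k$ with $F_k\neq 0$. Minimal free resolutions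 are $\mathbb{Z}^2$-graded over $S$. *)

theory Defs
  imports
    "HOL-Algebra.Ideal_Product"
    "HOL-Algebra.Module"
    "HOL-Computational_Algebra.Polynomial"
    "HOL-Library.Cardinality"
    "HOL-Library.Poly_Mapping"
    "HOL-Library.Product_Plus"
begin

section \<open>Bigraded modules\<close>

text \<open>
  A module record together with its homogeneous components. A graded ring is represented by the
  same record, as a module over itself. In the modules constructed below the fields
  \<open>mult\<close> and \<open>one\<close>, which the record inherits from rings, are not used.
\<close>

record ('a, 'b) gmod = "('a, 'b) module" +
  hcomp :: "int \<times> int \<Rightarrow> 'b set"

definition graded_module ::
    "('a, 'a) gmod \<Rightarrow> ('a, 'b) gmod \<Rightarrow> bool" where
  "graded_module R M \<longleftrightarrow>
     Module.module R M \<and>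
     (\<forall>d. additive_subgroup (hcomp M d) M) \<and>
     (\<forall>d e. \<forall>a\<in>hcomp R d. \<forall>u\<in>hcomp M e. a \<odot>\<^bsub>M\<^esub> u \<in> hcomp M (d + e)) \<and>
     (\<forall>u\<in>carrier M. \<exists>!c. (\<forall>d. c d \<in> hcomp M d) \<and> finite {d. c d \<noteq> \<zero>\<^bsub>M\<^esub>} \<and>
        u = (\<Oplus>\<^bsub>M\<^esub> d\<in>{d. c d \<noteq> \<zero>\<^bsub>M\<^esub>}. c d))"

definition graded_hom ::
    "('a, 'a) gmod \<Rightarrow> ('a, 'b) gmod \<Rightarrow> ('a, 'c) gmod \<Rightarrow> ('b \<Rightarrow> 'c) \<Rightarrow> bool" where
  "graded_hom R M N f \<longleftrightarrow>
     f \<in> carrier M \<rightarrow> carrier N \<and>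
     (\<forall>u\<in>carrier M. \<forall>v\<in>carrier M. f (u \<oplus>\<^bsub>M\<^esub> v) = f u \<oplus>\<^bsub>N\<^esub> f v) \<and>
     (\<forall>a\<in>carrier R. \<forall>u\<in>carrier M. f (a \<odot>\<^bsub>M\<^esub> u) = a \<odot>\<^bsub>N\<^esub> f u) \<and>
     (\<forall>d. f ` hcomp M d \<subseteq> hcomp N d)"

definition graded_iso ::
    "('a, 'a) gmod \<Rightarrow> ('a, 'b) gmod \<Rightarrow> ('a, 'c) gmod \<Rightarrow> bool" where
  "graded_iso R M N \<longleftrightarrow> (\<exists>f. graded_hom R M N f \<and> bij_betw f (carrier M) (carrier N))"

definition sub_gmod :: "('a, 'b) gmod \<Rightarrow> 'b set \<Rightarrow> ('a, 'b) gmod" where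
  "sub_gmod M K = M \<lparr>carrier := K, hcomp := (\<lambda>d. K \<inter> hcomp M d)\<rparr>"

text \<open>
  In the scalar multiplication of the quotient, adding \<open>N\<close> makes the result a full coset of
  \<open>N\<close> (the set \<open>a \<odot> A\<close> alone can be smaller, e.g. for \<open>a = 0\<close>).
\<close>

definition quot_gmod :: "('a, 'b) gmod \<Rightarrow> 'b set \<Rightarrow> ('a, 'b set) gmod" where
  "quot_gmod M N =
     \<lparr>carrier = a_rcosets\<^bsub>M\<^esub> N,
      monoid.mult = undefined,
      one = undefined,
      zero = N,
      add = (\<lambda>A B. A <+>\<^bsub>M\<^esub> B),
      module.smult = (\<lambda>a A. N <+>\<^bsub>M\<^esub> (\<lambda>u. a \<odot>\<^bsub>M\<^esub> u) ` A),
      hcomp = (\<lambda>d. (\<lambda>u. N +>\<^bsub>M\<^esub> u) ` hcomp M d)\<rparr>"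

primrec ideal_power :: "('a, 'c) ring_scheme \<Rightarrow> 'a set \<Rightarrow> nat \<Rightarrow> 'a set" where
  "ideal_power R I 0 = carrier R"
| "ideal_power R I (Suc t) = I \<cdot>\<^bsub>R\<^esub> ideal_power R I t"

definition ideal_smult :: "'a set \<Rightarrow> ('a, 'b) gmod \<Rightarrow> 'b set" where
  "ideal_smult I M =
     {u. \<exists>(r::nat) a v. (\<forall>i<r. a i \<in> I \<and> v i \<in> carrier M) \<and>
           u = (\<Oplus>\<^bsub>M\<^esub> i\<in>{..<r}. a i \<odot>\<^bsub>M\<^esub> v i)}"

definition torsion :: "('a, 'a) gmod \<Rightarrow> 'a set \<Rightarrow> ('a, 'b) gmod \<Rightarrow> 'b set" where
  "torsion R B M =
     {u \<in> carrier M. \<exists>t. \<forall>b\<in>ideal_power R B t. b \<odot>\<^bsub>M\<^esub> u = \<zero>\<^bsub>M\<^esub>}"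

text \<open>
  A homogeneous basis with members of degrees \<open>d\<^sub>e\<close> amounts to a graded isomorphism of
  the module with the direct sum of the twists \<open>R(-d\<^sub>e)\<close>.
\<close>

definition homogeneous_basis :: "('a, 'a) gmod \<Rightarrow> ('a, 'b) gmod \<Rightarrow> 'b set \<Rightarrow> bool" where
  "homogeneous_basis R M E \<longleftrightarrow>
     E \<subseteq> (\<Union>d. hcomp M d) \<and>
     (\<forall>u\<in>carrier M. \<exists>!c. (\<forall>e. c e \<in> carrier R) \<and>
        {e. c e \<noteq> \<zero>\<^bsub>R\<^esub>} \<subseteq> E \<and> finite {e. c e \<noteq> \<zero>\<^bsub>R\<^esub>} \<and>
        u = (\<Oplus>\<^bsub>M\<^esub> e\<in>{e. c e \<noteq> \<zero>\<^bsub>R\<^esub>}. c e \<odot>\<^bsub>M\<^esub> e))"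


section \<open>Complexes and resolutions\<close>

text \<open>The differential \<open>D i\<close> maps \<open>F (i + 1)\<close> to \<open>F i\<close>.\<close>

definition free_complex ::
    "('a, 'a) gmod \<Rightarrow> (nat \<Rightarrow> ('a, 'b) gmod) \<Rightarrow> (nat \<Rightarrow> 'b \<Rightarrow> 'b) \<Rightarrow> bool" where
  "free_complex R F D \<longleftrightarrow>
     (\<forall>i. graded_module R (F i) \<and> (\<exists>E. homogeneous_basis R (F i) E)) \<and>
     (\<forall>i. graded_hom R (F (i + 1)) (F i) (D i)) \<and>
     (\<forall>i. \<forall>u\<in>carrier (F (i + 2)). D i (D (i + 1) u) = \<zero>\<^bsub>F i\<^esub>)"

definition cycles :: "(nat \<Rightarrow> ('a, 'b) gmod) \<Rightarrow> (nat \<Rightarrow> 'b \<Rightarrow> 'b) \<Rightarrow> nat \<Rightarrow> 'b set" where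
  "cycles F D i =
     (case i of 0 \<Rightarrow> carrier (F 0)
      | Suc j \<Rightarrow> {u \<in> carrier (F (Suc j)). D j u = \<zero>\<^bsub>F j\<^esub>})"

definition homology ::
    "(nat \<Rightarrow> ('a, 'b) gmod) \<Rightarrow> (nat \<Rightarrow> 'b \<Rightarrow> 'b) \<Rightarrow> nat \<Rightarrow> ('a, 'b set) gmod" where
  "homology F D i = quot_gmod (sub_gmod (F i) (cycles F D i)) (D i ` carrier (F (i + 1)))"

definition complex_length :: "(nat \<Rightarrow> ('a, 'b) gmod) \<Rightarrow> nat \<Rightarrow> bool" where
  "complex_length F k \<longleftrightarrow>
     carrier (F k) \<noteq> {\<zero>\<^bsub>F k\<^esub>} \<and> (\<forall>i>k. carrier (F i) = {\<zero>\<^bsub>F i\<^esub>})"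

definition virtual_resolution ::
    "('a, 'a) gmod \<Rightarrow> 'a set \<Rightarrow> (nat \<Rightarrow> ('a, 'b) gmod) \<Rightarrow> (nat \<Rightarrow> 'b \<Rightarrow> 'b) \<Rightarrow>
     ('a, 'c) gmod \<Rightarrow> bool" where
  "virtual_resolution R B F D M \<longleftrightarrow>
     free_complex R F D \<and>
     (\<forall>i>0. \<exists>t. \<forall>b\<in>ideal_power R B t. \<forall>u\<in>carrier (homology F D i).
        b \<odot>\<^bsub>homology F D i\<^esub> u = \<zero>\<^bsub>homology F D i\<^esub>) \<and>
     graded_iso R
       (quot_gmod (homology F D 0) (torsion R B (homology F D 0)))
       (quot_gmod M (torsion R B M))"

text \<open>
  Here \<open>I\<close> is the homogeneous maximal ideal; minimality means that each differential maps into
  \<open>I F\<close>. The free modules have finite rank, as in the usual definition for finitely generated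
  \<open>M\<close>.
\<close>

definition minimal_free_resolution ::
    "('a, 'a) gmod \<Rightarrow> 'a set \<Rightarrow> (nat \<Rightarrow> ('a, 'b) gmod) \<Rightarrow> (nat \<Rightarrow> 'b \<Rightarrow> 'b) \<Rightarrow>
     ('a, 'c) gmod \<Rightarrow> bool" where
  "minimal_free_resolution R I F D M \<longleftrightarrow>
     free_complex R F D \<and>
     (\<forall>i. \<exists>E. finite E \<and> homogeneous_basis R (F i) E) \<and>
     (\<forall>i>0. carrier (homology F D i) = {\<zero>\<^bsub>homology F D i\<^esub>}) \<and>
     graded_iso R (homology F D 0) M \<and>
     (\<forall>i. D i ` carrier (F (i + 1)) \<subseteq> ideal_smult I (F i))"


section \<open>The Cox ring of a product of two projective spaces\<close>

text \<open>
  The finite types \<open>'n\<close> and \<open>'m\<close> index the two groups of variables, so that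
  \<open>CARD('n) = n + 1\<close> and \<open>CARD('m) = m + 1\<close>. A polynomial is a finitely supported
  function from exponent vectors to coefficients.
\<close>

type_synonym ('n, 'm, 'k) cox = "('n + 'm \<Rightarrow>\<^sub>0 nat) \<Rightarrow>\<^sub>0 'k"

definition bidegree :: "('n::finite + 'm::finite \<Rightarrow>\<^sub>0 nat) \<Rightarrow> int \<times> int" where
  "bidegree \<mu> =
     (int (\<Sum>i\<in>UNIV. Poly_Mapping.lookup \<mu> (Inl i)),
      int (\<Sum>j\<in>UNIV. Poly_Mapping.lookup \<mu> (Inr j)))"

definition cox_ring ::
    "(('n::finite, 'm::finite, 'k::field) cox, ('n, 'm, 'k) cox) gmod" where
  "cox_ring =
     \<lparr>carrier = UNIV, monoid.mult = (*), one = 1, zero = 0, add = (+), module.smult = (*),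
      hcomp = (\<lambda>d. {f. \<forall>\<mu>\<in>Poly_Mapping.keys f. bidegree \<mu> = d})\<rparr>"

definition cox_var :: "'n + 'm \<Rightarrow> ('n::finite, 'm::finite, 'k::field) cox" where
  "cox_var v = Poly_Mapping.single (Poly_Mapping.single v 1) 1"

definition x_ideal :: "('n::finite, 'm::finite, 'k::field) cox set" where
  "x_ideal = Idl\<^bsub>cox_ring\<^esub> (range (\<lambda>i. cox_var (Inl i)))"

definition y_ideal :: "('n::finite, 'm::finite, 'k::field) cox set" where
  "y_ideal = Idl\<^bsub>cox_ring\<^esub> (range (\<lambda>j. cox_var (Inr j)))"

definition irrelevant_ideal :: "('n::finite, 'm::finite, 'k::field) cox set" where
  "irrelevant_ideal = x_ideal \<inter> y_ideal"

definition maximal_ideal :: "('n::finite, 'm::finite, 'k::field) cox set" where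
  "maximal_ideal = Idl\<^bsub>cox_ring\<^esub> (range cox_var)"

definition eval_cox ::
    "('n::finite, 'm::finite, 'k::field) cox \<Rightarrow> ('n \<Rightarrow> 'k) \<Rightarrow> ('m \<Rightarrow> 'k) \<Rightarrow> 'k" where
  "eval_cox f a b =
     (\<Sum>\<mu>\<in>Poly_Mapping.keys f. Poly_Mapping.lookup f \<mu> *
        (\<Prod>v\<in>UNIV. case_sum a b v ^ Poly_Mapping.lookup \<mu> v))"


section \<open>Projective space and vanishing ideals\<close>

definition proj_rel :: "('n \<Rightarrow> 'k::field) \<Rightarrow> ('n \<Rightarrow> 'k) \<Rightarrow> bool" where
  "proj_rel a b \<longleftrightarrow> (\<exists>i. a i \<noteq> 0) \<and> (\<exists>c. c \<noteq> 0 \<and> b = (\<lambda>i. c * a i))"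

lemma part_equivp_proj_rel: "part_equivp proj_rel"
proof (rule part_equivpI)
  show "\<exists>a. proj_rel a (a :: 'n \<Rightarrow> 'k::field)"
    by (rule exI[of _ "\<lambda>_. 1"]) (auto simp: proj_rel_def intro!: exI[of _ 1])
  show "symp (proj_rel :: ('n \<Rightarrow> 'k::field) \<Rightarrow> _)"
  proof (rule sympI)
    fix a b :: "'n \<Rightarrow> 'k" assume "proj_rel a b"
    then obtain i c where "a i \<noteq> 0" "c \<noteq> 0" "b = (\<lambda>i. c * a i)"
      by (auto simp: proj_rel_def)
    then show "proj_rel b a"
      unfolding proj_rel_def
      by (intro conjI exI[of _ i] exI[of _ "inverse c"]) (auto simp: mult.assoc[symmetric])
  qed
  show "transp (proj_rel :: ('n \<Rightarrow> 'k::field) \<Rightarrow> _)"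
  proof (rule transpI)
    fix a b e :: "'n \<Rightarrow> 'k" assume "proj_rel a b" "proj_rel b e"
    then obtain i c c' where "a i \<noteq> 0" "c \<noteq> 0" "b = (\<lambda>i. c * a i)" "c' \<noteq> 0" "e = (\<lambda>i. c' * b i)"
      by (auto simp: proj_rel_def)
    then show "proj_rel a e"
      unfolding proj_rel_def
      by (intro conjI exI[of _ i] exI[of _ "c' * c"]) (auto simp: mult.assoc)
  qed
qed

quotient_type (overloaded) ('n, 'k) proj_space = "'n \<Rightarrow> 'k::field" / partial: proj_rel
  by (rule part_equivp_proj_rel)

definition homogeneous_coords :: "('n, 'k::field) proj_space \<Rightarrow> ('n \<Rightarrow> 'k) \<Rightarrow> bool" where
  "homogeneous_coords p a \<longleftrightarrow> (\<exists>i. a i \<noteq> 0) \<and> abs_proj_space a = p"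

definition vanishing_ideal ::
    "(('n::finite, 'k::field) proj_space \<times> ('m::finite, 'k) proj_space) set \<Rightarrow>
     ('n, 'm, 'k) cox set" where
  "vanishing_ideal X =
     Idl\<^bsub>cox_ring\<^esub>
       {f. (\<exists>d. f \<in> hcomp cox_ring d) \<and>
           (\<forall>(p, q)\<in>X. \<forall>a b. homogeneous_coords p a \<and> homogeneous_coords q b \<longrightarrow>
              eval_cox f a b = 0)}"

end

theory Submission
  imports Defs "HOL-Library.Function_Algebras"
begin

text \<open>
  Put \<open>J = I\<^sub>X \<inter> \<langle>x\<rangle>\<^sup>t\<close>. Since \<open>B\<^sup>t \<subseteq> \<langle>x\<rangle>\<^sup>t\<close>, the quotients \<open>S/J\<close> and \<open>S/I\<^sub>X\<close> agree modulo
  \<open>B\<close>-torsion, so the point is that \<open>S/J\<close> has depth exactly two. Choose a linear form \<open>H\<close> in the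
  \<open>y\<close>-variables and a linear form \<open>G\<close> in the \<open>x\<close>-variables that vanish at no point of \<open>X\<close>, and a variable
  \<open>Y = y\<^sub>j\<close> independent of \<open>H\<close>. Then \<open>H, Y + G\<close> is a regular sequence on \<open>S/J\<close>: in \<open>x\<close>-degrees below \<open>t\<close>
  the ideal \<open>J\<close> is zero and \<open>Y\<close> is regular modulo \<open>H\<close>, while in \<open>x\<close>-degrees at least \<open>t \<ge> \<ell> - 1\<close> the
  \<open>\<ell>\<close> first coordinates can be interpolated, so multiplication by \<open>G\<close> is bijective on \<open>S/I\<^sub>X\<close>. Modulo
  this sequence \<open>G\<^sup>t\<close> is nonzero and is killed by all monomials of large degree, which produces a socle
  element. Extending the sequence by variables to a basis of the linear forms and reducing the
  resolution modulo one form at a time, exactness is lost in one further degree per step, and the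
  connecting homomorphism carries the socle element one degree up; after all \<open>n + m + 2\<close> forms the
  differentials vanish, so exactly the free modules in degrees above \<open>n + m\<close> are zero.
\<close>

section \<open>Polynomials and linear forms\<close>

text \<open>Neither summand of \<open>Y + G\<close> would do alone. If t > 0, a nonzero f in I_X of
  x-degree t - 1 is not in J while G f is: truncation destroys the regularity of \<open>G\<close>
  just below x-degree t. From x-degree t on, S/(J + (H)) vanishes in large y-degrees, so
  \<open>Y\<close> is nilpotent there. The sum works because \<open>Y\<close> preserves the x-degree
  and \<open>G\<close> raises it by one: components below x-degree t are cancelled upwards through
  \<open>Y\<close>, the others downwards through \<open>G\<close>. The count l of first coordinates
  suffices, rather than |X|, because division by \<open>G\<close> affects only the x-part of a
  monomial; its y-part is carried along. The number of second coordinates enters through the degree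
  from which the multiples of G^t lie in the ideal, which makes the search for a socle element
  finite. The regular sequence bounds the length by n + m = (n + m + 2) - 2; the socle element shows
  that the free module in degree n + m is nonzero. Instead of Tor, the complexes F/KF are handled
  through vectors with entries in K.\<close>

type_synonym ('v, 'k) mpol = "('v \<Rightarrow>\<^sub>0 nat) \<Rightarrow>\<^sub>0 'k"

lemma mpol_sum_single:
  "f = (\<Sum>\<mu>\<in>Poly_Mapping.keys f. Poly_Mapping.single \<mu> (Poly_Mapping.lookup f \<mu>))"
  by (intro poly_mapping_eqI)
     (auto simp: lookup_sum lookup_single when_def in_keys_iff)

lemma mpol_induct [case_names single add]:
  assumes "\<And>\<mu> c. P (Poly_Mapping.single \<mu> c)" and "\<And>f g. P f \<Longrightarrow> P g \<Longrightarrow> P (f + g)"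
  shows "P (f :: 'a \<Rightarrow>\<^sub>0 'b::comm_monoid_add)"
proof -
  have "P (\<Sum>\<mu>\<in>A. Poly_Mapping.single \<mu> (c \<mu>))" if "finite A" for A c
    using that
  proof induction
    case empty
    \<comment> \<open>A single term with coefficient 0 is the zero element, which is why the rule
      has no separate zero case.\<close>
    show ?case using assms(1)[of undefined 0] by simp
  next
    case (insert \<mu> A)
    then show ?case by (simp add: assms)
  qed
  then show ?thesis
    by (subst mpol_sum_single) auto
qed

text \<open>The coefficient map is a parameter so that one set of homomorphism rules covers both
  evaluation at a point (identity on the field) and substitution of polynomials for the variables
  (\<open>const\<close>).\<close>

definition insertion ::
    "('k \<Rightarrow> 'r) \<Rightarrow> ('v \<Rightarrow> 'r) \<Rightarrow> ('v::finite, 'k::field) mpol \<Rightarrow> 'r::comm_ring_1" where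
  "insertion \<phi> z f =
     (\<Sum>\<mu>\<in>Poly_Mapping.keys f. \<phi> (Poly_Mapping.lookup f \<mu>) *
        (\<Prod>v\<in>UNIV. z v ^ Poly_Mapping.lookup \<mu> v))"

locale coeff_hom =
  fixes \<phi> :: "'k::field \<Rightarrow> 'r::comm_ring_1"
  assumes \<phi>_add: "\<phi> (a + b) = \<phi> a + \<phi> b"
    and \<phi>_mult: "\<phi> (a * b) = \<phi> a * \<phi> b"
    and \<phi>_one: "\<phi> 1 = 1"
begin

lemma \<phi>_zero: "\<phi> 0 = 0"
  using \<phi>_add[of 0 0] by simp

lemma insertion_superset:
  assumes "finite A" "Poly_Mapping.keys f \<subseteq> A"
  shows "insertion \<phi> z f =
    (\<Sum>\<mu>\<in>A. \<phi> (Poly_Mapping.lookup f \<mu>) * (\<Prod>v\<in>UNIV. z v ^ Poly_Mapping.lookup \<mu> v))"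
  unfolding insertion_def
  using assms by (intro sum.mono_neutral_left) (auto simp: in_keys_iff \<phi>_zero)

lemma insertion_add: "insertion \<phi> z (f + g) = insertion \<phi> z f + insertion \<phi> z g"
proof -
  let ?A = "Poly_Mapping.keys f \<union> Poly_Mapping.keys g"
  have "Poly_Mapping.keys (f + g) \<subseteq> ?A" by (rule keys_add)
  then show ?thesis
    by (simp add: insertion_superset[of ?A] lookup_add \<phi>_add algebra_simps sum.distrib)
qed

lemma insertion_single:
  "insertion \<phi> z (Poly_Mapping.single \<mu> c) = \<phi> c * (\<Prod>v\<in>UNIV. z v ^ Poly_Mapping.lookup \<mu> v)"
  by (cases "c = 0") (auto simp: insertion_def \<phi>_zero)

lemma insertion_mult: "insertion \<phi> z (f * g) = insertion \<phi> z f * insertion \<phi> z g"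
proof (induction f rule: mpol_induct)
  case (single \<mu> c)
  show ?case
  proof (induction g rule: mpol_induct)
    case (single \<nu> d)
    show ?case
      by (simp add: mult_single insertion_single \<phi>_mult lookup_add power_add prod.distrib
          algebra_simps)
  next
    case (add f g)
    then show ?case by (simp add: distrib_left insertion_add)
  qed
next
  case (add f g)
  then show ?case by (simp add: distrib_right insertion_add)
qed

lemma insertion_one: "insertion \<phi> z 1 = 1"
  using insertion_single[of z 0 1] by (simp add: \<phi>_one)

lemma insertion_zero: "insertion \<phi> z 0 = 0"
  by (simp add: insertion_def)

lemma insertion_minus: "insertion \<phi> z (f - g) = insertion \<phi> z f - insertion \<phi> z g"
  using insertion_add[of z "f - g" g] by (simp add: algebra_simps)

lemma insertion_sum: "insertion \<phi> z (sum f A) = (\<Sum>a\<in>A. insertion \<phi> z (f a))"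
  by (induction A rule: infinite_finite_induct) (auto simp: insertion_zero insertion_add)

lemma insertion_prod: "insertion \<phi> z (prod f A) = (\<Prod>a\<in>A. insertion \<phi> z (f a))"
  by (induction A rule: infinite_finite_induct) (auto simp: insertion_one insertion_mult)

lemma insertion_power: "insertion \<phi> z (f ^ r) = insertion \<phi> z f ^ r"
  by (induction r) (auto simp: insertion_one insertion_mult)

lemma insertion_const: "insertion \<phi> z (Poly_Mapping.single 0 c) = \<phi> c"
  by (simp add: insertion_single)

lemma insertion_var:
  "insertion \<phi> z (Poly_Mapping.single (Poly_Mapping.single v 1) c) = \<phi> c * z v"
proof -
  have "(\<Prod>w\<in>UNIV. z w ^ Poly_Mapping.lookup (Poly_Mapping.single v (1::nat)) w) = z v"
    by (subst prod.remove[of _ v]) (auto simp: lookup_single when_def intro!: prod.neutral)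
  then show ?thesis by (simp add: insertion_single)
qed

lemmas insertion_hom = insertion_add insertion_mult insertion_one insertion_zero insertion_minus
  insertion_sum insertion_prod insertion_power insertion_const insertion_var

end

abbreviation const :: "'k::zero \<Rightarrow> ('v, 'k) mpol" where
  "const c \<equiv> Poly_Mapping.single 0 c"

abbreviation var :: "'v \<Rightarrow> ('v, 'k::zero_neq_one) mpol" where
  "var v \<equiv> Poly_Mapping.single (Poly_Mapping.single v 1) 1"

interpretation id_hom: coeff_hom "\<lambda>x::'k::field. x"
  by standard auto

interpretation const_hom:
    coeff_hom "\<lambda>c::'k::field. const c :: ('v, 'k) mpol"
  by standard (auto simp: single_add mult_single)

lemma single_expand:
  "Poly_Mapping.single \<mu> c =
    const c * (\<Prod>v\<in>UNIV. var v ^ Poly_Mapping.lookup \<mu> v :: ('v::finite, 'k::field) mpol)"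
proof -
  have p: "var v ^ r = Poly_Mapping.single (Poly_Mapping.single v r) (1::'k)" for v :: 'v and r
    by (induction r) (auto simp: mult_single single_add[symmetric])
  have "(\<Prod>v\<in>A. Poly_Mapping.single (h v) (1::'k)) =
      Poly_Mapping.single (\<Sum>v\<in>A. h v) 1" if "finite A" for h :: "'v \<Rightarrow> 'v \<Rightarrow>\<^sub>0 nat" and A
    using that by induction (auto simp: mult_single)
  moreover have "(\<Sum>v\<in>UNIV. Poly_Mapping.single v (Poly_Mapping.lookup \<mu> v)) = \<mu>"
    by (intro poly_mapping_eqI) (auto simp: lookup_sum lookup_single when_def)
  ultimately show ?thesis by (simp add: p mult_single del: One_nat_def)
qed

lemma insertion_self: "insertion (\<lambda>c. const c) (\<lambda>v. var v) f = f"
  by (induction f rule: mpol_induct)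
     (simp_all only: const_hom.insertion_single const_hom.insertion_add single_expand[symmetric])

lemma single_Suc_factor:
  assumes "Poly_Mapping.lookup \<mu> v \<noteq> 0"
  obtains \<nu> where "\<mu> = Poly_Mapping.single v 1 + \<nu>"
    and "\<And>c. Poly_Mapping.single \<mu> c = var v * Poly_Mapping.single \<nu> (c :: 'k::field)"
proof
  let ?\<nu> = "\<mu> - Poly_Mapping.single v 1"
  show *: "\<mu> = Poly_Mapping.single v 1 + ?\<nu>"
    using assms
    by (intro poly_mapping_eqI) (auto simp: lookup_add lookup_minus lookup_single when_def)
  show "Poly_Mapping.single \<mu> c = var v * Poly_Mapping.single ?\<nu> (c :: 'k::field)" for c
    by (subst *) (simp add: mult_single)
qed

lemma lookup_single_mult:
  "Poly_Mapping.lookup (Poly_Mapping.single \<mu> c * f) (\<mu> + \<nu>) =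
    c * Poly_Mapping.lookup (f :: ('v::finite, 'k::field) mpol) \<nu>"
  by (induction f rule: mpol_induct)
     (auto simp: mult_single lookup_single when_def distrib_left lookup_add)

text \<open>Multiplication by a variable only shifts exponents, so no coefficient is lost. General
  linear forms are reduced to this case by a change of coordinates.\<close>

lemma var_mult_eq_0: "var v * f = 0 \<Longrightarrow> f = (0 :: ('v::finite, 'k::field) mpol)"
  by (intro poly_mapping_eqI) (metis lookup_single_mult lookup_zero mult_1)


definition linform :: "('v \<Rightarrow> 'k) \<Rightarrow> ('v::finite, 'k::field) mpol" where
  "linform c = (\<Sum>v\<in>UNIV. Poly_Mapping.single (Poly_Mapping.single v 1) (c v))"


lemma linform_add: "linform c + linform d = linform (\<lambda>v. c v + d v)"
  by (simp add: linform_def single_add sum.distrib)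

lemma linform_const_mult: "const a * linform c = linform (\<lambda>v. a * c v)"
  by (simp add: linform_def sum_distrib_left mult_single)

lemma var_eq_linform:
  "(var v :: ('v::finite, 'k::field) mpol) = linform (\<lambda>w. if w = v then 1 else 0)"
  unfolding linform_def by (subst sum.remove[of _ v]) (auto intro!: sum.neutral)

lemma linform_zero: "linform (\<lambda>v. 0) = 0"
  by (simp add: linform_def)

lemma linform_diff: "linform c - linform d = linform (\<lambda>v. c v - d v)"
  using linform_add[of "\<lambda>v. c v - d v" d] by (simp add: algebra_simps)

lemma linform_sum: "(\<Sum>a\<in>A. linform (c a)) = linform (\<lambda>v. \<Sum>a\<in>A. c a v)"
  by (induction A rule: infinite_finite_induct) (auto simp: linform_zero linform_add)

lemma (in coeff_hom) insertion_linform: "insertion \<phi> z (linform c) = (\<Sum>v\<in>UNIV. \<phi> (c v) * z v)"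
  by (simp add: linform_def insertion_sum insertion_var del: One_nat_def)

lemma linform_expand: "linform c = (\<Sum>v\<in>UNIV. const (c v) * var v)"
  by (simp add: linform_def mult_single)

lemma insertion_insertion:
  "insertion const z (insertion const z' f) = insertion const (\<lambda>v. insertion const z (z' v)) f"
  by (induction f rule: mpol_induct)
    (simp_all add: const_hom.insertion_single const_hom.insertion_hom del: One_nat_def)

text \<open>Solving for a variable \<open>v\<close> with nonzero coefficient gives a substitution
  \<open>s\<close> that turns the form into \<open>var v\<close>; \<open>s'\<close> undoes it, so
  \<open>s\<close> is injective on polynomials.\<close>

lemma linform_mult_eq_0:
  fixes f :: "('v::finite, 'k::field) mpol"
  assumes "c v \<noteq> 0" and "linform c * f = 0"
  shows "f = 0"
proof -
  define s :: "'v \<Rightarrow> ('v, 'k) mpol" where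
    "s w = (if w = v then const (1 / c v) * (var v - linform (c(v := 0))) else var w)" for w
  define s' :: "'v \<Rightarrow> ('v, 'k) mpol" where
    "s' w = (if w = v then linform c else var w)" for w
  have split: "(\<Sum>w\<in>UNIV. h w) = h v + (\<Sum>w\<in>UNIV - {v}. h w)" for h :: "'v \<Rightarrow> ('v, 'k) mpol"
    by (simp add: sum.remove[of _ v])
  have upd: "linform (c(v := 0)) = (\<Sum>w\<in>UNIV - {v}. const (c w) * var w)"
    unfolding linform_expand by (subst split) simp
  have "insertion const s (linform c) = var v"
  proof -
    have "insertion const s (linform c) =
        const (c v) * s v + (\<Sum>w\<in>UNIV - {v}. const (c w) * s w)"
      unfolding const_hom.insertion_linform by (rule split)
    also have "(\<Sum>w\<in>UNIV - {v}. const (c w) * s w) = linform (c(v := 0))"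
      unfolding upd by (intro sum.cong) (auto simp: s_def)
    also have "const (c v) * s v = (const (c v) * const (1 / c v)) * (var v - linform (c(v := 0)))"
      by (simp add: s_def mult.assoc)
    also have "const (c v) * const (1 / c v) = (1 :: ('v, 'k) mpol)"
      using assms(1) by (simp add: mult_single)
    finally show ?thesis by simp
  qed
  then have "var v * insertion const s f = 0"
    using arg_cong[OF assms(2), of "insertion const s"]
    by (simp add: const_hom.insertion_mult const_hom.insertion_zero)
  then have "insertion const s f = 0" by (rule var_mult_eq_0)
  moreover have "insertion const s' (s w) = var w" for w
  proof (cases "w = v")
    case True
    have "insertion const s' (linform (c(v := 0))) = linform (c(v := 0))"
      unfolding const_hom.insertion_linform unfolding linform_expand
      by (intro sum.cong) (auto simp: s'_def)
    moreover have "linform c - linform (c(v := 0)) = const (c v) * var v"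
      unfolding upd unfolding linform_expand by (subst split) simp
    moreover have "const (1 / c v) * (const (c v) * var v) = (var v :: ('v, 'k) mpol)"
      using assms(1) by (simp add: mult_single)
    ultimately show ?thesis
      using True by (simp add: s_def const_hom.insertion_hom s'_def del: One_nat_def)
  next
    case False
    then show ?thesis
      by (simp add: s_def const_hom.insertion_hom s'_def del: One_nat_def)
  qed
  ultimately show "f = 0"
    using insertion_insertion[of s' s f] insertion_self[of f]
    by (simp add: const_hom.insertion_zero del: One_nat_def)
qed


section \<open>Ideals and sequences of linear forms\<close>

definition is_ideal :: "'r::comm_ring_1 set \<Rightarrow> bool" where
  "is_ideal K \<longleftrightarrow> 0 \<in> K \<and> (\<forall>a\<in>K. \<forall>b\<in>K. a + b \<in> K) \<and> (\<forall>r. \<forall>a\<in>K. r * a \<in> K)"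

lemma is_idealD:
  assumes "is_ideal K"
  shows "0 \<in> K" and "a \<in> K \<Longrightarrow> b \<in> K \<Longrightarrow> a + b \<in> K" and "a \<in> K \<Longrightarrow> r * a \<in> K"
    and "a \<in> K \<Longrightarrow> a * r \<in> K" and "a \<in> K \<Longrightarrow> - a \<in> K"
    and "a \<in> K \<Longrightarrow> b \<in> K \<Longrightarrow> a - b \<in> K"
proof -
  show "0 \<in> K" and add: "a \<in> K \<Longrightarrow> b \<in> K \<Longrightarrow> a + b \<in> K" and mult: "a \<in> K \<Longrightarrow> r * a \<in> K" for a b r
    using assms by (auto simp: is_ideal_def)
  show "a \<in> K \<Longrightarrow> a * r \<in> K" and neg: "a \<in> K \<Longrightarrow> - a \<in> K" for a
    using mult[of a r] mult[of a "-1"] by (auto simp: mult.commute)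
  show "a \<in> K \<Longrightarrow> b \<in> K \<Longrightarrow> a - b \<in> K"
    using add[of a "- b"] neg[of b] by simp
qed

lemma is_ideal_sum: "is_ideal K \<Longrightarrow> (\<And>a. a \<in> A \<Longrightarrow> f a \<in> K) \<Longrightarrow> sum f A \<in> K"
  by (induction A rule: infinite_finite_induct) (auto intro: is_idealD)

lemma is_ideal_diff_mult:
  assumes "is_ideal K" "a - a' \<in> K" "b - b' \<in> K"
  shows "a * b - a' * b' \<in> K"
proof -
  have "a * b - a' * b' = a * (b - b') + b' * (a - a')" by (simp add: algebra_simps)
  then show ?thesis using assms is_idealD[OF assms(1)] by simp
qed

text \<open>Sums and products respect congruence modulo \<open>K\<close>. Mostly used with
  \<open>z'\<close> the identity substitution: then \<open>z\<close> moves no polynomial out of its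
  class modulo \<open>K\<close>.\<close>

lemma insertion_cong_ideal:
  assumes K: "is_ideal K" and z: "\<And>v. z v - z' v \<in> K"
  shows "insertion const z f - insertion const z' f \<in> K"
proof (induction f rule: mpol_induct)
  case (single \<mu> c)
  have pow: "z v ^ r - z' v ^ r \<in> K" for v r
    by (induction r) (auto intro: is_ideal_diff_mult[OF K] z is_idealD[OF K])
  have prod: "(\<Prod>v\<in>A. z v ^ e v) - (\<Prod>v\<in>A. z' v ^ e v) \<in> K" if "finite A" for A e
    using that by induction (auto intro: is_ideal_diff_mult[OF K] pow is_idealD[OF K])
  then show ?case
    unfolding const_hom.insertion_single
    by (intro is_ideal_diff_mult[OF K] prod) (auto simp: is_idealD[OF K])
next
  case (add f g)
  from is_idealD(2)[OF K this] show ?case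
    by (simp add: const_hom.insertion_add algebra_simps)
qed

definition adjoin :: "'r::comm_ring_1 set \<Rightarrow> 'r \<Rightarrow> 'r set" where
  "adjoin K \<theta> = {k + \<theta> * a |k a. k \<in> K}"

lemma adjoinI: "k \<in> K \<Longrightarrow> k + \<theta> * a \<in> adjoin K \<theta>"
  by (auto simp: adjoin_def)

lemma adjoinE:
  assumes "f \<in> adjoin K \<theta>" obtains k a where "k \<in> K" "f = k + \<theta> * a"
  using assms by (auto simp: adjoin_def)

lemma is_ideal_adjoin:
  assumes "is_ideal K"
  shows "is_ideal (adjoin K \<theta>)"
  unfolding is_ideal_def
proof (intro conjI ballI allI)
  show "0 \<in> adjoin K \<theta>"
    using adjoinI[of 0 K \<theta> 0] is_idealD[OF assms] by simp
next
  fix a b assume "a \<in> adjoin K \<theta>" "b \<in> adjoin K \<theta>"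
  then obtain k x l y where *: "k \<in> K" "l \<in> K" "a = k + \<theta> * x" "b = l + \<theta> * y"
    by (meson adjoinE)
  then have "a + b = (k + l) + \<theta> * (x + y)" by (simp add: algebra_simps)
  then show "a + b \<in> adjoin K \<theta>"
    using adjoinI[OF is_idealD(2)[OF assms *(1,2)], of \<theta> "x + y"] by simp
next
  fix r a assume "a \<in> adjoin K \<theta>"
  then obtain k x where *: "k \<in> K" "a = k + \<theta> * x" by (meson adjoinE)
  then have "r * a = r * k + \<theta> * (r * x)" by (simp add: algebra_simps)
  then show "r * a \<in> adjoin K \<theta>"
    using adjoinI[OF is_idealD(3)[OF assms *(1)], of r \<theta> "r * x"] by simp
qed

lemma adjoin_superset: "a \<in> K \<Longrightarrow> a \<in> adjoin K \<theta>"
  using adjoinI[of a K \<theta> 0] by simp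

lemma adjoin_gen: "is_ideal K \<Longrightarrow> \<theta> * a \<in> adjoin K \<theta>"
  using adjoinI[of 0 K \<theta> a] by (simp add: is_idealD)

lemma adjoin_gen': "is_ideal K \<Longrightarrow> \<theta> \<in> adjoin K \<theta>"
  using adjoin_gen[of K \<theta> 1] by simp

primrec seq_ideal :: "(nat \<Rightarrow> 'r::comm_ring_1) \<Rightarrow> nat \<Rightarrow> 'r set" where
  "seq_ideal \<theta> 0 = {0}"
| "seq_ideal \<theta> (Suc r) = adjoin (seq_ideal \<theta> r) (\<theta> r)"

lemma is_ideal_seq_ideal: "is_ideal (seq_ideal \<theta> r)"
  by (induction r) (auto intro: is_ideal_adjoin, simp add: is_ideal_def)

text \<open>Gaussian elimination phrased with substitutions: \<open>z\<close> is congruent to the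
  identity modulo the ideal and kills the ideal, so membership in the ideal becomes vanishing under
  \<open>z\<close>.\<close>

lemma linear_retraction:
  fixes \<theta> :: "nat \<Rightarrow> ('v::finite, 'k::field) mpol"
  assumes "\<And>i. i < r \<Longrightarrow> \<theta> i \<in> range linform"
  shows "\<exists>z. range z \<subseteq> range linform \<and> (\<forall>v. z v - var v \<in> seq_ideal \<theta> r) \<and>
    (\<forall>f\<in>seq_ideal \<theta> r. insertion const z f = 0)"
  using assms
proof (induction r)
  case 0
  have "insertion const z 0 = 0" for z :: "'v \<Rightarrow> ('v, 'k) mpol"
    by (rule const_hom.insertion_zero)
  then show ?case
    by (intro exI[of _ "\<lambda>v. var v"]) (auto simp: var_eq_linform simp del: One_nat_def)
next
  case (Suc r)
  let ?K = "seq_ideal \<theta> r"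
  obtain z where z: "range z \<subseteq> range linform" "\<And>v. z v - var v \<in> ?K"
    "\<And>f. f \<in> ?K \<Longrightarrow> insertion const z f = 0"
    using Suc.IH Suc.prems by (metis less_Suc_eq)
  note K = is_ideal_seq_ideal[of \<theta> r]
  note K' = is_ideal_seq_ideal[of \<theta> "Suc r", simplified]
  have zlin: "insertion const y (linform c) \<in> range linform"
    if "range y \<subseteq> range linform" for y :: "'v \<Rightarrow> ('v, 'k) mpol" and c
  proof -
    have "\<forall>v. \<exists>d. y v = linform d" using that by blast
    then obtain d where d: "\<And>v. y v = linform (d v)" by metis
    show ?thesis
      unfolding const_hom.insertion_linform d linform_const_mult linform_sum by blast
  qed
  obtain c where c: "insertion const z (\<theta> r) = linform c"
    using Suc.prems[of r] zlin[OF z(1)] by (metis imageE lessI)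
  have diff: "insertion const z f - f \<in> ?K" for f
    using insertion_cong_ideal[OF K, of z "\<lambda>v. var v" f] z(2) by (simp add: insertion_self del: One_nat_def)
  have lin_in: "linform c \<in> adjoin ?K (\<theta> r)"
    using adjoinI[OF diff[of "\<theta> r"], of "\<theta> r" 1] by (simp add: c)
  show ?case
  proof (cases "\<exists>v. c v \<noteq> 0")
    \<comment> \<open>Here the new form already lies in the ideal of the earlier ones, so the old
      \<open>z\<close> still works.\<close>
    case False
    then have "linform c = 0" by (simp add: linform_def)
    then have "insertion const z f = 0" if "f \<in> adjoin ?K (\<theta> r)" for f
      using that z(3) c
      by (auto elim!: adjoinE simp: const_hom.insertion_hom)
    then show ?thesis
      using z by (intro exI[of _ z]) (auto simp: adjoin_superset simp del: One_nat_def)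
  next
    case True
    then obtain v where v: "c v \<noteq> 0" by blast
    \<comment> \<open>The multiple of \<open>linform c\<close> that is subtracted has coefficient 1
      at \<open>v\<close>; this makes \<open>y\<close> kill \<open>linform c\<close> while staying
      congruent to the identity modulo it.\<close>
    define y where "y w = (if w = v then var v - const (1 / c v) * linform c else var w)" for w
    have y1: "range y \<subseteq> range linform"
      by (auto simp: y_def var_eq_linform linform_const_mult linform_diff simp del: One_nat_def)
    have "insertion const y (linform c) =
        (\<Sum>w\<in>UNIV. const (c w) * var w - (if w = v then linform c else 0))"
      unfolding const_hom.insertion_linform
    proof (rule sum.cong)
      fix w
      have "const (c v) * (const (1 / c v) * linform c) = linform c"
        unfolding mult.assoc[symmetric] using v by (simp add: mult_single)
      then show "const (c w) * y w =
          const (c w) * var w - (if w = v then linform c else 0)"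
        by (auto simp: y_def right_diff_distrib)
    qed simp
    also have "\<dots> = 0"
      by (simp add: sum_subtractf linform_expand)
    finally have y2: "insertion const y (linform c) = 0" .
    define x where "x w = insertion const y (z w)" for w
    have x: "insertion const x f = insertion const y (insertion const z f)" for f
      by (simp only: insertion_insertion x_def[abs_def])
    have "range x \<subseteq> range linform"
      using z(1) zlin[OF y1] by (auto simp: x_def)
    moreover have "x w - var w \<in> adjoin ?K (\<theta> r)" for w
    proof -
      have y_in: "y u - var u \<in> adjoin ?K (\<theta> r)" for u
        using is_idealD(3)[OF K' lin_in, of "- const (1 / c v)"]
        by (simp add: y_def is_idealD[OF K'])
      have "x w - z w \<in> adjoin ?K (\<theta> r)"
        using insertion_cong_ideal[OF K', of y "\<lambda>v. var v" "z w"] y_in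
        by (simp add: x_def insertion_self del: One_nat_def)
      from is_idealD(2)[OF K' this adjoin_superset[OF z(2)[of w]]] show ?thesis by simp
    qed
    moreover have "insertion const x f = 0" if "f \<in> adjoin ?K (\<theta> r)" for f
      using that z(3) by (auto elim!: adjoinE simp: x const_hom.insertion_hom c y2)
    ultimately show ?thesis by (intro exI[of _ x]) (auto simp del: One_nat_def)
  qed
qed

text \<open>The retraction sends a form outside the ideal to a nonzero linear form, which is no zero
  divisor in the polynomial ring; so the image of \<open>f\<close> vanishes, and that puts
  \<open>f\<close> into the ideal.\<close>

lemma linform_regular_mod_linforms:
  fixes \<theta> :: "nat \<Rightarrow> ('v::finite, 'k::field) mpol"
  assumes "\<And>i. i < r \<Longrightarrow> \<theta> i \<in> range linform"
    and l: "l \<in> range linform" "l \<notin> seq_ideal \<theta> r" and f: "l * f \<in> seq_ideal \<theta> r"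
  shows "f \<in> seq_ideal \<theta> r"
proof -
  let ?K = "seq_ideal \<theta> r"
  note K = is_ideal_seq_ideal[of \<theta> r]
  obtain z where z: "range z \<subseteq> range linform" "\<And>v. z v - var v \<in> ?K"
    "\<And>f. f \<in> ?K \<Longrightarrow> insertion const z f = 0"
    using linear_retraction[of r \<theta>] assms(1) by blast
  have diff: "insertion const z f - f \<in> ?K" for f
    using insertion_cong_ideal[OF K, of z "\<lambda>v. var v" f] z(2) by (simp add: insertion_self del: One_nat_def)
  then have zero: "f \<in> ?K" if "insertion const z f = 0" for f
    using that is_idealD(5)[OF K diff[of f]] by simp
  have "\<forall>v. \<exists>d. z v = linform d" using z(1) by blast
  then obtain d where d: "\<And>v. z v = linform (d v)" by metis
  obtain e where e: "l = linform e" using l by blast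
  have "insertion const z l \<in> range linform"
    unfolding e const_hom.insertion_linform d linform_const_mult linform_sum by blast
  then obtain c where c: "insertion const z l = linform c" by blast
  have "linform c \<noteq> 0" using zero[of l] l c by auto
  then obtain v where "c v \<noteq> 0" by (metis linform_zero ext)
  moreover have "linform c * insertion const z f = 0"
    using z(3)[OF f] by (simp add: c const_hom.insertion_mult)
  ultimately have "insertion const z f = 0" by (rule linform_mult_eq_0)
  then show ?thesis by (rule zero)
qed

section \<open>Regular sequences on complexes of free modules\<close>

definition fscale :: "'r::comm_ring_1 \<Rightarrow> ('b \<Rightarrow> 'r) \<Rightarrow> 'b \<Rightarrow> 'r" where
  "fscale r f = (\<lambda>e. r * f e)"

lemma fscale_simps:
  "fscale r (f + g) = fscale r f + fscale r g" "fscale r (f - g) = fscale r f - fscale r g"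
  "fscale r (fscale s f) = fscale s (fscale r f)" "fscale r 0 = 0"
  by (auto simp: fscale_def algebra_simps fun_eq_iff)

text \<open>The degree \<open>i\<close> part of the complex consists of the functions supported on \<open>E i\<close>, and \<open>A i\<close> is
  the matrix of the differential from degree \<open>i + 1\<close> to degree \<open>i\<close>.\<close>

locale matrix_complex =
  fixes E :: "nat \<Rightarrow> 'b set" and A :: "nat \<Rightarrow> 'b \<Rightarrow> 'b \<Rightarrow> 'r::comm_ring_1"
  assumes finite_E: "finite (E i)"
    and A_supp: "e' \<notin> E i \<Longrightarrow> A i e e' = 0"
begin

text \<open>For a free module F_i, the submodule K F_i consists of the vectors all of whose entries
  lie in \<open>K\<close>; this describes it without sums of products.\<close>

definition supp :: "nat \<Rightarrow> 'r set \<Rightarrow> ('b \<Rightarrow> 'r) set" where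
  "supp i K = {f. (\<forall>e. e \<notin> E i \<longrightarrow> f e = 0) \<and> (\<forall>e. f e \<in> K)}"

abbreviation free :: "nat \<Rightarrow> ('b \<Rightarrow> 'r) set" where
  "free i \<equiv> supp i UNIV"

definition diff :: "nat \<Rightarrow> ('b \<Rightarrow> 'r) \<Rightarrow> 'b \<Rightarrow> 'r" where
  "diff i f = (\<lambda>e'. \<Sum>e\<in>E (Suc i). f e * A i e e')"

text \<open>The preimage in F_i of the boundaries of F/KF. Working with it avoids quotient
  modules.\<close>

definition bdry :: "'r set \<Rightarrow> nat \<Rightarrow> ('b \<Rightarrow> 'r) set" where
  "bdry K i = {diff i v + k |v k. v \<in> free (Suc i) \<and> k \<in> supp i K}"

text \<open>The index is shifted: \<open>i\<close> means vanishing homology of F/KF in degree i + 1,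
  so index 0 speaks of H_1 and H_0 is never included.\<close>

definition exact_mod :: "'r set \<Rightarrow> nat \<Rightarrow> bool" where
  "exact_mod K i \<longleftrightarrow> (\<forall>u\<in>free (Suc i). diff i u \<in> supp i K \<longrightarrow> u \<in> bdry K (Suc i))"

lemma supp_mono: "f \<in> supp i K \<Longrightarrow> K \<subseteq> L \<Longrightarrow> f \<in> supp i L"
  by (auto simp: supp_def)

lemma is_ideal_UNIV: "is_ideal UNIV"
  by (simp add: is_ideal_def)

lemma supp_closed:
  assumes "is_ideal K"
  shows "0 \<in> supp i K" "f \<in> supp i K \<Longrightarrow> g \<in> supp i K \<Longrightarrow> f + g \<in> supp i K"
    "f \<in> supp i K \<Longrightarrow> g \<in> supp i K \<Longrightarrow> f - g \<in> supp i K"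
    "f \<in> supp i K \<Longrightarrow> fscale r f \<in> supp i K"
  using assms by (auto simp: supp_def fscale_def intro: is_idealD)

lemmas free_closed = supp_closed[OF is_ideal_UNIV]

lemma diff_simps:
  "diff i (f + g) = diff i f + diff i g" "diff i (f - g) = diff i f - diff i g"
  "diff i (fscale r f) = fscale r (diff i f)" "diff i 0 = 0"
  by (auto simp: diff_def fscale_def fun_eq_iff sum.distrib sum_subtractf sum_distrib_left
      algebra_simps)

lemma diff_supp: "is_ideal K \<Longrightarrow> f \<in> supp (Suc i) K \<Longrightarrow> diff i f \<in> supp i K"
  by (auto simp: supp_def diff_def A_supp intro!: is_ideal_sum is_idealD(4))

lemma diff_free: "f \<in> free (Suc i) \<Longrightarrow> diff i f \<in> free i"
  by (rule diff_supp[OF is_ideal_UNIV])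

lemma bdryI: "v \<in> free (Suc i) \<Longrightarrow> k \<in> supp i K \<Longrightarrow> diff i v + k \<in> bdry K i"
  by (auto simp: bdry_def)

lemma bdryE:
  assumes "u \<in> bdry K i"
  obtains v k where "v \<in> free (Suc i)" "k \<in> supp i K" "u = diff i v + k"
  using assms by (auto simp: bdry_def)

lemma supp_adjoinI:
  assumes "is_ideal K" "k \<in> supp i K" "w \<in> free i"
  shows "k + fscale \<theta> w \<in> supp i (adjoin K \<theta>)"
  using assms by (auto simp: supp_def fscale_def intro!: adjoinI)

lemma supp_adjoinE:
  assumes "is_ideal K" "u \<in> supp i (adjoin K \<theta>)"
  obtains k w where "k \<in> supp i K" "w \<in> free i" "u = k + fscale \<theta> w"
proof -
  \<comment> \<open>Both parts are required to be 0 off \<open>E i\<close>, so that the functions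
    chosen from this statement are supported on \<open>E i\<close>.\<close>
  have "\<forall>e. \<exists>k a. k \<in> K \<and> u e = k + \<theta> * a \<and> (e \<notin> E i \<longrightarrow> k = 0 \<and> a = 0)"
  proof
    fix e
    show "\<exists>k a. k \<in> K \<and> u e = k + \<theta> * a \<and> (e \<notin> E i \<longrightarrow> k = 0 \<and> a = 0)"
    proof (cases "e \<in> E i")
      case True
      have "u e \<in> adjoin K \<theta>" using assms(2) by (simp add: supp_def)
      then show ?thesis using True by (metis adjoinE)
    next
      case False
      then show ?thesis
        using assms(2) is_idealD(1)[OF assms(1)]
        by (intro exI[of _ 0]) (simp add: supp_def)
    qed
  qed
  then obtain k a where "\<And>e. k e \<in> K" "\<And>e. u e = k e + \<theta> * a e" "\<And>e. e \<notin> E i \<longrightarrow> k e = 0 \<and> a e = 0"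
    by metis
  then show thesis
    by (intro that[of k a]) (auto simp: supp_def fscale_def fun_eq_iff)
qed

lemma regular_supp:
  assumes "\<And>a. \<theta> * a \<in> K \<Longrightarrow> a \<in> K" "fscale \<theta> u \<in> supp i K" "u \<in> free i"
  shows "u \<in> supp i K"
  using assms by (auto simp: supp_def fscale_def)

text \<open>If \<open>w\<close> is the boundary of \<open>v\<close> modulo \<open>K\<close>, then
  subtracting \<open>\<theta>\<close> times \<open>v\<close> turns \<open>u\<close> into a cycle
  modulo \<open>K\<close>, hence into a boundary. The next two lemmas differ only in how
  \<open>w\<close> is seen to be a boundary.\<close>

lemma exact_mod_adjoin_aux:
  assumes K: "is_ideal K" and ex: "exact_mod K i"
    and u: "u \<in> free (Suc i)" "diff i u = k + fscale \<theta> w" "k \<in> supp i K" and w: "w \<in> bdry K i"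
  shows "u \<in> bdry (adjoin K \<theta>) (Suc i)"
proof -
  obtain v k' where v: "v \<in> free (Suc i)" "k' \<in> supp i K" "w = diff i v + k'"
    using w by (rule bdryE)
  have "diff i (u - fscale \<theta> v) = k + fscale \<theta> k'"
    by (simp add: u(2) v(3) diff_simps fscale_simps)
  moreover have "k + fscale \<theta> k' \<in> supp i K" using u(3) v(2) K by (intro supp_closed)
  moreover have "u - fscale \<theta> v \<in> free (Suc i)" using u(1) v(1) by (intro free_closed)
  ultimately have "u - fscale \<theta> v \<in> bdry K (Suc i)" using ex by (simp add: exact_mod_def)
  then obtain x l where x: "x \<in> free (Suc (Suc i))" "l \<in> supp (Suc i) K"
    "u - fscale \<theta> v = diff (Suc i) x + l" by (rule bdryE)
  then have "u = diff (Suc i) x + (l + fscale \<theta> v)" by (simp add: algebra_simps)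
  then show ?thesis using x v K by (auto intro!: bdryI supp_adjoinI)
qed

text \<open>In the long exact sequence for multiplication by \<open>\<theta>\<close> on F/KF, the
  homology of the cokernel complex in degree i + 2 sits between that of F/KF in degrees i + 2 and i
  + 1.\<close>

lemma exact_mod_adjoin:
  assumes K: "is_ideal K" and dd: "\<And>f. f \<in> free (Suc (Suc i)) \<Longrightarrow> diff i (diff (Suc i) f) = 0"
    and ex: "exact_mod K i" "exact_mod K (Suc i)"
    and reg: "\<And>a. \<theta> * a \<in> K \<Longrightarrow> a \<in> K"
  shows "exact_mod (adjoin K \<theta>) (Suc i)"
  unfolding exact_mod_def
proof (intro ballI impI)
  fix u assume u: "u \<in> free (Suc (Suc i))" "diff (Suc i) u \<in> supp (Suc i) (adjoin K \<theta>)"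
  then obtain k w where w: "k \<in> supp (Suc i) K" "w \<in> free (Suc i)" "diff (Suc i) u = k + fscale \<theta> w"
    using K by (elim supp_adjoinE)
  have "0 = diff i k + fscale \<theta> (diff i w)"
    using arg_cong[OF w(3), of "diff i"] dd[OF u(1)] by (simp add: diff_simps)
  then have "fscale \<theta> (diff i w) = 0 - diff i k"
    by (metis add_diff_cancel_left')
  also have "\<dots> \<in> supp i K"
    using w(1) K by (intro supp_closed diff_supp)
  finally have "fscale \<theta> (diff i w) \<in> supp i K" .
  then have "diff i w \<in> supp i K"
    using reg w(2) by (auto intro: regular_supp diff_free)
  then have "w \<in> bdry K (Suc i)" using ex(1) w(2) by (auto simp: exact_mod_def)
  with K ex(2) u(1) w(3,1) show "u \<in> bdry (adjoin K \<theta>) (Suc (Suc i))"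
    by (rule exact_mod_adjoin_aux)
qed

text \<open>At the bottom the neighbouring homology is H_0(F/KF), which need not vanish; injectivity
  of \<open>\<theta>\<close> on it takes the place of exactness.\<close>

lemma exact_mod_adjoin_0:
  assumes K: "is_ideal K" and ex: "exact_mod K 0"
    and reg: "\<And>w. w \<in> free 0 \<Longrightarrow> fscale \<theta> w \<in> bdry K 0 \<Longrightarrow> w \<in> bdry K 0"
  shows "exact_mod (adjoin K \<theta>) 0"
  unfolding exact_mod_def
proof (intro ballI impI)
  fix u assume u: "u \<in> free (Suc 0)" "diff 0 u \<in> supp 0 (adjoin K \<theta>)"
  then obtain k w where w: "k \<in> supp 0 K" "w \<in> free 0" "diff 0 u = k + fscale \<theta> w"
    using K by (elim supp_adjoinE)
  then have "fscale \<theta> w = diff 0 u + (0 - k)" by (simp add: algebra_simps)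
  then have "fscale \<theta> w \<in> bdry K 0"
    using w(1) u(1) K by (simp only:) (intro bdryI supp_closed)
  then have "w \<in> bdry K 0" using reg w(2) by blast
  with K ex u(1) w(3,1) show "u \<in> bdry (adjoin K \<theta>) (Suc 0)"
    by (rule exact_mod_adjoin_aux)
qed

text \<open>A socle element of the cokernel of F_{i+1} -> F_i modulo \<open>K\<close>, not of the
  homology: \<open>u\<close> need not be a cycle.\<close>

definition socle :: "'r set \<Rightarrow> 'r set \<Rightarrow> nat \<Rightarrow> ('b \<Rightarrow> 'r) \<Rightarrow> bool" where
  "socle I K i u \<longleftrightarrow> u \<in> free i \<and> u \<notin> bdry K i \<and> (\<forall>a\<in>I. fscale a u \<in> bdry K i)"

text \<open>As \<open>\<theta>\<close> kills the class of \<open>u\<close>, some \<open>v\<close>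
  has differential \<open>\<theta>\<close> times \<open>u\<close> modulo \<open>K\<close>; it is a
  snake-lemma preimage of \<open>u\<close>. If \<open>v\<close> were a boundary modulo
  \<open>K\<close> and \<open>\<theta>\<close>, cancelling \<open>\<theta>\<close> would make
  \<open>u\<close> a boundary modulo \<open>K\<close>.\<close>

lemma socle_adjoin:
  assumes K: "is_ideal K" and dd: "\<And>f. f \<in> free (Suc (Suc i)) \<Longrightarrow> diff i (diff (Suc i) f) = 0"
    and ex: "exact_mod K i" and \<theta>: "\<theta> \<in> I" and reg: "\<And>a. \<theta> * a \<in> K \<Longrightarrow> a \<in> K"
    and u: "socle I K i u"
  shows "\<exists>v. socle I (adjoin K \<theta>) (Suc i) v"
proof -
  have uf: "u \<in> free i" "u \<notin> bdry K i" using u by (auto simp: socle_def)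
  have "fscale \<theta> u \<in> bdry K i" using u \<theta> by (auto simp: socle_def)
  then obtain v k where v: "v \<in> free (Suc i)" "k \<in> supp i K" "fscale \<theta> u = diff i v + k"
    by (rule bdryE)
  have "v \<notin> bdry (adjoin K \<theta>) (Suc i)"
  proof
    assume "v \<in> bdry (adjoin K \<theta>) (Suc i)"
    then obtain x l where x: "x \<in> free (Suc (Suc i))" "l \<in> supp (Suc i) (adjoin K \<theta>)"
      "v = diff (Suc i) x + l" by (rule bdryE)
    then obtain l' w where l: "l' \<in> supp (Suc i) K" "w \<in> free (Suc i)" "l = l' + fscale \<theta> w"
      using K by (elim supp_adjoinE)
    have "fscale \<theta> (u - diff i w) = diff i l' + k"
      unfolding fscale_simps v(3) x(3) l(3) by (simp add: diff_simps dd x(1))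
    then have "fscale \<theta> (u - diff i w) \<in> supp i K"
      using l v K by (auto intro!: supp_closed diff_supp)
    then have "u - diff i w \<in> supp i K"
      using reg uf(1) l(2) by (auto intro!: free_closed diff_free intro: regular_supp)
    from bdryI[OF l(2) this] uf(2) show False by simp
  qed
  moreover have "fscale a v \<in> bdry (adjoin K \<theta>) (Suc i)" if a: "a \<in> I" for a
  proof -
    have "fscale a u \<in> bdry K i" using a u by (simp add: socle_def)
    then obtain w k1 where w: "w \<in> free (Suc i)" "k1 \<in> supp i K" "fscale a u = diff i w + k1"
      by (rule bdryE)
    \<comment> \<open>Both terms have the same differential modulo \<open>K\<close>, namely
      \<open>a\<close> times \<open>\<theta>\<close> times \<open>u\<close>, so their difference is
      a cycle modulo \<open>K\<close>.\<close>
    have "diff i (fscale a v - fscale \<theta> w) = fscale a (diff i v + k) - fscale \<theta> (diff i w + k1)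
        - fscale a k + fscale \<theta> k1"
      by (simp add: diff_simps fscale_simps)
    also have "\<dots> = fscale \<theta> k1 - fscale a k"
      unfolding v(3)[symmetric] w(3)[symmetric] by (simp add: fscale_simps)
    also have "\<dots> \<in> supp i K" using v(2) w(2) K by (intro supp_closed)
    finally have "diff i (fscale a v - fscale \<theta> w) \<in> supp i K" .
    moreover have "fscale a v - fscale \<theta> w \<in> free (Suc i)"
      using v(1) w(1) by (intro free_closed)
    ultimately have "fscale a v - fscale \<theta> w \<in> bdry K (Suc i)"
      using ex by (simp add: exact_mod_def)
    then obtain x l where x: "x \<in> free (Suc (Suc i))" "l \<in> supp (Suc i) K"
      "fscale a v - fscale \<theta> w = diff (Suc i) x + l" by (rule bdryE)
    then have "fscale a v = diff (Suc i) x + (l + fscale \<theta> w)" by (simp add: algebra_simps)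
    then show ?thesis using x w K by (auto intro!: bdryI supp_adjoinI)
  qed
  ultimately show ?thesis using v(1) by (auto simp: socle_def)
qed

end

text \<open>A case of the Auslander--Buchsbaum formula: depth two is witnessed by the regular sequence
  \<open>\<theta> 0, \<theta> 1\<close> and the socle element \<open>u\<close> modulo it. The map \<open>f \<mapsto> \<Sum>e. f e * s e\<close> presents the cyclic
  module with annihilator \<open>J\<close>.\<close>

lemma (in matrix_complex) length_eq_of_depth_two:
  fixes \<theta> :: "nat \<Rightarrow> 'r"
  assumes dd: "\<And>i f. f \<in> free (Suc (Suc i)) \<Longrightarrow> diff i (diff (Suc i) f) = 0"
    and ex: "\<And>i f. f \<in> free (Suc i) \<Longrightarrow> diff i f = 0 \<Longrightarrow> f \<in> diff (Suc i) ` free (Suc (Suc i))"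
    and J: "is_ideal J"
    and h0: "\<And>f. f \<in> free 0 \<Longrightarrow> (\<Sum>e\<in>E 0. f e * s e) \<in> J \<longleftrightarrow> f \<in> diff 0 ` free 1"
    and f1: "f1 \<in> free 0" "(\<Sum>e\<in>E 0. f1 e * s e) - 1 \<in> J"
    and I: "is_ideal I" "1 \<notin> I" "\<And>i e e'. A i e e' \<in> I"
    and I\<theta>: "I \<subseteq> seq_ideal \<theta> (Suc (Suc r))" "\<And>i. i < Suc (Suc r) \<Longrightarrow> \<theta> i \<in> I"
    and reg: "\<And>i a. i < Suc (Suc r) \<Longrightarrow> \<theta> i * a \<in> seq_ideal \<theta> i \<Longrightarrow> a \<in> seq_ideal \<theta> i"
    and regJ: "\<And>a. \<theta> 0 * a \<in> J \<Longrightarrow> a \<in> J"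
      "\<And>a. \<theta> 1 * a \<in> adjoin J (\<theta> 0) \<Longrightarrow> a \<in> adjoin J (\<theta> 0)"
    and u: "u \<notin> adjoin (adjoin J (\<theta> 0)) (\<theta> 1)"
      "\<And>a. a \<in> I \<Longrightarrow> a * u \<in> adjoin (adjoin J (\<theta> 0)) (\<theta> 1)"
  shows "E r \<noteq> {} \<and> (\<forall>i>r. E i = {})"
proof -
  let ?\<phi> = "\<lambda>f. \<Sum>e\<in>E 0. f e * s e"
  have \<phi>_add: "?\<phi> (f + g) = ?\<phi> f + ?\<phi> g" and \<phi>_minus: "?\<phi> (f - g) = ?\<phi> f - ?\<phi> g"
    and \<phi>_scale: "?\<phi> (fscale a f) = a * ?\<phi> f" for f g a
    by (simp_all add: fscale_def algebra_simps sum.distrib sum_subtractf sum_distrib_left)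
  \<comment> \<open>Through the generators \<open>s\<close>, this identifies H_0(F/KF) with the ring
    modulo J + K.\<close>
  have bdry0: "f \<in> bdry K 0 \<longleftrightarrow> (\<exists>j\<in>J. ?\<phi> f - j \<in> K)" if f: "f \<in> free 0" and K: "is_ideal K" for f K
  proof
    assume "f \<in> bdry K 0"
    then obtain v k where v: "v \<in> free 1" "k \<in> supp 0 K" "f = diff 0 v + k"
      by (auto elim: bdryE)
    have "?\<phi> (diff 0 v) \<in> J" using h0 v diff_free by auto
    moreover have "?\<phi> k \<in> K"
      using v K by (auto simp: supp_def intro!: is_ideal_sum is_idealD(4))
    ultimately show "\<exists>j\<in>J. ?\<phi> f - j \<in> K"
      unfolding v(3) \<phi>_add by (auto intro!: bexI[of _ "?\<phi> (diff 0 v)"])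
  next
    assume "\<exists>j\<in>J. ?\<phi> f - j \<in> K"
    then obtain j where j: "j \<in> J" "?\<phi> f - j \<in> K" by blast
    let ?k = "?\<phi> f - j"
    \<comment> \<open>Since \<open>f1\<close> lifts 1, subtracting the multiple of it by
      \<open>?k\<close> moves the image of \<open>f\<close> into \<open>J\<close>, where
      \<open>h0\<close> applies.\<close>
    have "?\<phi> (f - fscale ?k f1) = j - ?k * (?\<phi> f1 - 1)"
      unfolding \<phi>_minus \<phi>_scale by (simp add: algebra_simps)
    also have "\<dots> \<in> J" using j(1) f1(2) J by (auto intro: is_idealD)
    finally have "f - fscale ?k f1 \<in> diff 0 ` free 1"
      using h0[of "f - fscale ?k f1"] f f1 by (auto intro!: free_closed)
    then obtain v where v: "v \<in> free 1" "f - fscale ?k f1 = diff 0 v" by blast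
    then have "f = diff 0 v + fscale ?k f1" by (simp add: algebra_simps)
    moreover have "fscale ?k f1 \<in> supp 0 K"
      using f1(1) j(2) K by (auto simp: supp_def fscale_def intro: is_idealD)
    ultimately show "f \<in> bdry K 0" using v(1) bdryI[of v 0 "fscale ?k f1" K] by auto
  qed
  note K = is_ideal_seq_ideal[of \<theta>]
  let ?J2 = "adjoin (adjoin J (\<theta> 0)) (\<theta> 1)"
  \<comment> \<open>J + (K + (t)) = (J + K) + (t). It relates adjoining the forms to the zero ideal,
    as done for the complex, to adjoining them to \<open>J\<close>, as done for the cyclic
    module.\<close>
  have J_adjoin: "(\<exists>j\<in>J. a - j \<in> adjoin K t) \<longleftrightarrow> a \<in> adjoin L t"
    if JL: "\<And>b. (\<exists>j\<in>J. b - j \<in> K) \<longleftrightarrow> b \<in> L" for a K L t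
  proof
    assume "\<exists>j\<in>J. a - j \<in> adjoin K t"
    then obtain j k b where "j \<in> J" "k \<in> K" "a - j = k + t * b" by (meson adjoinE)
    then have "j + k \<in> L" "a = (j + k) + t * b"
      using JL[of "j + k"] by (auto simp: algebra_simps intro!: bexI[of _ j])
    then show "a \<in> adjoin L t" by (auto intro: adjoinI)
  next
    assume "a \<in> adjoin L t"
    then obtain l b where l: "l \<in> L" "a = l + t * b" by (meson adjoinE)
    then obtain j where j: "j \<in> J" "l - j \<in> K" using JL by blast
    have "a - j = (l - j) + t * b" using l(2) by simp
    then have "a - j \<in> adjoin K t" using j(2) by (simp only: adjoinI)
    then show "\<exists>j\<in>J. a - j \<in> adjoin K t" using j(1) by blast
  qed
  have J1: "(\<exists>j\<in>J. a - j \<in> seq_ideal \<theta> 1) \<longleftrightarrow> a \<in> adjoin J (\<theta> 0)" for a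
    unfolding One_nat_def seq_ideal.simps(2) by (rule J_adjoin) auto
  have J2: "(\<exists>j\<in>J. a - j \<in> seq_ideal \<theta> 2) \<longleftrightarrow> a \<in> ?J2" for a
    using J_adjoin[OF J1] by (simp add: numeral_2_eq_2)
  have ex0: "exact_mod (seq_ideal \<theta> 0) i" for i
    unfolding exact_mod_def
  proof (intro ballI impI)
    fix u assume "u \<in> free (Suc i)" "diff i u \<in> supp i (seq_ideal \<theta> 0)"
    moreover from this have "diff i u = 0" by (auto simp: supp_def)
    ultimately obtain v where "v \<in> free (Suc (Suc i))" "u = diff (Suc i) v" using ex by blast
    then show "u \<in> bdry (seq_ideal \<theta> 0) (Suc i)"
      using bdryI[of v "Suc i" 0 "seq_ideal \<theta> 0"] supp_closed(1)[OF K[of 0], of "Suc i"] by simp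
  qed
  have step: "exact_mod (seq_ideal \<theta> (Suc q)) (Suc i)"
    if "q < Suc (Suc r)" "exact_mod (seq_ideal \<theta> q) i" "exact_mod (seq_ideal \<theta> q) (Suc i)" for q i
    using that reg unfolding seq_ideal.simps
    by (intro exact_mod_adjoin K dd) auto
  have reg0: "w \<in> bdry {0} 0" if "w \<in> free 0" "fscale (\<theta> 0) w \<in> bdry {0} 0" for w
  proof -
    have *: "is_ideal {0::'r}" by (simp add: is_ideal_def)
    show ?thesis
      using that bdry0[OF _ *, of w] bdry0[OF _ *, of "fscale (\<theta> 0) w"] regJ(1)[of "?\<phi> w"] \<phi>_scale[of "\<theta> 0" w]
      by (auto simp: free_closed)
  qed
  have ex1: "exact_mod (seq_ideal \<theta> 1) i" for i
  proof (cases i)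
    case 0
    have "exact_mod (seq_ideal \<theta> (Suc 0)) 0"
      unfolding seq_ideal.simps(2)
      using ex0 reg0 by (intro exact_mod_adjoin_0 K) auto
    then show ?thesis using 0 by simp
  next
    case (Suc j)
    then show ?thesis using step[of 0 j] ex0 by auto
  qed
  have reg1: "w \<in> bdry (seq_ideal \<theta> 1) 0"
    if w: "w \<in> free 0" "fscale (\<theta> 1) w \<in> bdry (seq_ideal \<theta> 1) 0" for w
  proof -
    have "fscale (\<theta> 1) w \<in> free 0" using w(1) by (rule free_closed)
    from w(2)[unfolded bdry0[OF this K] J1 \<phi>_scale] have "?\<phi> w \<in> adjoin J (\<theta> 0)"
      by (rule regJ(2))
    then show ?thesis unfolding bdry0[OF w(1) K] J1 .
  qed
  have ex2: "exact_mod (seq_ideal \<theta> 2) i" for i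
  proof (cases i)
    case 0
    have "exact_mod (adjoin (seq_ideal \<theta> 1) (\<theta> 1)) 0"
      by (rule exact_mod_adjoin_0[OF K ex1 reg1])
    then show ?thesis using 0 by (simp add: numeral_2_eq_2)
  next
    case (Suc j)
    then show ?thesis using step[of 1 j] ex1 by (auto simp: numeral_2_eq_2)
  qed
  \<comment> \<open>The first two forms are regular on H_0 and cost no exactness. Each later form
    costs the lowest remaining degree, so after q + 2 forms the homology vanishes in degrees above
    \<open>q\<close>.\<close>
  have exq: "exact_mod (seq_ideal \<theta> (Suc (Suc q))) i" if "q \<le> r" "q \<le> i" for q i
    using that
  proof (induction q arbitrary: i)
    case 0
    then show ?case using ex2 by (simp add: numeral_2_eq_2)
  next
    case (Suc q)
    then obtain j where "i = Suc j" by (cases i) auto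
    then show ?case using step[of "Suc (Suc q)" j] Suc by auto
  qed
  \<comment> \<open>The multiple of \<open>f1\<close> by \<open>u\<close> maps to \<open>u\<close>
    modulo \<open>J\<close>, so the socle property passes from the cyclic module to F_0.\<close>
  have "socle I (seq_ideal \<theta> 2) 0 (fscale u f1)"
  proof -
    have fr: "fscale a (fscale u f1) \<in> free 0" "fscale u f1 \<in> free 0" for a
      using f1 by (auto intro!: free_closed)
    have c: "is_ideal ?J2" by (intro is_ideal_adjoin J)
    have J2J: "x \<in> J \<Longrightarrow> x \<in> ?J2" for x by (intro adjoin_superset)
    have *: "x * ?\<phi> f1 \<in> ?J2 \<longleftrightarrow> x \<in> ?J2" for x
    proof -
      have "x * (?\<phi> f1 - 1) \<in> ?J2" using J2J is_idealD(3)[OF J f1(2)] by blast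
      moreover have "x * ?\<phi> f1 = x + x * (?\<phi> f1 - 1)" "x = x * ?\<phi> f1 - x * (?\<phi> f1 - 1)"
        by (simp_all add: algebra_simps)
      ultimately show ?thesis using is_idealD(2,6)[OF c] by metis
    qed
    show ?thesis
      unfolding socle_def bdry0[OF fr(1) K] bdry0[OF fr(2) K] J2
      using u by (auto simp: \<phi>_scale * fr mult.assoc[symmetric] simp del: One_nat_def)
  qed
  then have soc: "\<exists>v. socle I (seq_ideal \<theta> (Suc (Suc q))) q v" if "q \<le> r" for q
    using that
  proof (induction q)
    case 0
    then show ?case by (auto simp: numeral_2_eq_2)
  next
    case (Suc q)
    then obtain v where v: "socle I (seq_ideal \<theta> (Suc (Suc q))) q v" by (meson Suc_leD)
    have ex': "exact_mod (seq_ideal \<theta> (Suc (Suc q))) q"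
      using Suc.prems by (intro exq) linarith+
    have reg': "\<theta> (Suc (Suc q)) * a \<in> seq_ideal \<theta> (Suc (Suc q)) \<Longrightarrow> a \<in> seq_ideal \<theta> (Suc (Suc q))"
      for a by (rule reg) (use Suc.prems in linarith)
    have "\<theta> (Suc (Suc q)) \<in> I" using Suc.prems by (intro I\<theta>(2)) linarith
    then have "\<exists>v. socle I (adjoin (seq_ideal \<theta> (Suc (Suc q))) (\<theta> (Suc (Suc q)))) (Suc q) v"
      using ex' reg' v dd by (intro socle_adjoin[OF K])
    then show ?case by (simp only: seq_ideal.simps(2)[of \<theta> "Suc (Suc q)"])
  qed
  obtain v where "socle I (seq_ideal \<theta> (Suc (Suc r))) r v" using soc by blast
  then have "v \<in> free r" "v \<notin> bdry (seq_ideal \<theta> (Suc (Suc r))) r" by (auto simp: socle_def)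
  then have "v \<noteq> 0"
    using bdryI[OF free_closed(1) supp_closed(1)[OF K], of r "Suc (Suc r)"]
    by (auto simp: diff_simps simp del: seq_ideal.simps)
  then have "E r \<noteq> {}" using \<open>v \<in> free r\<close> by (auto simp: supp_def fun_eq_iff)
  moreover have "E i = {}" if i: "i > r" for i
  proof (rule ccontr)
    assume "E i \<noteq> {}"
    then obtain e where e: "e \<in> E i" by blast
    obtain j where j: "i = Suc j" "r \<le> j" using i by (cases i) auto
    \<comment> \<open>A basis vector in a degree above \<open>r\<close>. The full sequence ideal
      contains all matrix entries, so modulo it the vector is a cycle and by exactness a boundary;
      but such boundaries have entries in \<open>I\<close>, and 1 is not in
      \<open>I\<close>.\<close>
    let ?d = "\<lambda>e'. if e' = e then 1 else (0::'r)"
    have d: "?d \<in> free (Suc j)" using e j by (auto simp: supp_def)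
    have dI: "diff k x \<in> supp k I" if "x \<in> free (Suc k)" for x k
      using diff_free[OF that] I by (auto simp: supp_def diff_def intro!: is_ideal_sum is_idealD(3)[OF I(1)])
    have sI: "seq_ideal \<theta> q \<subseteq> I" if "q \<le> Suc (Suc r)" for q
      using that
    proof (induction q)
      case 0
      then show ?case using I(1) by (simp add: is_idealD)
    next
      case (Suc q)
      then show ?case using I\<theta>(2)[of q] by (auto elim!: adjoinE intro!: is_idealD[OF I(1)])
    qed
    have "?d \<in> bdry (seq_ideal \<theta> (Suc (Suc r))) (Suc j)"
      using exq[of r j] j d supp_mono[OF dI[OF d] I\<theta>(1)] by (auto simp: exact_mod_def)
    then obtain x k where x: "x \<in> free (Suc (Suc j))" "k \<in> supp (Suc j) (seq_ideal \<theta> (Suc (Suc r)))"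
      "?d = diff (Suc j) x + k" by (rule bdryE)
    have "?d \<in> supp (Suc j) I"
      unfolding x(3) using x(1) dI supp_mono[OF x(2) sI] by (intro supp_closed I) auto
    then have "?d e \<in> I" unfolding supp_def by blast
    then show False using I(2) by simp
  qed
  ultimately show ?thesis by blast
qed

section \<open>Weights, homogeneous components and interpolation\<close>

definition whomog :: "(('v \<Rightarrow>\<^sub>0 nat) \<Rightarrow> nat) \<Rightarrow> nat \<Rightarrow> ('v, 'k::zero) mpol \<Rightarrow> bool" where
  "whomog w a f \<longleftrightarrow> (\<forall>\<mu>\<in>Poly_Mapping.keys f. w \<mu> = a)"

definition wcomp :: "(('v \<Rightarrow>\<^sub>0 nat) \<Rightarrow> nat) \<Rightarrow> nat \<Rightarrow> ('v, 'k::comm_monoid_add) mpol \<Rightarrow> ('v, 'k) mpol"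
  where "wcomp w a f =
    (\<Sum>\<mu>\<in>{\<mu> \<in> Poly_Mapping.keys f. w \<mu> = a}. Poly_Mapping.single \<mu> (Poly_Mapping.lookup f \<mu>))"

text \<open>The x-degree and the y-degree are two separate weights because \<open>Y + G\<close>
  mixes x-degrees 0 and 1, which forces arguments that split by x-degree alone.\<close>

locale weight =
  fixes w :: "('v::finite \<Rightarrow>\<^sub>0 nat) \<Rightarrow> nat"
  assumes w_add: "w (\<mu> + \<nu>) = w \<mu> + w \<nu>"
begin

lemma w_zero: "w 0 = 0"
  using w_add[of 0 0] by simp

lemma lookup_wcomp:
  "Poly_Mapping.lookup (wcomp w a f) \<mu> = (if w \<mu> = a then Poly_Mapping.lookup f \<mu> else 0)"
  by (auto simp: wcomp_def lookup_sum lookup_single when_def in_keys_iff)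

lemma wcomp_add: "wcomp w a (f + g) = wcomp w a f + wcomp w a g"
  by (intro poly_mapping_eqI) (simp add: lookup_wcomp lookup_add)

lemma wcomp_zero: "wcomp w a 0 = 0"
  by (simp add: wcomp_def)

lemma wcomp_sum: "wcomp w a (sum f A) = (\<Sum>x\<in>A. wcomp w a (f x))"
  by (induction A rule: infinite_finite_induct) (auto simp: wcomp_add wcomp_zero)

lemma wcomp_minus:
  "wcomp w a (f - g) = wcomp w a f - wcomp w a (g :: ('v, 'k::ab_group_add) mpol)"
  by (intro poly_mapping_eqI) (simp add: lookup_wcomp lookup_minus)

lemma whomog_wcomp: "whomog w a (wcomp w a f)"
  by (auto simp: whomog_def in_keys_iff lookup_wcomp split: if_splits)

lemma wcomp_whomog: "whomog w a f \<Longrightarrow> wcomp w b f = (if a = b then f else 0)"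
  by (intro poly_mapping_eqI) (auto simp: lookup_wcomp whomog_def in_keys_iff)

lemma sum_wcomp:
  assumes "finite B" "w ` Poly_Mapping.keys f \<subseteq> B"
  shows "f = (\<Sum>a\<in>B. wcomp w a f)"
proof (intro poly_mapping_eqI)
  fix \<mu>
  show "Poly_Mapping.lookup f \<mu> = Poly_Mapping.lookup (\<Sum>a\<in>B. wcomp w a f) \<mu>"
  proof (cases "w \<mu> \<in> B")
    case False
    then have "\<mu> \<notin> Poly_Mapping.keys f" using assms by blast
    then show ?thesis using assms False by (auto simp: lookup_sum lookup_wcomp in_keys_iff)
  qed (use assms in \<open>auto simp: lookup_sum lookup_wcomp\<close>)
qed

lemma whomog_add: "whomog w a f \<Longrightarrow> whomog w a g \<Longrightarrow> whomog w a (f + g)"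
  using keys_add[of f g] by (auto simp: whomog_def)

lemma whomog_minus: "whomog w a f \<Longrightarrow> whomog w a g \<Longrightarrow> whomog w a (f - g :: ('v, 'k::ab_group_add) mpol)"
  by (auto simp: whomog_def in_keys_iff lookup_minus)

lemma whomog_zero: "whomog w a 0"
  by (auto simp: whomog_def)

lemma whomog_sum: "(\<And>x. x \<in> A \<Longrightarrow> whomog w a (f x)) \<Longrightarrow> whomog w a (sum f A)"
  by (induction A rule: infinite_finite_induct) (auto simp: whomog_add whomog_zero)

lemma whomog_mult: "whomog w a f \<Longrightarrow> whomog w b g \<Longrightarrow> whomog w (a + b) (f * g)"
  using keys_mult[of f g] by (auto simp: whomog_def w_add)

lemma whomog_single: "w \<mu> = a \<Longrightarrow> whomog w a (Poly_Mapping.single \<mu> c)"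
  by (cases "c = 0") (auto simp: whomog_def)

lemma whomog_const: "whomog w 0 (const c)"
  by (rule whomog_single[OF w_zero])

lemma whomog_one: "whomog w 0 (1 :: ('v, 'k::field) mpol)"
  using whomog_const[of "1::'k"] by simp

lemma whomog_power: "whomog w a f \<Longrightarrow> whomog w (r * a) ((f :: ('v, 'k::field) mpol) ^ r)"
  by (induction r) (auto simp: whomog_one intro!: whomog_mult)

lemma whomog_prod:
  "(\<And>x. x \<in> A \<Longrightarrow> whomog w (a x) (f x)) \<Longrightarrow> whomog w (sum a A) (prod f A :: ('v, 'k::field) mpol)"
  by (induction A rule: infinite_finite_induct) (auto simp: whomog_one intro!: whomog_mult)

lemma wcomp_mult:
  fixes f g :: "('v, 'k::field) mpol"
  assumes "whomog w e g"
  shows "wcomp w a (g * f) = (if e \<le> a then g * wcomp w (a - e) f else 0)"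
proof -
  have "wcomp w a (Poly_Mapping.single \<mu> c * f) =
      (if e \<le> a then Poly_Mapping.single \<mu> c * wcomp w (a - e) f else 0)" if "w \<mu> = e" for \<mu> c
  proof (induction f rule: mpol_induct)
    case (single \<nu> d)
    have "wcomp w b (Poly_Mapping.single \<kappa> r) = (if w \<kappa> = b then Poly_Mapping.single \<kappa> r else 0)"
      for b \<kappa> and r :: 'k
      by (rule wcomp_whomog[OF whomog_single[OF refl]])
    then show ?case using that by (auto simp: mult_single w_add)
  next
    case (add f g)
    then show ?case by (simp add: distrib_left wcomp_add)
  qed
  then have "wcomp w a ((\<Sum>\<mu>\<in>Poly_Mapping.keys g. Poly_Mapping.single \<mu> (Poly_Mapping.lookup g \<mu>)) * f) =
      (if e \<le> a then
        (\<Sum>\<mu>\<in>Poly_Mapping.keys g. Poly_Mapping.single \<mu> (Poly_Mapping.lookup g \<mu>)) * wcomp w (a - e) f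
       else 0)"
    using assms by (simp add: sum_distrib_right wcomp_sum whomog_def)
  then show ?thesis by (simp flip: mpol_sum_single)
qed

end

section \<open>Linear forms and interpolation at projective points\<close>

definition iform :: "('i::finite \<Rightarrow> 'v) \<Rightarrow> ('i \<Rightarrow> 'k) \<Rightarrow> ('v::finite, 'k::field) mpol" where
  "iform \<iota> c = (\<Sum>i\<in>UNIV. Poly_Mapping.single (Poly_Mapping.single (\<iota> i) 1) (c i))"

lemma iform_linform: "iform \<iota> c \<in> range linform"
proof -
  have "iform \<iota> c = (\<Sum>i\<in>UNIV. const (c i) * var (\<iota> i))"
    by (simp add: iform_def mult_single)
  also have "\<dots> \<in> range linform"
    unfolding var_eq_linform linform_const_mult linform_sum by blast
  finally show ?thesis .
qed

lemma insertion_iform: "insertion (\<lambda>x. x) z (iform \<iota> c) = (\<Sum>i\<in>UNIV. c i * z (\<iota> i))"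
  by (simp add: iform_def id_hom.insertion_sum id_hom.insertion_var del: One_nat_def)

lemma iform_mult_eq_0:
  assumes "inj \<iota>" "c i \<noteq> 0" "iform \<iota> c * f = 0"
  shows "f = 0"
proof -
  let ?z = "\<lambda>v. if v = \<iota> i then 1 else 0"
  obtain e where e: "iform \<iota> c = linform e" using iform_linform by blast
  have "insertion (\<lambda>x. x) ?z (iform \<iota> c) = (\<Sum>i'\<in>UNIV. if i' = i then c i else 0)"
    unfolding insertion_iform using assms(1) by (intro sum.cong) (auto dest: injD)
  also have "\<dots> = c i" by simp
  finally have "linform e \<noteq> 0"
    using assms(2) e id_hom.insertion_zero by metis
  then obtain v where "e v \<noteq> 0" by (metis linform_zero ext)
  then show ?thesis using assms(3) unfolding e by (rule linform_mult_eq_0)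
qed

lemma (in weight) whomog_iform:
  "(\<And>i. w (Poly_Mapping.single (\<iota> i) 1) = a) \<Longrightarrow> whomog w a (iform \<iota> c)"
  unfolding iform_def by (intro whomog_sum whomog_single)

text \<open>Coordinate vectors of projective points, at most one for each point.\<close>

definition nonproportional :: "('i \<Rightarrow> 'k::field) set \<Rightarrow> bool" where
  "nonproportional A \<longleftrightarrow> (\<forall>p\<in>A. \<exists>i. p i \<noteq> 0) \<and> (\<forall>p\<in>A. \<forall>p'\<in>A. \<forall>c. p' = (\<lambda>i. c * p i) \<longrightarrow> p = p')"

lemma nonproportional_separate:
  fixes p p' :: "'i::finite \<Rightarrow> 'k::field"
  assumes "nonproportional A" "p \<in> A" "p' \<in> A" "p \<noteq> p'"
  shows "\<exists>c. (\<Sum>i\<in>UNIV. c i * p' i) = 0 \<and> (\<Sum>i\<in>UNIV. c i * p i) \<noteq> 0"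
proof -
  obtain i where i: "p' i \<noteq> 0" using assms by (auto simp: nonproportional_def)
  obtain j where j: "p' i * p j \<noteq> p' j * p i"
  proof (rule ccontr)
    assume "\<not> thesis"
    then have "p' i * p j = p' j * p i" for j using that by blast
    then have "p = (\<lambda>j. p i / p' i * p' j)" using i by (auto simp: field_simps)
    then have "p' = p" using assms unfolding nonproportional_def by blast
    then show False using assms(4) by simp
  qed
  \<comment> \<open>The 2 x 2 minor of \<open>p'\<close> against the variables in positions
    \<open>i\<close> and \<open>j\<close>: it vanishes at \<open>p'\<close>, and at \<open>p\<close>
    it is nonzero by the choice of \<open>j\<close>.\<close>
  let ?c = "\<lambda>l. (if l = j then p' i else 0) - (if l = i then p' j else 0)"
  have "(\<Sum>l\<in>UNIV. ?c l * f l) = p' i * f j - p' j * f i" for f :: "'i \<Rightarrow> 'k"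
    by (simp add: left_diff_distrib sum_subtractf if_distrib[of "\<lambda>x. x * _"] cong: if_cong)
  then show ?thesis using j by (intro exI[of _ ?c]) (auto simp: mult.commute)
qed

text \<open>Multiply one form through each of the other points and fill up to degree
  \<open>a\<close> with a form that vanishes nowhere on \<open>A\<close>; hence degree card A - 1 is
  enough. Quantifying over weights gives the x-degree and the y-degree of one and the same
  polynomial.\<close>

lemma interpolation:
  fixes \<iota> :: "'i::finite \<Rightarrow> 'v::finite" and d :: "'i \<Rightarrow> 'k::field"
  assumes A: "finite A" "nonproportional A" and d: "\<And>p. p \<in> A \<Longrightarrow> (\<Sum>i\<in>UNIV. d i * p i) \<noteq> 0"
    and card: "card A \<le> a + 1" and p: "p \<in> A"
  shows "\<exists>e :: ('v, 'k) mpol.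
    (\<forall>w b. weight w \<longrightarrow> (\<forall>i. w (Poly_Mapping.single (\<iota> i) 1) = b) \<longrightarrow> whomog w (a * b) e) \<and>
    (\<forall>z. z \<circ> \<iota> \<in> A \<longrightarrow> insertion (\<lambda>x. x) z e = (if z \<circ> \<iota> = p then 1 else 0))"
proof -
  have "\<forall>p'\<in>A - {p}. \<exists>c. (\<Sum>i\<in>UNIV. c i * p' i) = 0 \<and> (\<Sum>i\<in>UNIV. c i * p i) \<noteq> 0"
    using nonproportional_separate[OF A(2) p] by auto
  then obtain c where c: "\<And>p'. p' \<in> A - {p} \<Longrightarrow> (\<Sum>i\<in>UNIV. c p' i * p' i) = 0"
    "\<And>p'. p' \<in> A - {p} \<Longrightarrow> (\<Sum>i\<in>UNIV. c p' i * p i) \<noteq> 0"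
    by metis
  define b where "b = a - card (A - {p})"
  define e0 :: "('v, 'k) mpol" where "e0 = (\<Prod>p'\<in>A - {p}. iform \<iota> (c p')) * iform \<iota> d ^ b"
  define \<kappa> where "\<kappa> = (\<Prod>p'\<in>A - {p}. \<Sum>i\<in>UNIV. c p' i * p i) * (\<Sum>i\<in>UNIV. d i * p i) ^ b"
  have "\<kappa> \<noteq> 0" using A(1) c d[OF p] by (auto simp: \<kappa>_def)
  have ab: "a = card (A - {p}) + b" using card p A(1) by (simp add: b_def card_Diff_singleton_if)
  have "whomog w (a * r) (const (1 / \<kappa>) * e0)"
    if "weight w" "\<And>i. w (Poly_Mapping.single (\<iota> i) 1) = r" for w r
  proof -
    interpret weight w by fact
    have "whomog w (0 + ((\<Sum>p'\<in>A - {p}. r) + b * r)) (const (1 / \<kappa>) * e0)"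
      unfolding e0_def
      by (intro whomog_mult whomog_const whomog_prod whomog_power whomog_iform that)
    then show ?thesis by (simp add: ab algebra_simps)
  qed
  moreover have "insertion (\<lambda>x. x) z (const (1 / \<kappa>) * e0) = (if z \<circ> \<iota> = p then 1 else 0)"
    if z: "z \<circ> \<iota> \<in> A" for z
  proof -
    let ?q = "z \<circ> \<iota>"
    have ev: "insertion (\<lambda>x. x) z (const (1 / \<kappa>) * e0) =
      1 / \<kappa> * ((\<Prod>p'\<in>A - {p}. \<Sum>i\<in>UNIV. c p' i * ?q i) * (\<Sum>i\<in>UNIV. d i * ?q i) ^ b)"
      by (simp add: e0_def id_hom.insertion_hom insertion_iform del: One_nat_def)
    show ?thesis
    proof (cases "?q = p")
      case True
      then show ?thesis using \<open>\<kappa> \<noteq> 0\<close> unfolding ev True by (simp add: \<kappa>_def)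
    next
      case False
      then have "(\<Prod>p'\<in>A - {p}. \<Sum>i\<in>UNIV. c p' i * ?q i) = 0"
        using A(1) z c(1)[of ?q] by (intro prod_zero) auto
      then show ?thesis unfolding ev using False by simp
    qed
  qed
  ultimately show ?thesis by blast
qed

lemma power_sum_eq_0:
  fixes c :: "nat \<Rightarrow> 'k::field"
  assumes inf: "infinite (UNIV :: 'k set)" and fin: "finite B"
    and eq: "\<And>s. s \<noteq> 0 \<Longrightarrow> (\<Sum>a\<in>B. s ^ a * c a) = 0" and a: "a \<in> B"
  shows "c a = 0"
proof -
  let ?p = "\<Sum>a\<in>B. Polynomial.monom (c a) a"
  have "poly ?p s = 0" if "s \<noteq> 0" for s
    using eq[OF that] by (simp add: poly_sum poly_monom mult.commute)
  then have "UNIV - {0} \<subseteq> {s. poly ?p s = 0}" by blast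
  moreover have "infinite (UNIV - {0 :: 'k})" using inf by simp
  ultimately have "infinite {s. poly ?p s = 0}" using finite_subset by blast
  then have "?p = 0" using poly_roots_finite by blast
  then have "Polynomial.coeff ?p a = 0" by simp
  then show ?thesis using fin a by (simp add: coeff_sum)
qed

lemma avoid_hyperplanes:
  fixes A :: "('i::finite \<Rightarrow> 'k::field) set"
  assumes inf: "infinite (UNIV :: 'k set)" and "finite A" and "\<And>p. p \<in> A \<Longrightarrow> \<exists>i. p i \<noteq> 0"
  shows "\<exists>d. \<forall>p\<in>A. (\<Sum>i\<in>UNIV. d i * p i) \<noteq> 0"
  using assms(2,3)
proof induction
  case (insert q A)
  then obtain d where d: "\<And>p. p \<in> A \<Longrightarrow> (\<Sum>i\<in>UNIV. d i * p i) \<noteq> 0" by auto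
  obtain j where j: "q j \<noteq> 0" using insert by auto
  \<comment> \<open>Where \<open>p j\<close> is nonzero, this is the value of \<open>s\<close> at
    which the corrected form would vanish at \<open>p\<close>. Where \<open>p j\<close> is 0 the
    quotient is 0 by convention, and excluding that value does no harm.\<close>
  let ?bad = "(\<lambda>p. - (\<Sum>i\<in>UNIV. d i * p i) / p j) ` insert q A"
  have "finite ?bad" using insert by simp
  then obtain s where s: "s \<notin> ?bad" using inf ex_new_if_finite by blast
  consider "(\<Sum>i\<in>UNIV. d i * q i) \<noteq> 0" | "(\<Sum>i\<in>UNIV. d i * q i) = 0" by blast
  then show ?case
  proof cases
    case 1
    then show ?thesis using d by blast
  next
    case 2
    let ?d = "\<lambda>i. d i + (if i = j then s else 0)"
    have "(\<Sum>i\<in>UNIV. ?d i * p i) = (\<Sum>i\<in>UNIV. d i * p i) + s * p j" for p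
      by (simp add: distrib_right sum.distrib if_distrib[of "\<lambda>x. x * _"] cong: if_cong)
    moreover have "(\<Sum>i\<in>UNIV. d i * p i) + s * p j \<noteq> 0" if p: "p \<in> insert q A" for p
    proof (cases "p j = 0")
      case True
      then have "p \<in> A" using p j by auto
      then show ?thesis using d True by simp
    next
      case False
      then show ?thesis using s p by (auto simp: image_iff field_simps eq_neg_iff_add_eq_0)
    qed
    ultimately show ?thesis by (intro exI[of _ ?d]) simp
  qed
qed auto

text \<open>Over a finite field, 1 plus the product of all x - a takes the value 1 everywhere and so
  has no root.\<close>

lemma infinite_alg_closed_field: "infinite (UNIV :: 'k::alg_closed_field set)"
proof
  assume fin: "finite (UNIV :: 'k set)"
  let ?q = "\<Prod>a\<in>(UNIV :: 'k set). [:- a, 1:]"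
  have "Polynomial.degree ?q = CARD('k)"
    by (subst degree_prod_eq_sum_degree) auto
  then have "Polynomial.degree (?q + 1) > 0"
    using fin by (subst degree_add_eq_left) (auto simp: card_gt_0_iff)
  then obtain x where "poly (?q + 1) x = 0" using alg_closed_imp_poly_has_root by blast
  moreover have "poly ?q x = 0"
    using fin by (auto simp: poly_prod intro!: prod_zero bexI[of _ x])
  ultimately show False by simp
qed

section \<open>The truncated ideal of a finite set of points\<close>

definition xdeg :: "('n::finite + 'm::finite \<Rightarrow>\<^sub>0 nat) \<Rightarrow> nat" where
  "xdeg \<mu> = (\<Sum>i\<in>UNIV. Poly_Mapping.lookup \<mu> (Inl i))"

definition ydeg :: "('n::finite + 'm::finite \<Rightarrow>\<^sub>0 nat) \<Rightarrow> nat" where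
  "ydeg \<mu> = (\<Sum>j\<in>UNIV. Poly_Mapping.lookup \<mu> (Inr j))"

interpretation xw: weight xdeg
  by standard (simp add: xdeg_def lookup_add sum.distrib)

interpretation yw: weight ydeg
  by standard (simp add: ydeg_def lookup_add sum.distrib)

lemma xydeg_single:
  "xdeg (Poly_Mapping.single (Inl i) r) = r" "xdeg (Poly_Mapping.single (Inr j) r) = 0"
  "ydeg (Poly_Mapping.single (Inl i) r) = 0" "ydeg (Poly_Mapping.single (Inr j) r) = r"
  by (auto simp: xdeg_def ydeg_def lookup_single when_def)

text \<open>A point of the bicone: the two coordinate vectors are scaled independently, so that
  x-components and y-components can be separated by varying \<open>s\<close> or
  \<open>r\<close>.\<close>

definition pt :: "'k \<Rightarrow> ('n \<Rightarrow> 'k) \<Rightarrow> 'k \<Rightarrow> ('m \<Rightarrow> 'k) \<Rightarrow> 'n + 'm \<Rightarrow> 'k::field" where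
  "pt s p r q = case_sum (\<lambda>i. s * p i) (\<lambda>j. r * q j)"

abbreviation ev :: "('v::finite \<Rightarrow> 'k) \<Rightarrow> ('v, 'k::field) mpol \<Rightarrow> 'k" where
  "ev \<equiv> insertion (\<lambda>x. x)"

lemma prod_UNIV_sum:
  fixes h :: "'a::finite + 'b::finite \<Rightarrow> 'd::comm_monoid_mult"
  shows "(\<Prod>v\<in>UNIV. h v) = (\<Prod>i\<in>UNIV. h (Inl i)) * (\<Prod>j\<in>UNIV. h (Inr j))"
  unfolding UNIV_sum by (subst prod.union_disjoint) (auto simp: prod.reindex)

lemma ev_single_pt:
  "ev (pt s p r q) (Poly_Mapping.single \<mu> c) =
    s ^ xdeg \<mu> * r ^ ydeg \<mu> * ev (pt 1 p 1 q) (Poly_Mapping.single \<mu> c)"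
proof -
  show ?thesis
    unfolding id_hom.insertion_single prod_UNIV_sum
    by (simp add: pt_def power_mult_distrib prod.distrib xdeg_def ydeg_def power_sum algebra_simps)
qed

lemma ev_scale:
  assumes "whomog xdeg a f" "whomog ydeg b f"
  shows "ev (pt s p r q) f = s ^ a * r ^ b * ev (pt 1 p 1 q) f"
proof -
  have "ev (pt s p r q) (\<Sum>\<mu>\<in>Poly_Mapping.keys f. Poly_Mapping.single \<mu> (Poly_Mapping.lookup f \<mu>)) =
      s ^ a * r ^ b *
      ev (pt 1 p 1 q) (\<Sum>\<mu>\<in>Poly_Mapping.keys f. Poly_Mapping.single \<mu> (Poly_Mapping.lookup f \<mu>))"
    unfolding id_hom.insertion_sum sum_distrib_left
    using assms by (intro sum.cong) (auto simp: ev_single_pt[of s p r q] whomog_def)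
  then show ?thesis by (simp flip: mpol_sum_single)
qed

lemma ev_scale_x:
  assumes "whomog xdeg a f"
  shows "ev (pt s p r q) f = s ^ a * ev (pt 1 p r q) f"
proof -
  have "ev (pt s p r q) (\<Sum>\<mu>\<in>Poly_Mapping.keys f. Poly_Mapping.single \<mu> (Poly_Mapping.lookup f \<mu>)) =
      s ^ a *
      ev (pt 1 p r q) (\<Sum>\<mu>\<in>Poly_Mapping.keys f. Poly_Mapping.single \<mu> (Poly_Mapping.lookup f \<mu>))"
    unfolding id_hom.insertion_sum sum_distrib_left
    using assms by (intro sum.cong)
      (auto simp: ev_single_pt[of s p r q] ev_single_pt[of 1 p r q] whomog_def)
  then show ?thesis by (simp flip: mpol_sum_single)
qed

lemma ev_scale_y:
  assumes "whomog ydeg b f"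
  shows "ev (pt s p r q) f = r ^ b * ev (pt s p 1 q) f"
proof -
  have "ev (pt s p r q) (\<Sum>\<mu>\<in>Poly_Mapping.keys f. Poly_Mapping.single \<mu> (Poly_Mapping.lookup f \<mu>)) =
      r ^ b *
      ev (pt s p 1 q) (\<Sum>\<mu>\<in>Poly_Mapping.keys f. Poly_Mapping.single \<mu> (Poly_Mapping.lookup f \<mu>))"
    unfolding id_hom.insertion_sum sum_distrib_left
    using assms by (intro sum.cong)
      (auto simp: ev_single_pt[of s p r q] ev_single_pt[of s p 1 q] whomog_def)
  then show ?thesis by (simp flip: mpol_sum_single)
qed

text \<open>Vanishing on the whole bicone, for polynomials that need not be bihomogeneous; over an
  infinite field this gives I_X (\<open>vanishing_ideal_eq\<close>). Being a pointwise condition, it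
  lets a form without zeros on \<open>W\<close> be cancelled at once.\<close>

definition cone_ideal :: "(('n::finite \<Rightarrow> 'k) \<times> ('m::finite \<Rightarrow> 'k)) set \<Rightarrow> ('n + 'm, 'k::field) mpol set"
  where "cone_ideal W =
    {f. \<forall>(p, q)\<in>W. \<forall>s r. s \<noteq> 0 \<longrightarrow> r \<noteq> 0 \<longrightarrow> ev (pt s p r q) f = 0}"

text \<open>The power of the x-ideal, written as a monomial ideal; see
  \<open>ideal_power_x_ideal\<close>.\<close>

definition xpow :: "nat \<Rightarrow> ('n::finite + 'm::finite, 'k::field) mpol set" where
  "xpow t = {f. \<forall>\<mu>\<in>Poly_Mapping.keys f. t \<le> xdeg \<mu>}"

lemma cone_idealD:
  "f \<in> cone_ideal W \<Longrightarrow> (p, q) \<in> W \<Longrightarrow> s \<noteq> 0 \<Longrightarrow> r \<noteq> 0 \<Longrightarrow> ev (pt s p r q) f = 0"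
  by (auto simp: cone_ideal_def)

lemma is_ideal_cone: "is_ideal (cone_ideal W)"
  unfolding is_ideal_def cone_ideal_def by (fastforce simp: id_hom.insertion_hom)

lemma is_ideal_xpow: "is_ideal (xpow t :: ('a::finite + 'b::finite, 'c::field) mpol set)"
proof -
  have mult: "r * f \<in> xpow t" if f: "f \<in> xpow t" for r f :: "('a + 'b, 'c) mpol"
    unfolding xpow_def
  proof (clarify)
    fix \<mu> assume "\<mu> \<in> Poly_Mapping.keys (r * f)"
    then obtain \<kappa> \<nu> where "\<mu> = \<kappa> + \<nu>" "\<nu> \<in> Poly_Mapping.keys f" using keys_mult[of r f] by blast
    then show "t \<le> xdeg \<mu>" using f by (simp add: xw.w_add xpow_def trans_le_add2)
  qed
  have add: "f + g \<in> xpow t" if "f \<in> xpow t" "g \<in> xpow t" for f g :: "('a + 'b, 'c) mpol"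
    using that keys_add[of f g] unfolding xpow_def by blast
  have "0 \<in> xpow t" by (simp add: xpow_def)
  with mult add show ?thesis unfolding is_ideal_def by blast
qed

lemma xpow_wcomp: "f \<in> xpow t \<Longrightarrow> wcomp xdeg a f \<in> xpow t"
  by (auto simp: xpow_def in_keys_iff xw.lookup_wcomp split: if_splits)

lemma xpow_wcomp_0: "f \<in> xpow t \<Longrightarrow> a < t \<Longrightarrow> wcomp xdeg a f = 0"
  by (intro poly_mapping_eqI)
     (metis (no_types, lifting) in_keys_iff leD lookup_zero mem_Collect_eq xpow_def xw.lookup_wcomp)

lemma whomog_xpow: "whomog xdeg a f \<Longrightarrow> t \<le> a \<Longrightarrow> f \<in> xpow t"
  by (auto simp: whomog_def xpow_def)

lemma xpowI: "(\<And>a. a < t \<Longrightarrow> wcomp xdeg a f = 0) \<Longrightarrow> f \<in> xpow t"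
  unfolding xpow_def
  by (auto simp: in_keys_iff) (metis lookup_zero not_le xw.lookup_wcomp)

text \<open>With \<open>p\<close>, \<open>q\<close>, \<open>r\<close> fixed, the value of
  \<open>f\<close> is a polynomial in \<open>s\<close> whose coefficients are the values of the
  x-components; it vanishes at all nonzero elements of an infinite field. The y-components are found
  in the same way from \<open>r\<close>.\<close>

lemma cone_wcomp:
  fixes W :: "(('n::finite \<Rightarrow> 'k) \<times> ('m::finite \<Rightarrow> 'k::field)) set"
  assumes inf: "infinite (UNIV :: 'k set)" and f: "f \<in> cone_ideal W"
  shows "wcomp xdeg a f \<in> cone_ideal W" and "wcomp ydeg b f \<in> cone_ideal W"
proof -
  show "wcomp xdeg a f \<in> cone_ideal W"
    unfolding cone_ideal_def
  proof (clarify)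
    fix p q and s r :: 'k assume pq: "(p, q) \<in> W" "s \<noteq> 0" "r \<noteq> 0"
    let ?B = "insert a (xdeg ` Poly_Mapping.keys f)"
    have "(\<Sum>a\<in>?B. s' ^ a * ev (pt 1 p r q) (wcomp xdeg a f)) = 0" if "s' \<noteq> 0" for s'
    proof -
      have "(\<Sum>a\<in>?B. s' ^ a * ev (pt 1 p r q) (wcomp xdeg a f)) =
          (\<Sum>a\<in>?B. ev (pt s' p r q) (wcomp xdeg a f))"
        by (intro sum.cong refl ev_scale_x[OF xw.whomog_wcomp, symmetric])
      also have "\<dots> = ev (pt s' p r q) (\<Sum>a\<in>?B. wcomp xdeg a f)"
        by (rule id_hom.insertion_sum[symmetric])
      also have "(\<Sum>a\<in>?B. wcomp xdeg a f) = f"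
        by (rule xw.sum_wcomp[symmetric]) auto
      finally show ?thesis using cone_idealD[OF f pq(1) that pq(3)] by simp
    qed
    from power_sum_eq_0[OF inf _ this, of a] show "ev (pt s p r q) (wcomp xdeg a f) = 0"
      by (simp add: ev_scale_x[OF xw.whomog_wcomp, of s p r q])
  qed
  show "wcomp ydeg b f \<in> cone_ideal W"
    unfolding cone_ideal_def
  proof (clarify)
    fix p q and s r :: 'k assume pq: "(p, q) \<in> W" "s \<noteq> 0" "r \<noteq> 0"
    let ?B = "insert b (ydeg ` Poly_Mapping.keys f)"
    have "(\<Sum>b\<in>?B. s' ^ b * ev (pt s p 1 q) (wcomp ydeg b f)) = 0" if "s' \<noteq> 0" for s'
    proof -
      have "(\<Sum>b\<in>?B. s' ^ b * ev (pt s p 1 q) (wcomp ydeg b f)) =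
          (\<Sum>b\<in>?B. ev (pt s p s' q) (wcomp ydeg b f))"
        by (intro sum.cong refl ev_scale_y[OF yw.whomog_wcomp, symmetric])
      also have "\<dots> = ev (pt s p s' q) (\<Sum>b\<in>?B. wcomp ydeg b f)"
        by (rule id_hom.insertion_sum[symmetric])
      also have "(\<Sum>b\<in>?B. wcomp ydeg b f) = f"
        by (rule yw.sum_wcomp[symmetric]) auto
      finally show ?thesis using cone_idealD[OF f pq(1,2) that] by simp
    qed
    from power_sum_eq_0[OF inf _ this, of b] show "ev (pt s p r q) (wcomp ydeg b f) = 0"
      by (simp add: ev_scale_y[OF yw.whomog_wcomp, of s p r q])
  qed
qed

lemma cone_homI:
  assumes "whomog xdeg a f" "whomog ydeg b f" "\<And>p q. (p, q) \<in> W \<Longrightarrow> ev (pt 1 p 1 q) f = 0"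
  shows "f \<in> cone_ideal W"
  unfolding cone_ideal_def
proof (clarify)
  fix p q s r assume "(p, q) \<in> W"
  then show "ev (pt s p r q) f = 0"
    using ev_scale[OF assms(1,2), of s p r q] assms(3) by simp
qed

text \<open>\<open>P\<close> and \<open>Q\<close> stand for the first and second coordinates of the
  points, and \<open>card_P\<close> is the bound t >= l - 1. As \<open>c j0\<close> is nonzero,
  \<open>H\<close> eliminates the y-variable at \<open>j0\<close>, so the one at \<open>j1\<close>
  remains a variable modulo \<open>H\<close>.\<close>

locale cone_points =
  fixes P :: "('n::finite \<Rightarrow> 'k::field) set" and Q :: "('m::finite \<Rightarrow> 'k) set" and W t
    and d :: "'n \<Rightarrow> 'k" and c :: "'m \<Rightarrow> 'k" and j0 j1 :: 'm
  assumes inf: "infinite (UNIV :: 'k set)"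
    and fin: "finite P" "finite Q"
    and W: "W \<subseteq> P \<times> Q" "W \<noteq> {}"
    and np: "nonproportional P" "nonproportional Q"
    and d: "p \<in> P \<Longrightarrow> (\<Sum>i\<in>UNIV. d i * p i) \<noteq> 0"
    and c: "q \<in> Q \<Longrightarrow> (\<Sum>j\<in>UNIV. c j * q j) \<noteq> 0"
    and card_P: "card P \<le> t + 1"
    and j01: "c j0 \<noteq> 0" "j1 \<noteq> j0"
begin

definition G :: "('n + 'm, 'k) mpol" where "G = iform Inl d"

definition H :: "('n + 'm, 'k) mpol" where "H = iform Inr c"

definition Y :: "('n + 'm, 'k) mpol" where "Y = var (Inr j1)"

definition J :: "('n + 'm, 'k) mpol set" where "J = cone_ideal W \<inter> xpow t"

lemma hom_forms:
  "whomog xdeg 1 G" "whomog ydeg 0 G" "whomog xdeg 0 H" "whomog ydeg 1 H" "whomog xdeg 0 Y" "whomog ydeg 1 Y"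
  unfolding G_def H_def Y_def
  by (intro xw.whomog_iform yw.whomog_iform xw.whomog_single yw.whomog_single; simp add: xydeg_single)+

lemma ev_forms:
  "ev (pt s p r q) G = s * (\<Sum>i\<in>UNIV. d i * p i)" "ev (pt s p r q) H = r * (\<Sum>j\<in>UNIV. c j * q j)"
  by (simp_all add: G_def H_def insertion_iform pt_def sum_distrib_left algebra_simps)

lemma WD: "(p, q) \<in> W \<Longrightarrow> p \<in> P" "(p, q) \<in> W \<Longrightarrow> q \<in> Q"
  using W by auto

lemma cancel_G: "G * f \<in> cone_ideal W \<Longrightarrow> f \<in> cone_ideal W"
  using WD d by (fastforce simp: cone_ideal_def id_hom.insertion_mult ev_forms)

lemma cancel_H: "H * f \<in> cone_ideal W \<Longrightarrow> f \<in> cone_ideal W"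
  using WD c by (fastforce simp: cone_ideal_def id_hom.insertion_mult ev_forms)

lemma is_ideal_J: "is_ideal J"
  using is_ideal_cone[of W] is_ideal_xpow[of t] by (auto simp: is_ideal_def J_def)

lemma J_wcomp: "f \<in> J \<Longrightarrow> wcomp xdeg a f \<in> J"
  using cone_wcomp(1)[OF inf] xpow_wcomp by (auto simp: J_def)

text \<open>\<open>H\<close> has x-degree 0 and therefore acts on each x-component
  separately.\<close>

lemma xpow_cancel_H: 
  assumes "H * f \<in> xpow t" shows "f \<in> xpow t"
proof (rule xpowI)
  fix a assume "a < t"
  have "H * wcomp xdeg a f = wcomp xdeg a (H * f)"
    using xw.wcomp_mult[OF hom_forms(3), of a f] by simp
  also have "\<dots> = 0" using assms \<open>a < t\<close> by (rule xpow_wcomp_0)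
  finally show "wcomp xdeg a f = 0"
    using iform_mult_eq_0[of Inr c j0] j01(1) by (simp add: H_def)
qed

lemma regular_H: "H * f \<in> J \<Longrightarrow> f \<in> J"
  using cancel_H xpow_cancel_H by (auto simp: J_def)

lemma ev_single_split:
  "ev (pt 1 p 1 q) (Poly_Mapping.single \<mu> k) =
    k * (\<Prod>i\<in>UNIV. p i ^ Poly_Mapping.lookup \<mu> (Inl i)) *
      (\<Prod>j\<in>UNIV. q j ^ Poly_Mapping.lookup \<mu> (Inr j))"
proof -
  show ?thesis unfolding id_hom.insertion_single prod_UNIV_sum by (simp add: pt_def)
qed

lemma x_interpolation:
  assumes "card P \<le> a + 1"
  obtains e :: "('n \<Rightarrow> 'k) \<Rightarrow> ('n + 'm, 'k) mpol"
  where "\<And>p. p \<in> P \<Longrightarrow> whomog xdeg a (e p)" "\<And>p. p \<in> P \<Longrightarrow> whomog ydeg 0 (e p)"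
    "\<And>p p' q. p \<in> P \<Longrightarrow> p' \<in> P \<Longrightarrow> ev (pt 1 p' 1 q) (e p) = (if p' = p then 1 else 0)"
proof -
  have "\<forall>p\<in>P. \<exists>e :: ('n + 'm, 'k) mpol. whomog xdeg a e \<and> whomog ydeg 0 e \<and>
    (\<forall>p'\<in>P. \<forall>q. ev (pt 1 p' 1 q) e = (if p' = p then 1 else 0))"
  proof
    fix p assume "p \<in> P"
    from interpolation[OF fin(1) np(1) d assms this, of Inl]
    obtain e :: "('n + 'm, 'k) mpol" where
      e: "\<And>w b. weight w \<Longrightarrow> (\<And>i. w (Poly_Mapping.single (Inl i) 1) = b) \<Longrightarrow> whomog w (a * b) e"
      "\<And>z. z \<circ> Inl \<in> P \<Longrightarrow> ev z e = (if z \<circ> Inl = p then 1 else 0)" by blast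
    have "pt 1 p' 1 q \<circ> Inl = p'" for p' :: "'n \<Rightarrow> 'k" and q :: "'m \<Rightarrow> 'k" by (auto simp: pt_def)
    then show "\<exists>e :: ('n + 'm, 'k) mpol. whomog xdeg a e \<and> whomog ydeg 0 e \<and>
      (\<forall>p'\<in>P. \<forall>q. ev (pt 1 p' 1 q) e = (if p' = p then 1 else 0))"
      using e(1)[OF xw.weight_axioms, of 1] e(1)[OF yw.weight_axioms, of 0] e(2)
      by (intro exI[of _ e]) (simp add: xydeg_single)
  qed
  then show thesis using that by metis
qed

lemma y_interpolation:
  assumes "card Q \<le> b + 1"
  obtains e :: "('m \<Rightarrow> 'k) \<Rightarrow> ('n + 'm, 'k) mpol"
  where "\<And>q. q \<in> Q \<Longrightarrow> whomog xdeg 0 (e q)" "\<And>q. q \<in> Q \<Longrightarrow> whomog ydeg b (e q)"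
    "\<And>p q q'. q \<in> Q \<Longrightarrow> q' \<in> Q \<Longrightarrow> ev (pt 1 p 1 q') (e q) = (if q' = q then 1 else 0)"
proof -
  have "\<forall>q\<in>Q. \<exists>e :: ('n + 'm, 'k) mpol. whomog xdeg 0 e \<and> whomog ydeg b e \<and>
    (\<forall>q'\<in>Q. \<forall>p. ev (pt 1 p 1 q') e = (if q' = q then 1 else 0))"
  proof
    fix q assume "q \<in> Q"
    from interpolation[OF fin(2) np(2) c assms this, of Inr]
    obtain e :: "('n + 'm, 'k) mpol" where
      e: "\<And>w a. weight w \<Longrightarrow> (\<And>i. w (Poly_Mapping.single (Inr i) 1) = a) \<Longrightarrow> whomog w (b * a) e"
      "\<And>z. z \<circ> Inr \<in> Q \<Longrightarrow> ev z e = (if z \<circ> Inr = q then 1 else 0)" by blast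
    have "pt 1 p 1 q' \<circ> Inr = q'" for p :: "'n \<Rightarrow> 'k" and q' :: "'m \<Rightarrow> 'k" by (auto simp: pt_def)
    then show "\<exists>e :: ('n + 'm, 'k) mpol. whomog xdeg 0 e \<and> whomog ydeg b e \<and>
      (\<forall>q'\<in>Q. \<forall>p. ev (pt 1 p 1 q') e = (if q' = q then 1 else 0))"
      using e(1)[OF xw.weight_axioms, of 0] e(1)[OF yw.weight_axioms, of 1] e(2)
      by (intro exI[of _ e]) (simp add: xydeg_single)
  qed
  then show thesis using that by metis
qed

text \<open>Modulo \<open>cone_ideal W\<close> a bihomogeneous polynomial is determined by its
  values at the representatives (\<open>cone_homI\<close>). Only the x-part of the monomial is
  divided by \<open>G\<close> and interpolated; the y-part stays as the factor \<open>m\<close>. So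
  the bound counts first coordinates, not points, and holds in every y-degree.\<close>

lemma G_surj_single:
  assumes a: "card P \<le> a + 1" and \<mu>: "xdeg \<mu> = a + 1"
  shows "\<exists>g. whomog xdeg a g \<and> whomog ydeg (ydeg \<mu>) g \<and>
    Poly_Mapping.single \<mu> k - G * g \<in> cone_ideal W"
proof -
  obtain e :: "('n \<Rightarrow> 'k) \<Rightarrow> ('n + 'm, 'k) mpol"
    where e: "\<And>p. p \<in> P \<Longrightarrow> whomog xdeg a (e p)" "\<And>p. p \<in> P \<Longrightarrow> whomog ydeg 0 (e p)"
    "\<And>p p' q. p \<in> P \<Longrightarrow> p' \<in> P \<Longrightarrow> ev (pt 1 p' 1 q) (e p) = (if p' = p then 1 else 0)"
    using x_interpolation[OF a] by blast
  define \<kappa> where "\<kappa> p = k * (\<Prod>i\<in>UNIV. p i ^ Poly_Mapping.lookup \<mu> (Inl i)) / (\<Sum>i\<in>UNIV. d i * p i)"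
    for p
  define m :: "('n + 'm, 'k) mpol" where
    "m = (\<Prod>j\<in>UNIV. var (Inr j) ^ Poly_Mapping.lookup \<mu> (Inr j))"
  define g where "g = (\<Sum>p\<in>P. const (\<kappa> p) * e p) * m"
  have m: "whomog xdeg 0 m" "whomog ydeg (ydeg \<mu>) m"
  proof -
    have "whomog xdeg (\<Sum>j\<in>UNIV. Poly_Mapping.lookup \<mu> (Inr j) * 0) m"
      unfolding m_def by (intro xw.whomog_prod xw.whomog_power xw.whomog_single) (simp add: xydeg_single)
    then show "whomog xdeg 0 m" by simp
    have "whomog ydeg (\<Sum>j\<in>UNIV. Poly_Mapping.lookup \<mu> (Inr j) * 1) m"
      unfolding m_def by (intro yw.whomog_prod yw.whomog_power yw.whomog_single) (simp add: xydeg_single)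
    then show "whomog ydeg (ydeg \<mu>) m" by (simp add: ydeg_def)
  qed
  have "whomog xdeg (0 + a + 0) g"
    unfolding g_def using e(1) m(1) by (intro xw.whomog_mult xw.whomog_sum xw.whomog_const)
  then have gx: "whomog xdeg a g" by simp
  have "whomog ydeg (0 + 0 + ydeg \<mu>) g"
    unfolding g_def using e(2) m(2) by (intro yw.whomog_mult yw.whomog_sum yw.whomog_const)
  then have gy: "whomog ydeg (ydeg \<mu>) g" by simp
  have "Poly_Mapping.single \<mu> k - G * g \<in> cone_ideal W"
  proof (rule cone_homI)
    show "whomog xdeg (1 + a) (Poly_Mapping.single \<mu> k - G * g)"
      using \<mu> by (intro xw.whomog_minus xw.whomog_mult xw.whomog_single hom_forms gx) simp
    show "whomog ydeg (0 + ydeg \<mu>) (Poly_Mapping.single \<mu> k - G * g)"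
      by (intro yw.whomog_minus yw.whomog_mult yw.whomog_single hom_forms gy) simp
    fix p q assume pq: "(p, q) \<in> W"
    have "ev (pt 1 p 1 q) (\<Sum>p\<in>P. const (\<kappa> p) * e p) = (\<Sum>p'\<in>P. if p' = p then \<kappa> p else 0)"
      unfolding id_hom.insertion_hom
      using e(3) WD(1)[OF pq] by (intro sum.cong) auto
    also have "\<dots> = \<kappa> p" using fin WD(1)[OF pq] by simp
    finally have "ev (pt 1 p 1 q) g = \<kappa> p * (\<Prod>j\<in>UNIV. q j ^ Poly_Mapping.lookup \<mu> (Inr j))"
      by (simp add: g_def m_def id_hom.insertion_hom pt_def del: One_nat_def)
    then show "ev (pt 1 p 1 q) (Poly_Mapping.single \<mu> k - G * g) = 0"
      using d[OF WD(1)[OF pq]]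
      by (simp add: id_hom.insertion_minus id_hom.insertion_mult ev_single_split ev_forms \<kappa>_def)
  qed
  with gx gy show ?thesis by blast
qed

text \<open>Here the y-degree drops, so the y-part cannot be kept. Each point gets an indicator
  polynomial of bidegree (a, b), the product of the indicators of its two coordinates.\<close>

lemma H_surj_single:
  assumes a: "card P \<le> a + 1" and b: "card Q \<le> b + 1" and \<mu>: "xdeg \<mu> = a" "ydeg \<mu> = b + 1"
  shows "\<exists>g. whomog xdeg a g \<and> whomog ydeg b g \<and> Poly_Mapping.single \<mu> k - H * g \<in> cone_ideal W"
proof -
  obtain e :: "('n \<Rightarrow> 'k) \<Rightarrow> ('n + 'm, 'k) mpol"
    where e: "\<And>p. p \<in> P \<Longrightarrow> whomog xdeg a (e p)" "\<And>p. p \<in> P \<Longrightarrow> whomog ydeg 0 (e p)"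
    "\<And>p p' q. p \<in> P \<Longrightarrow> p' \<in> P \<Longrightarrow> ev (pt 1 p' 1 q) (e p) = (if p' = p then 1 else 0)"
    using x_interpolation[OF a] by blast
  obtain e' :: "('m \<Rightarrow> 'k) \<Rightarrow> ('n + 'm, 'k) mpol"
    where e': "\<And>q. q \<in> Q \<Longrightarrow> whomog xdeg 0 (e' q)" "\<And>q. q \<in> Q \<Longrightarrow> whomog ydeg b (e' q)"
    "\<And>p q q'. q \<in> Q \<Longrightarrow> q' \<in> Q \<Longrightarrow> ev (pt 1 p 1 q') (e' q) = (if q' = q then 1 else 0)"
    using y_interpolation[OF b] by blast
  define \<kappa> where "\<kappa> x = ev (pt 1 (fst x) 1 (snd x)) (Poly_Mapping.single \<mu> k) /
    (\<Sum>j\<in>UNIV. c j * snd x j)" for x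
  define g where "g = (\<Sum>x\<in>W. const (\<kappa> x) * (e (fst x) * e' (snd x)))"
  have fW: "finite W" using W(1) fin finite_subset by blast
  have W': "x \<in> W \<Longrightarrow> fst x \<in> P \<and> snd x \<in> Q" for x using W(1) by auto
  have "whomog xdeg (0 + (a + 0)) g"
    unfolding g_def using e(1) e'(1) W' by (intro xw.whomog_sum xw.whomog_mult xw.whomog_const) auto
  then have gx: "whomog xdeg a g" by simp
  have "whomog ydeg (0 + (0 + b)) g"
    unfolding g_def using e(2) e'(2) W' by (intro yw.whomog_sum yw.whomog_mult yw.whomog_const) auto
  then have gy: "whomog ydeg b g" by simp
  have "Poly_Mapping.single \<mu> k - H * g \<in> cone_ideal W"
  proof (rule cone_homI)
    show "whomog xdeg (0 + a) (Poly_Mapping.single \<mu> k - H * g)"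
      using \<mu> by (intro xw.whomog_minus xw.whomog_mult xw.whomog_single hom_forms gx) simp
    show "whomog ydeg (1 + b) (Poly_Mapping.single \<mu> k - H * g)"
      using \<mu> by (intro yw.whomog_minus yw.whomog_mult yw.whomog_single hom_forms gy) simp
    fix p q assume pq: "(p, q) \<in> W"
    have "ev (pt 1 p 1 q) g = (\<Sum>x\<in>W. if x = (p, q) then \<kappa> (p, q) else 0)"
      unfolding id_hom.insertion_hom g_def
      using e(3) e'(3) WD[OF pq] W' by (intro sum.cong) (auto simp: prod_eq_iff)
    also have "\<dots> = \<kappa> (p, q)" using fW pq by simp
    finally have "ev (pt 1 p 1 q) g = \<kappa> (p, q)" .
    then show "ev (pt 1 p 1 q) (Poly_Mapping.single \<mu> k - H * g) = 0"
      using c[OF WD(2)[OF pq]]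
      by (simp add: id_hom.insertion_minus id_hom.insertion_mult ev_forms \<kappa>_def)
  qed
  with gx gy show ?thesis by blast
qed

text \<open>Extends the monomial case by linearity. The y-degree is recorded for the induction in
  \<open>high_degree_in_J2\<close>.\<close>

lemma G_surj:
  assumes a: "card P \<le> a + 1" and f: "whomog xdeg (a + 1) f"
  shows "\<exists>g. whomog xdeg a g \<and> (\<forall>b. whomog ydeg b f \<longrightarrow> whomog ydeg b g) \<and> f - G * g \<in> cone_ideal W"
proof -
  let ?s = "\<lambda>\<mu>. Poly_Mapping.single \<mu> (Poly_Mapping.lookup f \<mu>)"
  have "\<forall>\<mu>\<in>Poly_Mapping.keys f. \<exists>g. whomog xdeg a g \<and> whomog ydeg (ydeg \<mu>) g \<and>
    ?s \<mu> - G * g \<in> cone_ideal W"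
    using G_surj_single[OF a] f by (auto simp: whomog_def)
  then obtain g where g: "\<And>\<mu>. \<mu> \<in> Poly_Mapping.keys f \<Longrightarrow> whomog xdeg a (g \<mu>)"
    "\<And>\<mu>. \<mu> \<in> Poly_Mapping.keys f \<Longrightarrow> whomog ydeg (ydeg \<mu>) (g \<mu>)"
    "\<And>\<mu>. \<mu> \<in> Poly_Mapping.keys f \<Longrightarrow> ?s \<mu> - G * g \<mu> \<in> cone_ideal W"
    by metis
  let ?g = "\<Sum>\<mu>\<in>Poly_Mapping.keys f. g \<mu>"
  have "whomog xdeg a ?g" using g(1) by (rule xw.whomog_sum)
  moreover have "whomog ydeg b ?g" if "whomog ydeg b f" for b
    using g(2) that by (intro yw.whomog_sum) (auto simp: whomog_def)
  moreover have "f - G * ?g \<in> cone_ideal W"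
  proof -
    have "(\<Sum>\<mu>\<in>Poly_Mapping.keys f. ?s \<mu> - G * g \<mu>) \<in> cone_ideal W"
      using g(3) by (intro is_ideal_sum[OF is_ideal_cone])
    then show ?thesis by (simp add: sum_subtractf sum_distrib_left flip: mpol_sum_single)
  qed
  ultimately show ?thesis by blast
qed

lemma H_surj:
  assumes a: "card P \<le> a + 1" and b: "card Q \<le> b + 1" and f: "whomog xdeg a f" "whomog ydeg (b + 1) f"
  shows "\<exists>g. whomog xdeg a g \<and> f - H * g \<in> cone_ideal W"
proof -
  let ?s = "\<lambda>\<mu>. Poly_Mapping.single \<mu> (Poly_Mapping.lookup f \<mu>)"
  have "\<forall>\<mu>\<in>Poly_Mapping.keys f. \<exists>g. whomog xdeg a g \<and> ?s \<mu> - H * g \<in> cone_ideal W"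
    using H_surj_single[OF a b] f unfolding whomog_def by blast
  then obtain g where g: "\<And>\<mu>. \<mu> \<in> Poly_Mapping.keys f \<Longrightarrow> whomog xdeg a (g \<mu>)"
    "\<And>\<mu>. \<mu> \<in> Poly_Mapping.keys f \<Longrightarrow> ?s \<mu> - H * g \<mu> \<in> cone_ideal W"
    by metis
  let ?g = "\<Sum>\<mu>\<in>Poly_Mapping.keys f. g \<mu>"
  have "whomog xdeg a ?g" using g(1) by (rule xw.whomog_sum)
  moreover have "f - H * ?g \<in> cone_ideal W"
  proof -
    have "(\<Sum>\<mu>\<in>Poly_Mapping.keys f. ?s \<mu> - H * g \<mu>) \<in> cone_ideal W"
      using g(2) by (intro is_ideal_sum[OF is_ideal_cone])
    then show ?thesis by (simp add: sum_subtractf sum_distrib_left flip: mpol_sum_single)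
  qed
  ultimately show ?thesis by blast
qed

section \<open>The regular sequence on S/J and the socle element modulo it\<close>

abbreviation "J1 \<equiv> adjoin J H"

abbreviation "J2 \<equiv> adjoin J1 (Y + G)"

lemma is_ideal_J1: "is_ideal J1"
  by (rule is_ideal_adjoin[OF is_ideal_J])

lemma is_ideal_J2: "is_ideal J2"
  by (rule is_ideal_adjoin[OF is_ideal_J1])

lemma wcomp_H: "wcomp xdeg a (H * f) = H * wcomp xdeg a f"
  using xw.wcomp_mult[OF hom_forms(3), of a f] by simp

text \<open>\<open>Y\<close> preserves the x-degree and \<open>G\<close> raises it by one. The
  resulting recursion is solved from below through \<open>Y\<close> and from above through
  \<open>G\<close>.\<close>

lemma wcomp_YG:
  "wcomp xdeg a ((Y + G) * f) = Y * wcomp xdeg a f + (if 1 \<le> a then G * wcomp xdeg (a - 1) f else 0)"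
  unfolding distrib_right xw.wcomp_add
  using xw.wcomp_mult[OF hom_forms(5), of a f] xw.wcomp_mult[OF hom_forms(1), of a f] by simp

lemma J1_wcomp:
  assumes "f \<in> J1" shows "wcomp xdeg a f \<in> J1"
proof -
  obtain j s where "j \<in> J" "f = j + H * s" using assms by (rule adjoinE)
  then show ?thesis by (auto simp: xw.wcomp_add wcomp_H intro: adjoinI J_wcomp)
qed

text \<open>In G f = j + H s, surjectivity of \<open>G\<close> replaces \<open>s\<close> by G g
  modulo I_X; then G (f - H g) lies in I_X and \<open>G\<close> cancels. The bound
  \<open>t \<le> a\<close> serves twice: for surjectivity, and for returning from I_X to
  \<open>J\<close>.\<close>

lemma cancel_G_J1:
  assumes f: "whomog xdeg a f" "t \<le> a" and Gf: "G * f \<in> J1"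
  shows "f \<in> J1"
proof -
  obtain j s where j: "j \<in> J" "G * f = j + H * s" using Gf by (rule adjoinE)
  have "whomog xdeg (1 + a) (G * f)" by (intro xw.whomog_mult hom_forms f)
  then have "G * f = wcomp xdeg (a + 1) (G * f)" by (simp add: xw.wcomp_whomog)
  also have "\<dots> = wcomp xdeg (a + 1) j + H * wcomp xdeg (a + 1) s"
    unfolding j(2) by (simp add: xw.wcomp_add wcomp_H)
  finally have eq: "G * f = wcomp xdeg (a + 1) j + H * wcomp xdeg (a + 1) s" .
  have "card P \<le> a + 1" using card_P f(2) by simp
  from G_surj[OF this xw.whomog_wcomp] obtain g where
    g: "whomog xdeg a g" "wcomp xdeg (a + 1) s - G * g \<in> cone_ideal W" by blast
  have "G * (f - H * g) = wcomp xdeg (a + 1) j + H * (wcomp xdeg (a + 1) s - G * g)"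
    by (simp add: right_diff_distrib eq mult.left_commute)
  also have "\<dots> \<in> cone_ideal W"
    using J_wcomp[OF j(1)] g(2)
    by (intro is_idealD(2,3)[OF is_ideal_cone]) (auto simp: J_def)
  finally have "f - H * g \<in> cone_ideal W" by (rule cancel_G)
  moreover have "whomog xdeg (0 + a) (H * g)" by (intro xw.whomog_mult hom_forms g)
  then have "f - H * g \<in> xpow t" using f by (auto intro!: whomog_xpow xw.whomog_minus)
  ultimately have "f - H * g \<in> J" by (simp add: J_def)
  from adjoinI[OF this, of H g] show ?thesis by simp
qed

lemma cancel_Y:
  assumes "Y * f \<in> adjoin {0} H" shows "f \<in> adjoin {0} H"
proof -
  let ?\<theta> = "\<lambda>_::nat. H"
  have sq: "seq_ideal ?\<theta> 1 = adjoin {0} H" by simp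
  \<comment> \<open>A zero of \<open>H\<close> at which \<open>Y\<close> is 1, so \<open>Y\<close>
    is no multiple of \<open>H\<close>.\<close>
  let ?z = "\<lambda>v :: 'n + 'm. if v = Inr j1 then 1 else if v = Inr j0 then - c j1 / c j0 else 0"
  have "(\<Sum>j\<in>UNIV. c j * ?z (Inr j)) = (\<Sum>j\<in>{j0, j1}. c j * ?z (Inr j))"
    by (rule sum.mono_neutral_right) auto
  also have "\<dots> = 0" using j01 by simp
  finally have "ev ?z H = 0" by (simp add: H_def insertion_iform)
  moreover have "ev ?z Y = 1" unfolding Y_def id_hom.insertion_var by simp
  ultimately have "Y \<notin> adjoin {0} H"
    by (auto elim!: adjoinE simp: id_hom.insertion_mult)
  moreover have "Y \<in> range linform" unfolding Y_def var_eq_linform by simp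
  moreover have "H \<in> range linform" unfolding H_def by (rule iform_linform)
  ultimately show ?thesis
    using linform_regular_mod_linforms[of 1 ?\<theta> Y f] assms unfolding sq by blast
qed

text \<open>In \<open>x\<close>-degrees below \<open>t\<close> the ideal \<open>J\<close> vanishes, so there \<open>Y\<close> is regular modulo \<open>H\<close>.\<close>

lemma low_degree_part:
  assumes x: "x \<in> xpow t" and eq: "(Y + G) * r = x + H * s"
  obtains r' w where "r = r' + H * w" "r' \<in> xpow t"
proof -
  have K: "is_ideal (adjoin {0} H)" by (intro is_ideal_adjoin) (simp add: is_ideal_def)
  \<comment> \<open>Upward induction on the x-degree: the \<open>G\<close>-term comes from the
    previous component, which is already a multiple of \<open>H\<close>, so the
    \<open>Y\<close>-term is one too and \<open>Y\<close> cancels.\<close>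
  have low: "wcomp xdeg a r \<in> adjoin {0} H" if "a < t" for a
    using that
  proof (induction a)
    case 0
    have "Y * wcomp xdeg 0 r = H * wcomp xdeg 0 s"
      using arg_cong[OF eq, of "wcomp xdeg 0"] xpow_wcomp_0[OF x 0]
      by (simp add: wcomp_YG xw.wcomp_add wcomp_H)
    then have "Y * wcomp xdeg 0 r \<in> adjoin {0} H" by (auto simp: adjoin_def)
    then show ?case by (rule cancel_Y)
  next
    case (Suc a)
    have "Y * wcomp xdeg (Suc a) r + G * wcomp xdeg a r = H * wcomp xdeg (Suc a) s"
      using arg_cong[OF eq, of "wcomp xdeg (Suc a)"] xpow_wcomp_0[OF x Suc.prems]
      by (simp add: wcomp_YG xw.wcomp_add wcomp_H)
    then have "Y * wcomp xdeg (Suc a) r = H * wcomp xdeg (Suc a) s - G * wcomp xdeg a r"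
      by (simp add: algebra_simps)
    also have "\<dots> \<in> adjoin {0} H"
      using Suc by (intro is_idealD(3,6)[OF K] adjoin_gen) (auto simp: is_ideal_def)
    finally show ?case by (rule cancel_Y)
  qed
  then have "(\<Sum>a<t. wcomp xdeg a r) \<in> adjoin {0} H" by (intro is_ideal_sum[OF K]) auto
  then obtain w where w: "(\<Sum>a<t. wcomp xdeg a r) = H * w" by (auto elim: adjoinE)
  have "r - H * w \<in> xpow t"
    unfolding w[symmetric]
    by (rule xpowI)
      (simp add: xw.wcomp_minus xw.wcomp_sum xw.wcomp_whomog[OF xw.whomog_wcomp] cong: if_cong)
  then show thesis by (intro that[of "r - H * w" w]) auto
qed

text \<open>Once the part below x-degree t is absorbed into a multiple of \<open>H\<close>, the
  components are treated from the top down: if the component in x-degree a + 1 is in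
  \<open>J1\<close>, then so is \<open>G\<close> times the component in x-degree a, and
  \<open>cancel_G_J1\<close> applies.\<close>

lemma regular_YG:
  assumes "(Y + G) * r \<in> J1" shows "r \<in> J1"
proof -
  obtain j s where j: "j \<in> J" "(Y + G) * r = j + H * s" using assms by (rule adjoinE)
  then have "j \<in> xpow t" by (simp add: J_def)
  from low_degree_part[OF this j(2)] obtain r' w where r': "r = r' + H * w" "r' \<in> xpow t" .
  have "(Y + G) * r' = (Y + G) * r - H * ((Y + G) * w)" by (simp add: r' algebra_simps)
  also have "\<dots> \<in> J1"
    using assms by (intro is_idealD(6)[OF is_ideal_J1] adjoin_gen is_ideal_J)
  finally have YG: "(Y + G) * r' \<in> J1" .
  obtain N where N: "\<And>\<mu>. \<mu> \<in> Poly_Mapping.keys r' \<Longrightarrow> xdeg \<mu> < N"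
    using finite_nat_set_iff_bounded[of "xdeg ` Poly_Mapping.keys r'"] by auto
  \<comment> \<open>The downward induction on \<open>a\<close> is run as an induction on
    \<open>k\<close>, a bound for the distance to \<open>N\<close>; for k = 0 the component is
    0.\<close>
  have high: "wcomp xdeg a r' \<in> J1" if "N \<le> a + k" for a k
    using that
  proof (induction k arbitrary: a)
    case 0
    have "wcomp xdeg a r' = 0"
    proof (rule poly_mapping_eqI)
      fix \<mu>
      show "Poly_Mapping.lookup (wcomp xdeg a r') \<mu> = Poly_Mapping.lookup 0 \<mu>"
        using N[of \<mu>] 0 by (cases "\<mu> \<in> Poly_Mapping.keys r'") (auto simp: xw.lookup_wcomp in_keys_iff)
    qed
    then show ?case using is_idealD(1)[OF is_ideal_J1] by simp
  next
    case (Suc k)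
    show ?case
    proof (cases "t \<le> a")
      case True
      have "Y * wcomp xdeg (a + 1) r' + G * wcomp xdeg a r' \<in> J1"
        using J1_wcomp[OF YG, of "a + 1"] by (simp add: wcomp_YG)
      moreover have "Y * wcomp xdeg (a + 1) r' \<in> J1"
        using Suc.IH[of "a + 1"] Suc.prems by (intro is_idealD(3)[OF is_ideal_J1]) simp
      ultimately have "G * wcomp xdeg a r' \<in> J1"
        using is_idealD(6)[OF is_ideal_J1] by (metis add_diff_cancel_left')
      with xw.whomog_wcomp True show ?thesis by (rule cancel_G_J1)
    next
      case False
      then show ?thesis using xpow_wcomp_0[OF r'(2), of a] is_idealD(1)[OF is_ideal_J1] by simp
    qed
  qed
  have "r' = (\<Sum>a<N. wcomp xdeg a r')" using N by (intro xw.sum_wcomp) auto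
  also have "\<dots> \<in> J1" using high[of _ N] by (intro is_ideal_sum[OF is_ideal_J1]) simp
  finally show ?thesis
    unfolding r'(1) by (intro is_idealD(2)[OF is_ideal_J1] adjoin_gen is_ideal_J)
qed

text \<open>In bidegree (t, 0) neither \<open>H\<close> nor \<open>Y\<close> contributes, since both
  have y-degree 1. Membership would thus put G^t into I_X, although \<open>G\<close> vanishes at no
  point.\<close>

lemma G_power_notin: "G ^ t \<notin> J2"
proof
  assume "G ^ t \<in> J2"
  then obtain x r where x: "x \<in> J1" "G ^ t = x + (Y + G) * r" by (rule adjoinE)
  obtain j s where j': "j \<in> J" "x = j + H * s" using x(1) by (rule adjoinE)
  then have j: "j \<in> J" "G ^ t = j + H * s + (Y + G) * r" using x(2) by simp_all
  have Gt: "whomog xdeg t (G ^ t)" "whomog ydeg 0 (G ^ t)"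
    using xw.whomog_power[OF hom_forms(1), of t] yw.whomog_power[OF hom_forms(2), of t] by simp_all
  \<comment> \<open>Both \<open>G ^ t\<close> and \<open>j\<close> live in x-degrees at least
    \<open>t\<close>, so \<open>low_degree_part\<close> applies to their difference.\<close>
  have YGr: "(Y + G) * r = (G ^ t - j) + H * (- s)" by (simp add: j(2))
  have Gj: "G ^ t - j \<in> xpow t"
    using whomog_xpow[OF Gt(1)] j(1) by (intro is_idealD(6)[OF is_ideal_xpow]) (auto simp: J_def)
  from low_degree_part[OF Gj YGr] obtain r' w where r': "r = r' + H * w" "r' \<in> xpow t" .
  let ?s = "s + (Y + G) * w"
  have eq: "G ^ t = j + H * ?s + (Y + G) * r'" by (simp add: j(2) r'(1) algebra_simps)
  have "G ^ t = wcomp xdeg t (G ^ t)" using xw.wcomp_whomog[OF Gt(1)] by simp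
  \<comment> \<open>For t > 0 the \<open>G\<close>-term involves the component of \<open>r'\<close>
    in x-degree t - 1, which is 0; for t = 0 there is no such term.\<close>
  also have "\<dots> = wcomp xdeg t j + H * wcomp xdeg t ?s + Y * wcomp xdeg t r'"
    unfolding eq
    using xpow_wcomp_0[OF r'(2), of "t - 1"] by (simp add: xw.wcomp_add wcomp_H wcomp_YG)
  finally have eq2: "G ^ t = wcomp xdeg t j + H * wcomp xdeg t ?s + Y * wcomp xdeg t r'" .
  have "G ^ t = wcomp ydeg 0 (G ^ t)" using yw.wcomp_whomog[OF Gt(2)] by simp
  also have "\<dots> = wcomp ydeg 0 (wcomp xdeg t j)"
    unfolding eq2
    using yw.wcomp_mult[OF hom_forms(4), of 0] yw.wcomp_mult[OF hom_forms(6), of 0]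
    by (simp add: yw.wcomp_add)
  also have "\<dots> \<in> cone_ideal W" using j(1) by (auto simp: J_def intro!: cone_wcomp inf)
  finally have "G ^ t \<in> cone_ideal W" .
  moreover obtain p q where pq: "(p, q) \<in> W" using W(2) by auto
  ultimately have "ev (pt 1 p 1 q) (G ^ t) = 0" using cone_idealD[of _ W p q 1 1] by simp
  then show False using d[OF WD(1)[OF pq]] by (simp add: id_hom.insertion_power ev_forms)
qed

text \<open>Modulo \<open>Y + G\<close>, a factor \<open>G\<close> can be traded for
  \<open>- Y\<close>: the x-degree drops by one and the total degree is kept. When x-degree t is
  reached, the y-degree is at least \<open>card Q\<close>, and there every polynomial is a multiple
  of \<open>H\<close> modulo \<open>J\<close>.\<close>

lemma high_degree_in_J2:
  assumes "whomog xdeg a f" "whomog ydeg b f" "t \<le> a" "t + card Q \<le> a + b"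
  shows "f \<in> J2"
  using assms
proof (induction "a - t" arbitrary: a b f)
  case 0
  then have at: "a = t" by simp
  have "Q \<noteq> {}" using W by auto
  then have "card Q > 0" using fin by (simp add: card_gt_0_iff)
  then obtain b' where b': "b = b' + 1" using 0 at by (cases b) auto
  have "card P \<le> a + 1" "card Q \<le> b' + 1" using card_P at 0 b' by auto
  from H_surj[OF this 0(2) 0(3)[unfolded b']] obtain g where
    g: "whomog xdeg a g" "f - H * g \<in> cone_ideal W" by blast
  have "whomog xdeg (0 + a) (H * g)" by (intro xw.whomog_mult hom_forms g)
  then have "f - H * g \<in> J"
    using g(2) whomog_xpow[OF xw.whomog_minus[OF 0(2)]] 0(4) by (simp add: J_def)
  from adjoinI[OF this, of H g] show ?case by (simp add: adjoin_superset)
next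
  case (Suc x)
  then obtain a' where a': "a = a' + 1" "t \<le> a'" by (cases a) auto
  have "card P \<le> a' + 1" using card_P a' by simp
  from G_surj[OF this Suc(3)[unfolded a'(1)]] obtain g where
    g: "whomog xdeg a' g" "whomog ydeg b g" "f - G * g \<in> cone_ideal W" using Suc.prems(2) by blast
  have "whomog xdeg (1 + a') (G * g)" by (intro xw.whomog_mult hom_forms g)
  then have "f - G * g \<in> J"
    using g(3) whomog_xpow[OF xw.whomog_minus[OF Suc.prems(1)]] Suc.prems(3) a'
    by (simp add: J_def)
  then have 1: "f - G * g \<in> J2" by (intro adjoin_superset)
  have "whomog xdeg (0 + a') (Y * g)" "whomog ydeg (1 + b) (Y * g)"
    by (intro xw.whomog_mult yw.whomog_mult hom_forms g)+
  then have 2: "Y * g \<in> J2" using Suc.hyps(1)[of a' "Y * g" "1 + b"] Suc.hyps(2) Suc.prems a' by simp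
  have 3: "(Y + G) * g \<in> J2" by (rule adjoin_gen[OF is_ideal_J1])
  have "(f - G * g) + ((Y + G) * g - Y * g) \<in> J2"
    by (intro is_idealD(2,6)[OF is_ideal_J2] 1 2 3)
  then show ?case by (simp add: algebra_simps)
qed

text \<open>Among the monomial multiples of G^t outside \<open>J2\<close>, one of maximal total
  degree is moved into \<open>J2\<close> by every variable. The maximum exists because G^t itself is
  outside \<open>J2\<close>, while multiples by monomials of degree at least \<open>card Q\<close>
  are inside.\<close>

lemma socle_element: "\<exists>u. u \<notin> J2 \<and> (\<forall>v. var v * u \<in> J2)"
proof -
  let ?m = "\<lambda>\<mu>. Poly_Mapping.single \<mu> 1 * G ^ t"
  let ?S = "{k. \<exists>\<mu>. xdeg \<mu> + ydeg \<mu> = k \<and> ?m \<mu> \<notin> J2}"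
  have Gt: "whomog xdeg t (G ^ t)" "whomog ydeg 0 (G ^ t)"
    using xw.whomog_power[OF hom_forms(1), of t] yw.whomog_power[OF hom_forms(2), of t] by simp_all
  have bd: "k < card Q" if "k \<in> ?S" for k
  proof (rule ccontr)
    assume k: "\<not> k < card Q"
    obtain \<mu> where \<mu>: "xdeg \<mu> + ydeg \<mu> = k" "?m \<mu> \<notin> J2" using \<open>k \<in> ?S\<close> by blast
    have "whomog xdeg (xdeg \<mu> + t) (?m \<mu>)" "whomog ydeg (ydeg \<mu> + 0) (?m \<mu>)"
      by (intro xw.whomog_mult yw.whomog_mult Gt xw.whomog_single yw.whomog_single refl)+
    then have "?m \<mu> \<in> J2" using \<mu>(1) k by (intro high_degree_in_J2) auto
    with \<mu>(2) show False ..
  qed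
  have "0 \<in> ?S" using G_power_notin by (auto intro!: exI[of _ 0] simp: xw.w_zero yw.w_zero)
  moreover have "finite ?S" using bd by (intro finite_subset[of ?S "{..<card Q}"]) auto
  ultimately have "Max ?S \<in> ?S" by (intro Max_in) auto
  then obtain \<mu> where \<mu>: "xdeg \<mu> + ydeg \<mu> = Max ?S" "?m \<mu> \<notin> J2" by blast
  have "var v * ?m \<mu> \<in> J2" for v
  proof (rule ccontr)
    assume "var v * ?m \<mu> \<notin> J2"
    then have "?m (Poly_Mapping.single v 1 + \<mu>) \<notin> J2" by (simp add: mult_single mult.assoc[symmetric])
    then have "xdeg (Poly_Mapping.single v 1 + \<mu>) + ydeg (Poly_Mapping.single v 1 + \<mu>) \<le> Max ?S"
      using \<open>finite ?S\<close> by (intro Max_ge) blast+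
    moreover have "xdeg (Poly_Mapping.single v 1) + ydeg (Poly_Mapping.single v 1) = 1"
      by (cases v) (auto simp: xydeg_single)
    ultimately show False using \<mu>(1) by (simp add: xw.w_add yw.w_add)
  qed
  with \<mu>(2) show ?thesis by blast
qed

end

section \<open>The maximal ideal and a basis of the linear forms\<close>

definition maxI :: "('v::finite, 'k::field) mpol set" where
  "maxI = {f. ev (\<lambda>v. 0) f = 0}"

lemma is_ideal_maxI: "is_ideal maxI"
  by (simp add: is_ideal_def maxI_def id_hom.insertion_hom)

text \<open>Replacing all variables by 0 does not change \<open>f\<close> modulo \<open>K\<close>,
  and it leaves only the constant term.\<close>

lemma maxI_subset:
  fixes K :: "('v::finite, 'k::field) mpol set"
  assumes K: "is_ideal K" and v: "\<And>v. var v \<in> K"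
  shows "maxI \<subseteq> K"
proof
  fix f :: "('v, 'k) mpol" assume f: "f \<in> maxI"
  have const_mult: "const (a * b) = const a * (const b :: ('v, 'k) mpol)" for a b :: 'k
    by (simp add: mult_single)
  have const_power: "const (a ^ r) = (const a :: ('v, 'k) mpol) ^ r" for a :: 'k and r
    by (induction r) (simp_all add: const_mult)
  have const_prod: "const (prod h A) = (\<Prod>v\<in>A. const (h v) :: ('v, 'k) mpol)" if "finite A"
    for h :: "'v \<Rightarrow> 'k" and A
    using that by induction (simp_all add: const_mult)
  have "insertion const (\<lambda>v. const 0 :: ('v, 'k) mpol) f = const (ev (\<lambda>v. 0) f)"
    by (induction f rule: mpol_induct)
      (simp_all only: const_hom.insertion_single id_hom.insertion_single const_hom.insertion_add
        id_hom.insertion_add single_add const_mult const_power const_prod finite)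
  then have "insertion const (\<lambda>v. 0 :: ('v, 'k) mpol) f = const (ev (\<lambda>v. 0) f)" by simp
  moreover have "insertion const (\<lambda>v. var v) f - insertion const (\<lambda>v. 0) f \<in> K"
    using v by (intro insertion_cong_ideal[OF K]) simp
  ultimately show "f \<in> K"
    using f by (simp add: insertion_self maxI_def del: One_nat_def)
qed

text \<open>Used contrapositively: a common zero of the earlier forms at which the next form is
  nonzero keeps the next form out of their ideal.\<close>

lemma ev_seq_ideal:
  assumes "\<And>k. k < i \<Longrightarrow> ev z (\<theta> k) = 0" "a \<in> seq_ideal \<theta> i"
  shows "ev z a = 0"
  using assms by (induction i arbitrary: a) (auto elim!: adjoinE simp: id_hom.insertion_hom)

lemma seq_ideal_mono: "i \<le> k \<Longrightarrow> a \<in> seq_ideal \<theta> i \<Longrightarrow> a \<in> seq_ideal \<theta> k"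
  by (induction k) (auto simp: le_Suc_eq adjoin_superset)

lemma seq_ideal_gen: "i < k \<Longrightarrow> \<theta> i \<in> seq_ideal \<theta> k"
  using seq_ideal_mono[of "Suc i" k "\<theta> i" \<theta>] adjoin_gen'[OF is_ideal_seq_ideal] by auto

context cone_points
begin

text \<open>After the two special forms come the n + m variables other than the y-variables at
  \<open>j0\<close> and \<open>j1\<close>. These generate all variables: \<open>G\<close> lies in
  the span of the x-variables, so \<open>Y\<close> is recovered from \<open>Y + G\<close>, and then
  the variable at \<open>j0\<close> from \<open>H\<close>.\<close>

lemma linform_sequence:
  assumes "CARD('n) = n + 1" "CARD('m) = m + 1"
  obtains \<theta> where "\<theta> 0 = H" "\<theta> 1 = Y + G" "\<And>i. \<theta> i \<in> maxI"
    "maxI \<subseteq> seq_ideal \<theta> (Suc (Suc (n + m)))"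
    "\<And>i a. i < Suc (Suc (n + m)) \<Longrightarrow> \<theta> i * a \<in> seq_ideal \<theta> i \<Longrightarrow> a \<in> seq_ideal \<theta> i"
proof -
  let ?T = "UNIV - {Inr j0, Inr j1} :: ('n + 'm) set"
  have "card ?T = n + m"
    using assms j01(2) by (subst card_Diff_subset) (auto simp: card_UNIV_sum)
  then obtain f where f: "bij_betw f {0..<n + m} ?T"
    using ex_bij_betw_nat_finite[of ?T] by auto
  define \<theta> :: "nat \<Rightarrow> ('n + 'm, 'k) mpol" where
    "\<theta> i = (case i of 0 \<Rightarrow> H | Suc j \<Rightarrow> (case j of 0 \<Rightarrow> Y + G | Suc k \<Rightarrow> var (f k)))" for i
  have \<theta>: "\<theta> 0 = H" "\<theta> (Suc 0) = Y + G" "\<And>k. \<theta> (Suc (Suc k)) = var (f k)"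
    by (simp_all add: \<theta>_def)
  have Y_lin: "Y = linform (\<lambda>w. if w = Inr j1 then 1 else 0)"
    unfolding Y_def var_eq_linform ..
  have lin: "\<theta> i \<in> range linform" for i
  proof -
    consider "i = 0" | "i = Suc 0" | k where "i = Suc (Suc k)" by (metis not0_implies_Suc)
    then show ?thesis
    proof cases
      case 1
      then show ?thesis by (simp add: \<theta> H_def iform_linform)
    next
      case 2
      obtain e where "G = linform e" unfolding G_def using iform_linform by blast
      then show ?thesis using 2 by (simp add: \<theta> Y_lin linform_add)
    next
      case 3
      then show ?thesis by (simp only: \<theta> var_eq_linform) simp
    qed
  qed
  have evY: "ev z Y = z (Inr j1)" for z
    unfolding Y_def id_hom.insertion_var by simp
  have evG: "ev z G = (\<Sum>i\<in>UNIV. d i * z (Inl i))" and evH: "ev z H = (\<Sum>j\<in>UNIV. c j * z (Inr j))" for z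
    by (simp_all add: G_def H_def insertion_iform)
  have ev_var: "ev z (var w) = z w" for z and w :: "'n + 'm"
    unfolding id_hom.insertion_var by simp
  \<comment> \<open>Corrects the one coordinate at \<open>Inr j0\<close> so that \<open>H\<close>
    vanishes and leaves the others alone.\<close>
  define solve :: "('n + 'm \<Rightarrow> 'k) \<Rightarrow> 'n + 'm \<Rightarrow> 'k" where
    "solve z = z(Inr j0 := - (\<Sum>j\<in>UNIV - {j0}. c j * z (Inr j)) / c j0)" for z
  have solve_H: "ev (solve z) H = 0" for z
  proof -
    have "ev (solve z) H = c j0 * solve z (Inr j0) + (\<Sum>j\<in>UNIV - {j0}. c j * solve z (Inr j))"
      unfolding evH by (simp add: sum.remove[of _ j0])
    also have "(\<Sum>j\<in>UNIV - {j0}. c j * solve z (Inr j)) = (\<Sum>j\<in>UNIV - {j0}. c j * z (Inr j))"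
      by (intro sum.cong) (auto simp: solve_def)
    also have "c j0 * solve z (Inr j0) = - (\<Sum>j\<in>UNIV - {j0}. c j * z (Inr j))"
      using j01(1) by (simp add: solve_def)
    finally show ?thesis by simp
  qed
  have "\<exists>z. (\<forall>k<i. ev z (\<theta> k) = 0) \<and> ev z (\<theta> i) \<noteq> 0" if i: "i < Suc (Suc (n + m))" for i
  proof -
    consider "i = 0" | "i = Suc 0" | k where "i = Suc (Suc k)" by (metis not0_implies_Suc)
    then show ?thesis
    proof cases
      case 1
      let ?z = "\<lambda>v. if v = Inr j0 then 1 else 0"
      have "ev ?z H = (\<Sum>j\<in>UNIV. if j = j0 then c j0 else 0)"
        unfolding evH by (intro sum.cong) auto
      then have "ev ?z H \<noteq> 0" using j01(1) by simp
      then show ?thesis using 1 \<theta> by (intro exI[of _ ?z]) simp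
    next
      case 2
      let ?z = "solve (\<lambda>v. if v = Inr j1 then 1 else 0)"
      have "ev ?z (Y + G) = 1"
        unfolding id_hom.insertion_add evY evG using j01(2) by (simp add: solve_def)
      then show ?thesis using 2 \<theta> solve_H by (intro exI[of _ ?z]) simp
    next
      case 3
      let ?z0 = "\<lambda>v. if v = f k then 1 else (0::'k)"
      \<comment> \<open>The unit vector at \<open>f k\<close>, with the coordinate at
        \<open>j1\<close> set to cancel \<open>G\<close> and then the one at \<open>j0\<close> set
        to cancel \<open>H\<close>. The order matters, because \<open>H\<close> may involve
        \<open>j1\<close>, whereas \<open>Y + G\<close> does not involve \<open>j0\<close>.\<close>
      define z where "z = solve (?z0(Inr j1 := - (\<Sum>i\<in>UNIV. d i * ?z0 (Inl i))))"
      have k: "k < n + m" using i 3 by simp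
      have fT: "f k' \<in> ?T" if "k' < n + m" for k' using bij_betwE[OF f] that by simp
      have zT: "z w = ?z0 w" if "w \<in> ?T" for w using that by (simp add: z_def solve_def)
      have z_f: "z (f k') = (if k' = k then 1 else 0)" if "k' < n + m" for k'
      proof -
        have "f k' = f k \<longleftrightarrow> k' = k"
          using inj_onD[OF bij_betw_imp_inj_on[OF f], of k' k] that k by auto
        then show ?thesis using zT[OF fT[OF that]] by simp
      qed
      have z_YG: "ev z (Y + G) = 0"
        unfolding id_hom.insertion_add evY evG using j01(2) by (simp add: z_def solve_def)
      have z_H: "ev z H = 0" unfolding z_def by (rule solve_H)
      have "ev z (\<theta> k') = 0" if "k' < i" for k'
      proof -
        consider "k' = 0" | "k' = Suc 0" | l where "k' = Suc (Suc l)" by (metis not0_implies_Suc)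
        then show ?thesis
        proof cases
          case 3
          then have "l < n + m" "l \<noteq> k" using that \<open>i = Suc (Suc k)\<close> k by auto
          then show ?thesis using z_f[of l] by (simp only: 3 \<theta> ev_var if_False)
        qed (use z_YG z_H in \<open>simp_all add: \<theta>\<close>)
      qed
      moreover have "ev z (\<theta> i) = 1" using z_f[OF k] by (simp only: 3 \<theta> ev_var if_True refl)
      ultimately show ?thesis by (intro exI[of _ z]) simp
    qed
  qed
  then have "\<theta> i \<notin> seq_ideal \<theta> i" if "i < Suc (Suc (n + m))" for i
    using that ev_seq_ideal[of i _ \<theta> "\<theta> i"] by blast
  then have reg: "\<theta> i * a \<in> seq_ideal \<theta> i \<Longrightarrow> a \<in> seq_ideal \<theta> i" if "i < Suc (Suc (n + m))" for i a
    using linform_regular_mod_linforms[of i \<theta> "\<theta> i" a] lin that by blast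
  have max: "\<theta> i \<in> maxI" for i
  proof -
    obtain e where "\<theta> i = linform e" using lin by blast
    then show ?thesis by (simp add: maxI_def id_hom.insertion_linform)
  qed
  let ?K = "seq_ideal \<theta> (Suc (Suc (n + m)))"
  note K = is_ideal_seq_ideal[of \<theta> "Suc (Suc (n + m))"]
  note gen = seq_ideal_gen[of _ "Suc (Suc (n + m))" \<theta>]
  have varT: "var w \<in> ?K" if "w \<in> ?T" for w
  proof -
    have "w \<in> f ` {0..<n + m}" using f that by (simp add: bij_betw_def)
    then obtain k where "k < n + m" "w = f k" by auto
    then show ?thesis using gen[of "Suc (Suc k)"] by (simp del: seq_ideal.simps One_nat_def add: \<theta>)
  qed
  have expand: "iform \<iota> e = (\<Sum>i\<in>UNIV. const (e i) * var (\<iota> i))"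
    for \<iota> :: "'i::finite \<Rightarrow> 'n + 'm" and e :: "'i \<Rightarrow> 'k"
    by (simp add: iform_def mult_single)
  have "G \<in> ?K"
    unfolding G_def expand by (intro is_ideal_sum[OF K] is_idealD(3)[OF K] varT) auto
  moreover have "Y + G \<in> ?K" using gen[of "Suc 0"] by (simp del: seq_ideal.simps add: \<theta>)
  ultimately have "(Y + G) - G \<in> ?K" by (intro is_idealD(6)[OF K])
  then have "Y \<in> ?K" by (simp del: seq_ideal.simps)
  then have var1: "var w \<in> ?K" if "w \<noteq> Inr j0" for w
    using varT[of w] that by (cases "w = Inr j1") (auto simp: Y_def simp del: One_nat_def seq_ideal.simps)
  have "H - (\<Sum>j\<in>UNIV - {j0}. const (c j) * var (Inr j)) = const (c j0) * var (Inr j0)"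
    unfolding H_def expand by (subst sum.remove[of _ j0]) auto
  moreover have "H - (\<Sum>j\<in>UNIV - {j0}. const (c j) * var (Inr j)) \<in> ?K"
  proof -
    have "H \<in> ?K" using gen[of 0] by (simp del: seq_ideal.simps add: \<theta>)
    moreover have "(\<Sum>j\<in>UNIV - {j0}. const (c j) * var (Inr j)) \<in> ?K"
      by (intro is_ideal_sum[OF K] is_idealD(3)[OF K] var1) auto
    ultimately show ?thesis by (rule is_idealD(6)[OF K])
  qed
  ultimately have "const (c j0) * var (Inr j0) \<in> ?K" by (simp only:)
  then have "const (1 / c j0) * (const (c j0) * var (Inr j0)) \<in> ?K"
    by (rule is_idealD(3)[OF K])
  moreover have "const (1 / c j0) * (const (c j0) * var (Inr j0)) = (var (Inr j0) :: ('n + 'm, 'k) mpol)"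
    using j01(1) by (simp add: mult_single)
  ultimately have "var (Inr j0) \<in> ?K" by (simp only:)
  then have "var w \<in> ?K" for w using var1[of w] by (cases "w = Inr j0") (simp_all only: not_False_eq_True)
  then have "maxI \<subseteq> ?K" by (intro maxI_subset K)
  then show thesis
    by (intro that[of \<theta>]) (use reg max \<theta> in \<open>auto simp del: seq_ideal.simps\<close>)
qed

lemma resolution_length:
  assumes card: "CARD('n) = n + 1" "CARD('m) = m + 1" and "matrix_complex E A"
    and dd: "\<And>i f. f \<in> matrix_complex.supp E (Suc (Suc i)) UNIV \<Longrightarrow>
        matrix_complex.diff E A i (matrix_complex.diff E A (Suc i) f) = 0"
    and ex: "\<And>i f. f \<in> matrix_complex.supp E (Suc i) UNIV \<Longrightarrow> matrix_complex.diff E A i f = 0 \<Longrightarrow>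
        f \<in> matrix_complex.diff E A (Suc i) ` matrix_complex.supp E (Suc (Suc i)) UNIV"
    and h0: "\<And>f. f \<in> matrix_complex.supp E 0 UNIV \<Longrightarrow>
        (\<Sum>e\<in>E 0. f e * s e) \<in> J \<longleftrightarrow> f \<in> matrix_complex.diff E A 0 ` matrix_complex.supp E 1 UNIV"
    and f1: "f1 \<in> matrix_complex.supp E 0 UNIV" "(\<Sum>e\<in>E 0. f1 e * s e) - 1 \<in> J"
    and entries: "\<And>i e e'. A i e e' \<in> maxI"
  shows "E (n + m) \<noteq> {} \<and> (\<forall>i>n + m. E i = {})"
proof -
  interpret matrix_complex E A by fact
  obtain \<theta> where \<theta>: "\<theta> 0 = H" "\<theta> 1 = Y + G" "\<And>i. \<theta> i \<in> maxI"
    "maxI \<subseteq> seq_ideal \<theta> (Suc (Suc (n + m)))"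
    "\<And>i a. i < Suc (Suc (n + m)) \<Longrightarrow> \<theta> i * a \<in> seq_ideal \<theta> i \<Longrightarrow> a \<in> seq_ideal \<theta> i"
    using linform_sequence[OF card] by blast
  obtain u where u: "u \<notin> J2" "\<And>v. var v * u \<in> J2" using socle_element by blast
  \<comment> \<open>The annihilator of \<open>u\<close> modulo \<open>J2\<close> is an ideal
    containing all variables, hence all of \<open>maxI\<close>.\<close>
  have "is_ideal {a. a * u \<in> J2}"
    using is_ideal_J2 by (auto simp: is_ideal_def distrib_right mult.assoc)
  then have "maxI \<subseteq> {a. a * u \<in> J2}" using u(2) by (intro maxI_subset) auto
  then have u': "a * u \<in> J2" if "a \<in> maxI" for a using that by blast
  have one: "1 \<notin> maxI" by (simp add: maxI_def id_hom.insertion_one)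
  show ?thesis
    by (rule length_eq_of_depth_two[OF dd ex is_ideal_J h0 f1 is_ideal_maxI one entries \<theta>(4,3,5)])
      (use regular_H regular_YG u(1) u' in \<open>auto simp only: \<theta>(1,2)\<close>)
qed

end

section \<open>The Cox ring record and its ideals\<close>

lemma cox_simps:
  "carrier cox_ring = UNIV" "f \<oplus>\<^bsub>cox_ring\<^esub> g = f + g" "f \<otimes>\<^bsub>cox_ring\<^esub> g = f * g"
  "f \<odot>\<^bsub>cox_ring\<^esub> g = f * g" "\<zero>\<^bsub>cox_ring\<^esub> = 0" "\<one>\<^bsub>cox_ring\<^esub> = 1"
  by (simp_all add: cox_ring_def)

lemma cring_cox: "cring (cox_ring :: (('n::finite, 'm::finite, 'k::field) cox, ('n, 'm, 'k) cox) gmod)"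
proof (rule cringI)
  show "abelian_group (cox_ring :: (('n::finite, 'm::finite, 'k::field) cox, ('n, 'm, 'k) cox) gmod)"
  proof (rule abelian_groupI)
    fix x :: "('n::finite, 'm::finite, 'k::field) cox"
    show "\<exists>y\<in>carrier cox_ring. y \<oplus>\<^bsub>cox_ring\<^esub> x = \<zero>\<^bsub>cox_ring\<^esub>"
      by (rule bexI[of _ "- x"]) (simp_all add: cox_simps)
  qed (auto simp: cox_simps algebra_simps)
  show "comm_monoid (cox_ring :: (('n::finite, 'm::finite, 'k::field) cox, ('n, 'm, 'k) cox) gmod)"
    by (rule comm_monoidI) (auto simp: cox_simps algebra_simps)
qed (auto simp: cox_simps algebra_simps)

interpretation cox: cring "cox_ring :: (('n::finite, 'm::finite, 'k::field) cox, ('n, 'm, 'k) cox) gmod"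
  by (rule cring_cox)

lemma cox_a_inv: "\<ominus>\<^bsub>cox_ring\<^esub> f = - f"
  by (rule cox.minus_equality) (simp_all add: cox_simps)

lemma ideal_cox_iff: "ideal I cox_ring \<longleftrightarrow> is_ideal I"
proof
  assume "ideal I cox_ring"
  then interpret ideal I cox_ring .
  show "is_ideal I"
    using zero_closed a_closed I_l_closed by (auto simp: is_ideal_def cox_simps)
next
  assume I: "is_ideal I"
  show "ideal I cox_ring"
  proof (rule idealI)
    show "subgroup I (add_monoid cox_ring)"
    proof (rule cox.add.subgroupI)
      show "I \<noteq> {}" using is_idealD(1)[OF I] by auto
    qed (use is_idealD[OF I] in \<open>auto simp: cox_simps cox_a_inv\<close>)
  qed (use is_idealD[OF I] in \<open>auto simp: cox_simps cox.ring_axioms\<close>)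
qed

lemma bidegree_eq: "bidegree \<mu> = (int (xdeg \<mu>), int (ydeg \<mu>))"
  by (simp add: bidegree_def xdeg_def ydeg_def)

lemma cox_var_eq: "cox_var v = var v"
  by (simp add: cox_var_def)

lemma is_ideal_genideal: "is_ideal (Idl\<^bsub>cox_ring\<^esub> S)"
  using cox.genideal_ideal[of S] by (simp add: ideal_cox_iff cox_simps)

lemma genideal_gen: "s \<in> S \<Longrightarrow> s \<in> Idl\<^bsub>cox_ring\<^esub> S"
  using cox.genideal_self[of S] by (auto simp: cox_simps)

lemma genideal_subset: "is_ideal I \<Longrightarrow> S \<subseteq> I \<Longrightarrow> Idl\<^bsub>cox_ring\<^esub> S \<subseteq> I"
  by (rule cox.genideal_minimal) (simp_all add: ideal_cox_iff)

lemma is_ideal_x_ideal: "is_ideal x_ideal" and is_ideal_y_ideal: "is_ideal y_ideal"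
  unfolding x_ideal_def y_ideal_def by (rule is_ideal_genideal)+

lemma is_ideal_irrelevant: "is_ideal irrelevant_ideal"
  using is_ideal_x_ideal is_ideal_y_ideal unfolding irrelevant_ideal_def is_ideal_def by blast

lemma is_ideal_power: "is_ideal I \<Longrightarrow> is_ideal (ideal_power cox_ring I t)"
proof (induction t)
  case 0
  then show ?case by (simp add: is_ideal_def cox_simps)
next
  case (Suc t)
  then show ?case
    using cox.ideal_prod_is_ideal[of I "ideal_power cox_ring I t"] by (simp add: ideal_cox_iff)
qed

lemma ideal_power_mono:
  assumes "I \<subseteq> K" shows "ideal_power cox_ring I t \<subseteq> ideal_power cox_ring K t"
proof (induction t)
  case (Suc t)
  show ?case
  proof
    fix a assume "a \<in> ideal_power cox_ring I (Suc t)"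
    then have "a \<in> I \<cdot>\<^bsub>cox_ring\<^esub> ideal_power cox_ring I t" by simp
    then show "a \<in> ideal_power cox_ring K (Suc t)"
      by induction (use assms Suc in \<open>auto intro: ideal_prod.intros\<close>)
  qed
qed simp

lemma ideal_power_Suc_subset: "is_ideal I \<Longrightarrow> ideal_power cox_ring I (Suc t) \<subseteq> ideal_power cox_ring I t"
  using cox.ideal_prod_inter[of I "ideal_power cox_ring I t"] is_ideal_power[of I t]
  by (auto simp: ideal_cox_iff)

lemma ideal_power_antimono:
  "is_ideal I \<Longrightarrow> s \<le> t \<Longrightarrow> ideal_power cox_ring I t \<subseteq> ideal_power cox_ring I s"
proof (induction t)
  case (Suc t)
  then show ?case using ideal_power_Suc_subset[of I t] by (auto simp: le_Suc_eq)
qed simp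

lemma xdeg_pos_factor:
  fixes k :: "'k::field"
  assumes "xdeg \<mu> \<noteq> 0"
  obtains i \<nu> where "xdeg \<mu> = Suc (xdeg \<nu>)"
    "Poly_Mapping.single \<mu> k = var (Inl i) * Poly_Mapping.single \<nu> k"
proof -
  obtain i where "Poly_Mapping.lookup \<mu> (Inl i) \<noteq> 0"
    using assms by (auto simp: xdeg_def)
  then obtain \<nu> where \<nu>: "\<mu> = Poly_Mapping.single (Inl i) 1 + \<nu>"
    "Poly_Mapping.single \<mu> k = var (Inl i) * Poly_Mapping.single \<nu> k"
    by (metis single_Suc_factor)
  then have "xdeg \<mu> = Suc (xdeg \<nu>)" by (simp add: xw.w_add xydeg_single)
  then show thesis using \<nu>(2) that by blast
qed

lemma xpow_expand:
  fixes K :: "('a::finite + 'b::finite, 'c::field) mpol set"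
  assumes K: "is_ideal K" and single: "\<And>\<mu> k. t \<le> xdeg \<mu> \<Longrightarrow> Poly_Mapping.single \<mu> k \<in> K"
  shows "xpow t \<subseteq> K"
proof
  fix f :: "('a + 'b, 'c) mpol" assume "f \<in> xpow t"
  then show "f \<in> K"
    by (subst mpol_sum_single) (auto simp: xpow_def intro!: is_ideal_sum[OF K] single)
qed

lemma x_ideal_eq: "(x_ideal :: ('a::finite, 'b::finite, 'c::field) cox set) = xpow 1" (is "?L = ?R")
proof
  show "?L \<subseteq> ?R"
    unfolding x_ideal_def
    by (intro genideal_subset is_ideal_xpow)
      (auto simp: xpow_def cox_var_eq xydeg_single simp del: One_nat_def)
  show "?R \<subseteq> ?L"
  proof (rule xpow_expand[OF is_ideal_x_ideal])
    fix \<mu> :: "'a + 'b \<Rightarrow>\<^sub>0 nat" and k :: 'c assume "1 \<le> xdeg \<mu>"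
    then have "xdeg \<mu> \<noteq> 0" by simp
    then obtain i \<nu> where "Poly_Mapping.single \<mu> k = var (Inl i) * Poly_Mapping.single \<nu> k"
      by (rule xdeg_pos_factor)
    moreover have "var (Inl i) \<in> (x_ideal :: ('a, 'b, 'c) cox set)"
      unfolding x_ideal_def cox_var_eq[symmetric] by (rule genideal_gen) blast
    ultimately show "Poly_Mapping.single \<mu> k \<in> x_ideal"
      using is_idealD(4)[OF is_ideal_x_ideal] by simp
  qed
qed

text \<open>Multiplying adds x-degrees, which gives one inclusion; for the other, a monomial of
  x-degree at least t + 1 splits off one x-variable.\<close>

lemma ideal_power_x_ideal:
  "ideal_power cox_ring (x_ideal :: ('a::finite, 'b::finite, 'c::field) cox set) t = xpow t"
proof (induction t)
  case 0
  then show ?case by (simp add: cox_simps xpow_def)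
next
  case (Suc t)
  show ?case
  proof
    have "a \<in> xpow (Suc t)" if "a \<in> xpow 1 \<cdot>\<^bsub>cox_ring\<^esub> xpow t"
      for a :: "('a, 'b, 'c) cox"
      using that
    proof induction
      case (prod i j)
      show ?case
        unfolding xpow_def cox_simps
      proof (clarify)
        fix \<mu> assume "\<mu> \<in> Poly_Mapping.keys (i * j)"
        then obtain \<kappa> \<nu> where "\<mu> = \<kappa> + \<nu>" "\<kappa> \<in> Poly_Mapping.keys i" "\<nu> \<in> Poly_Mapping.keys j"
          using keys_mult[of i j] by blast
        then show "Suc t \<le> xdeg \<mu>" using prod by (fastforce simp: xw.w_add xpow_def)
      qed
    next
      case (sum a b)
      then show ?case using is_idealD(2)[OF is_ideal_xpow] by (simp add: cox_simps)
    qed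
    then show "ideal_power cox_ring (x_ideal :: ('a, 'b, 'c) cox set) (Suc t) \<subseteq> xpow (Suc t)"
      by (simp only: ideal_power.simps Suc) (auto simp: x_ideal_eq)
    show "xpow (Suc t) \<subseteq> ideal_power cox_ring (x_ideal :: ('a, 'b, 'c) cox set) (Suc t)"
    proof (rule xpow_expand[OF is_ideal_power[OF is_ideal_x_ideal]])
      fix \<mu> :: "'a + 'b \<Rightarrow>\<^sub>0 nat" and k :: 'c assume \<mu>: "Suc t \<le> xdeg \<mu>"
      then have "xdeg \<mu> \<noteq> 0" by simp
      then obtain i \<nu> where \<nu>: "xdeg \<mu> = Suc (xdeg \<nu>)"
        "Poly_Mapping.single \<mu> k = var (Inl i) * Poly_Mapping.single \<nu> k"
        by (rule xdeg_pos_factor)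
      have "var (Inl i) \<in> (x_ideal :: ('a, 'b, 'c) cox set)"
        unfolding x_ideal_def cox_var_eq[symmetric] by (rule genideal_gen) blast
      moreover have "Poly_Mapping.single \<nu> k \<in> ideal_power cox_ring x_ideal t"
        unfolding Suc using \<mu> \<nu>(1) by (intro whomog_xpow[OF xw.whomog_single[OF refl]]) simp
      ultimately show "Poly_Mapping.single \<mu> k \<in> ideal_power cox_ring x_ideal (Suc t)"
        using ideal_prod.prod[of "var (Inl i)" x_ideal "Poly_Mapping.single \<nu> k" _ cox_ring]
        by (simp add: cox_simps \<nu>(2) del: One_nat_def)
    qed
  qed
qed

lemma maximal_ideal_subset:
  "(maximal_ideal :: ('a::finite, 'b::finite, 'c::field) cox set) \<subseteq> maxI"
  unfolding maximal_ideal_def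
proof (rule genideal_subset[OF is_ideal_maxI])
  have "(var v :: ('a + 'b, 'c) mpol) \<in> maxI" for v
    unfolding maxI_def by (simp add: id_hom.insertion_var del: One_nat_def)
  then show "range cox_var \<subseteq> (maxI :: ('a, 'b, 'c) cox set)" by (auto simp: cox_var_eq simp del: One_nat_def)
qed

section \<open>Projective points and their vanishing ideal\<close>

definition coords :: "('n, 'k::field) proj_space \<Rightarrow> 'n \<Rightarrow> 'k" where
  "coords p = (SOME a. homogeneous_coords p a)"

lemma abs_proj_eq_iff:
  assumes "\<exists>i. a i \<noteq> 0" "\<exists>i. b i \<noteq> 0"
  shows "abs_proj_space a = abs_proj_space b \<longleftrightarrow> proj_rel a b"
proof -
  have "proj_rel a a" if "\<exists>i. a i \<noteq> 0" for a :: "'a \<Rightarrow> 'b"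
    using that by (auto simp: proj_rel_def intro!: exI[of _ 1])
  then show ?thesis using Quotient3_rel[OF Quotient3_proj_space, of a b] assms by blast
qed

lemma homogeneous_coords_coords: "homogeneous_coords p (coords p)"
proof -
  have "proj_rel (rep_proj_space p) (rep_proj_space p)"
    using Quotient3_rep_reflp[OF Quotient3_proj_space] .
  then have "homogeneous_coords p (rep_proj_space p)"
    using Quotient3_abs_rep[OF Quotient3_proj_space, of p]
    by (auto simp: homogeneous_coords_def proj_rel_def)
  then show ?thesis unfolding coords_def by (rule someI[where P = "homogeneous_coords p"])
qed

lemma coords_nonzero: "\<exists>i. coords p i \<noteq> 0"
  using homogeneous_coords_coords[of p] by (auto simp: homogeneous_coords_def)

lemma homogeneous_coords_iff:
  "homogeneous_coords p a \<longleftrightarrow> (\<exists>s. s \<noteq> 0 \<and> a = (\<lambda>i. s * coords p i))"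
proof
  assume a: "homogeneous_coords p a"
  then have "abs_proj_space (coords p) = abs_proj_space a" "\<exists>i. a i \<noteq> 0"
    using homogeneous_coords_coords[of p] by (auto simp: homogeneous_coords_def)
  then show "\<exists>s. s \<noteq> 0 \<and> a = (\<lambda>i. s * coords p i)"
    using abs_proj_eq_iff[OF coords_nonzero, of a p] by (auto simp: proj_rel_def)
next
  assume "\<exists>s. s \<noteq> 0 \<and> a = (\<lambda>i. s * coords p i)"
  then obtain s where s: "s \<noteq> 0" "a = (\<lambda>i. s * coords p i)" by blast
  then have "\<exists>i. a i \<noteq> 0" "proj_rel (coords p) a"
    using coords_nonzero[of p] by (auto simp: proj_rel_def)
  then show "homogeneous_coords p a"
    using abs_proj_eq_iff[OF coords_nonzero, of a p] homogeneous_coords_coords[of p]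
    by (auto simp: homogeneous_coords_def)
qed

lemma nonproportional_coords: "nonproportional (coords ` A)"
  unfolding nonproportional_def
proof (intro conjI ballI allI impI)
  fix a assume "a \<in> coords ` A"
  then show "\<exists>i. a i \<noteq> 0" using coords_nonzero by auto
next
  fix a b c assume "a \<in> coords ` A" "b \<in> coords ` A" and b: "b = (\<lambda>i. c * a i)"
  then obtain p q where pq: "a = coords p" "b = coords q" by blast
  have "c \<noteq> 0" using coords_nonzero[of q] b pq by auto
  then have "homogeneous_coords p b" unfolding homogeneous_coords_iff using b pq by blast
  then have "p = q" using homogeneous_coords_coords[of q] pq by (simp add: homogeneous_coords_def)
  then show "a = b" using pq by simp
qed

lemma eval_cox_eq: "eval_cox f a b = ev (case_sum a b) f"
  by (simp add: eval_cox_def insertion_def)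

text \<open>The generators vanish on the bicone. Conversely, the bihomogeneous components of an
  element of the cone ideal stay in it by \<open>cone_wcomp\<close>, so they are generators, and the
  element is their sum.\<close>

lemma vanishing_ideal_eq:
  fixes X :: "(('n::finite, 'k::field) proj_space \<times> ('m::finite, 'k) proj_space) set"
  assumes inf: "infinite (UNIV :: 'k set)"
  shows "vanishing_ideal X = cone_ideal ((\<lambda>(p, q). (coords p, coords q)) ` X)" (is "_ = ?C")
proof
  show "vanishing_ideal X \<subseteq> ?C"
    unfolding vanishing_ideal_def
  proof (rule genideal_subset[OF is_ideal_cone], clarify)
    fix f d assume f: "\<forall>(p, q)\<in>X. \<forall>a b. homogeneous_coords p a \<and> homogeneous_coords q b \<longrightarrow> eval_cox f a b = 0"
    show "f \<in> ?C"
      unfolding cone_ideal_def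
    proof clarsimp
      fix p q and s r :: 'k assume pq: "(p, q) \<in> X" "s \<noteq> 0" "r \<noteq> 0"
      then have "homogeneous_coords p (\<lambda>i. s * coords p i)" "homogeneous_coords q (\<lambda>i. r * coords q i)"
        unfolding homogeneous_coords_iff by blast+
      then show "ev (pt s (coords p) r (coords q)) f = 0"
        using f pq(1) unfolding eval_cox_eq pt_def by blast
    qed
  qed
  show "?C \<subseteq> vanishing_ideal X"
  proof
    fix f assume f: "f \<in> ?C"
    have "wcomp ydeg b (wcomp xdeg a f) \<in> vanishing_ideal X" for a b
    proof -
      let ?g = "wcomp ydeg b (wcomp xdeg a f)"
      have "?g \<in> hcomp cox_ring (int a, int b)"
        by (auto simp: cox_ring_def bidegree_eq in_keys_iff xw.lookup_wcomp yw.lookup_wcomp split: if_splits)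
      moreover have "eval_cox ?g x y = 0"
        if pq: "(p, q) \<in> X" and xy: "homogeneous_coords p x" "homogeneous_coords q y" for p q x y
      proof -
        obtain s r where "s \<noteq> 0" "x = (\<lambda>i. s * coords p i)" "r \<noteq> 0" "y = (\<lambda>i. r * coords q i)"
          using xy unfolding homogeneous_coords_iff by blast
        moreover have "?g \<in> ?C" by (intro cone_wcomp inf f)
        ultimately show ?thesis
          using cone_idealD[of ?g _ "coords p" "coords q" s r] pq
          unfolding eval_cox_eq pt_def by force
      qed
      ultimately show ?thesis
        unfolding vanishing_ideal_def by (intro genideal_gen) blast
    qed
    moreover have "f = (\<Sum>a\<in>xdeg ` Poly_Mapping.keys f.
        \<Sum>b\<in>ydeg ` Poly_Mapping.keys (wcomp xdeg a f). wcomp ydeg b (wcomp xdeg a f))"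
    proof -
      have "f = (\<Sum>a\<in>xdeg ` Poly_Mapping.keys f. wcomp xdeg a f)" by (rule xw.sum_wcomp) auto
      also have "\<dots> = (\<Sum>a\<in>xdeg ` Poly_Mapping.keys f.
        \<Sum>b\<in>ydeg ` Poly_Mapping.keys (wcomp xdeg a f). wcomp ydeg b (wcomp xdeg a f))"
        by (intro sum.cong refl yw.sum_wcomp) auto
      finally show ?thesis .
    qed
    moreover have "is_ideal (vanishing_ideal X)"
      unfolding vanishing_ideal_def by (rule is_ideal_genideal)
    ultimately show "f \<in> vanishing_ideal X" by (metis (no_types, lifting) is_ideal_sum)
  qed
qed

section \<open>Quotients of graded modules\<close>

locale quotient_module = Module.module R M
  for R :: "('a, 'a) gmod" and M :: "('a, 'b) gmod" +
  fixes N :: "'b set"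
  assumes N_sub: "subgroup N (add_monoid M)"
    and N_smult: "a \<in> carrier R \<Longrightarrow> u \<in> N \<Longrightarrow> a \<odot>\<^bsub>M\<^esub> u \<in> N"
begin

sublocale N: abelian_subgroup N M
  by (rule abelian_subgroupI3) (auto intro: additive_subgroup.intro N_sub M.abelian_group_axioms)

lemma N_carrier: "u \<in> N \<Longrightarrow> u \<in> carrier M"
  using N.a_subset by blast

abbreviation Q where "Q \<equiv> quot_gmod M N"

lemma carrier_Q: "carrier Q = (\<lambda>u. N +>\<^bsub>M\<^esub> u) ` carrier M"
  by (auto simp: quot_gmod_def A_RCOSETS_def')

lemma coset_in_Q: "u \<in> carrier M \<Longrightarrow> N +>\<^bsub>M\<^esub> u \<in> carrier Q"
  by (auto simp: carrier_Q)

lemma coset_eq_iff: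
  assumes "u \<in> carrier M" "v \<in> carrier M"
  shows "N +>\<^bsub>M\<^esub> u = N +>\<^bsub>M\<^esub> v \<longleftrightarrow> u \<ominus>\<^bsub>M\<^esub> v \<in> N"
proof
  assume "N +>\<^bsub>M\<^esub> u = N +>\<^bsub>M\<^esub> v"
  then have "u \<in> N +>\<^bsub>M\<^esub> v" using N.a_rcos_self[OF assms(1)] by simp
  then obtain h where h: "h \<in> N" "u = h \<oplus>\<^bsub>M\<^esub> v" by (auto simp: a_r_coset_def')
  then have "u \<ominus>\<^bsub>M\<^esub> v = h"
    using assms N_carrier[OF h(1)] by (simp add: M.minus_eq M.a_assoc M.r_neg)
  then show "u \<ominus>\<^bsub>M\<^esub> v \<in> N" using h(1) by simp
next
  assume uv: "u \<ominus>\<^bsub>M\<^esub> v \<in> N"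
  have "u = (u \<ominus>\<^bsub>M\<^esub> v) \<oplus>\<^bsub>M\<^esub> v" using assms by (simp add: M.minus_eq M.a_assoc M.l_neg)
  then have "u \<in> N +>\<^bsub>M\<^esub> v" using uv by (auto simp: a_r_coset_def')
  then show "N +>\<^bsub>M\<^esub> u = N +>\<^bsub>M\<^esub> v"
    using M.a_repr_independence[of u N v] assms(2) N_sub by simp
qed

lemma coset_zero: "N +>\<^bsub>M\<^esub> \<zero>\<^bsub>M\<^esub> = N"
  using M.a_coset_add_zero N.a_subset by blast

lemma zero_Q: "\<zero>\<^bsub>Q\<^esub> = N"
  by (simp add: quot_gmod_def)

lemma coset_eq_zero_iff: "u \<in> carrier M \<Longrightarrow> N +>\<^bsub>M\<^esub> u = \<zero>\<^bsub>Q\<^esub> \<longleftrightarrow> u \<in> N"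
proof -
  assume "u \<in> carrier M"
  moreover from this have "u \<ominus>\<^bsub>M\<^esub> \<zero>\<^bsub>M\<^esub> = u"
    using M.add.inv_one by (simp add: M.minus_eq a_inv_def)
  ultimately show ?thesis using coset_eq_iff[of u "\<zero>\<^bsub>M\<^esub>"] by (simp add: coset_zero zero_Q)
qed

lemma add_Q:
  "u \<in> carrier M \<Longrightarrow> v \<in> carrier M \<Longrightarrow>
    (N +>\<^bsub>M\<^esub> u) \<oplus>\<^bsub>Q\<^esub> (N +>\<^bsub>M\<^esub> v) = N +>\<^bsub>M\<^esub> (u \<oplus>\<^bsub>M\<^esub> v)"
  by (simp add: quot_gmod_def N.a_rcos_sum)

lemma smult_Q:
  assumes a: "a \<in> carrier R" and u: "u \<in> carrier M"
  shows "a \<odot>\<^bsub>Q\<^esub> (N +>\<^bsub>M\<^esub> u) = N +>\<^bsub>M\<^esub> (a \<odot>\<^bsub>M\<^esub> u)"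
proof -
  have "N <+>\<^bsub>M\<^esub> (\<lambda>u. a \<odot>\<^bsub>M\<^esub> u) ` (N +>\<^bsub>M\<^esub> u) = N +>\<^bsub>M\<^esub> (a \<odot>\<^bsub>M\<^esub> u)"
  proof
    show "N <+>\<^bsub>M\<^esub> (\<lambda>u. a \<odot>\<^bsub>M\<^esub> u) ` (N +>\<^bsub>M\<^esub> u) \<subseteq> N +>\<^bsub>M\<^esub> (a \<odot>\<^bsub>M\<^esub> u)"
    proof
      fix x assume "x \<in> N <+>\<^bsub>M\<^esub> (\<lambda>u. a \<odot>\<^bsub>M\<^esub> u) ` (N +>\<^bsub>M\<^esub> u)"
      then obtain h k where hk: "h \<in> N" "k \<in> N" "x = h \<oplus>\<^bsub>M\<^esub> a \<odot>\<^bsub>M\<^esub> (k \<oplus>\<^bsub>M\<^esub> u)"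
        by (auto simp: set_add_def' a_r_coset_def')
      have "x = (h \<oplus>\<^bsub>M\<^esub> a \<odot>\<^bsub>M\<^esub> k) \<oplus>\<^bsub>M\<^esub> a \<odot>\<^bsub>M\<^esub> u"
        unfolding hk(3) using N_carrier[OF hk(1)] N_carrier[OF hk(2)] a u
        by (simp add: smult_r_distr M.a_assoc)
      moreover have "h \<oplus>\<^bsub>M\<^esub> a \<odot>\<^bsub>M\<^esub> k \<in> N" using hk a N_smult by simp
      ultimately show "x \<in> N +>\<^bsub>M\<^esub> (a \<odot>\<^bsub>M\<^esub> u)" by (auto simp: a_r_coset_def')
    qed
    show "N +>\<^bsub>M\<^esub> (a \<odot>\<^bsub>M\<^esub> u) \<subseteq> N <+>\<^bsub>M\<^esub> (\<lambda>u. a \<odot>\<^bsub>M\<^esub> u) ` (N +>\<^bsub>M\<^esub> u)"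
    proof
      fix x assume "x \<in> N +>\<^bsub>M\<^esub> (a \<odot>\<^bsub>M\<^esub> u)"
      then obtain h where "h \<in> N" "x = h \<oplus>\<^bsub>M\<^esub> a \<odot>\<^bsub>M\<^esub> u" by (auto simp: a_r_coset_def')
      then show "x \<in> N <+>\<^bsub>M\<^esub> (\<lambda>u. a \<odot>\<^bsub>M\<^esub> u) ` (N +>\<^bsub>M\<^esub> u)"
        using N.a_rcos_self[OF u] by (auto simp: set_add_def')
    qed
  qed
  then show ?thesis by (simp add: quot_gmod_def)
qed

lemma hcomp_Q: "hcomp Q d = (\<lambda>u. N +>\<^bsub>M\<^esub> u) ` hcomp M d"
  by (simp add: quot_gmod_def)

lemma module_Q: "Module.module R Q"
proof (rule moduleI)
  show "cring R" by (rule R.is_cring)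
  show "abelian_group Q"
  proof (rule abelian_groupI)
    fix x y assume "x \<in> carrier Q" "y \<in> carrier Q"
    then show "x \<oplus>\<^bsub>Q\<^esub> y \<in> carrier Q" by (auto simp: carrier_Q add_Q)
  next
    show "\<zero>\<^bsub>Q\<^esub> \<in> carrier Q" using coset_in_Q[of "\<zero>\<^bsub>M\<^esub>"] by (simp add: coset_zero zero_Q)
  next
    fix x y z assume "x \<in> carrier Q" "y \<in> carrier Q" "z \<in> carrier Q"
    then show "x \<oplus>\<^bsub>Q\<^esub> y \<oplus>\<^bsub>Q\<^esub> z = x \<oplus>\<^bsub>Q\<^esub> (y \<oplus>\<^bsub>Q\<^esub> z)"
      by (auto simp: carrier_Q add_Q M.a_assoc)
  next
    fix x y assume "x \<in> carrier Q" "y \<in> carrier Q"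
    then show "x \<oplus>\<^bsub>Q\<^esub> y = y \<oplus>\<^bsub>Q\<^esub> x" by (auto simp: carrier_Q add_Q M.a_comm)
  next
    fix x assume "x \<in> carrier Q"
    then obtain u where u: "u \<in> carrier M" "x = N +>\<^bsub>M\<^esub> u" by (auto simp: carrier_Q)
    have z: "\<zero>\<^bsub>Q\<^esub> = N +>\<^bsub>M\<^esub> \<zero>\<^bsub>M\<^esub>" by (simp add: zero_Q coset_zero)
    show "\<zero>\<^bsub>Q\<^esub> \<oplus>\<^bsub>Q\<^esub> x = x" unfolding z u(2) using u(1) by (simp add: add_Q)
    show "\<exists>y\<in>carrier Q. y \<oplus>\<^bsub>Q\<^esub> x = \<zero>\<^bsub>Q\<^esub>"
      unfolding z u(2) using u(1)
      by (intro bexI[of _ "N +>\<^bsub>M\<^esub> (\<ominus>\<^bsub>M\<^esub> u)"]) (auto simp: add_Q M.l_neg coset_in_Q)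
  qed
qed (auto simp: carrier_Q add_Q smult_Q smult_l_distr smult_r_distr smult_assoc1)

end

lemma graded_homD:
  assumes "graded_hom R M N f"
  shows "u \<in> carrier M \<Longrightarrow> f u \<in> carrier N"
    "u \<in> carrier M \<Longrightarrow> v \<in> carrier M \<Longrightarrow> f (u \<oplus>\<^bsub>M\<^esub> v) = f u \<oplus>\<^bsub>N\<^esub> f v"
    "a \<in> carrier R \<Longrightarrow> u \<in> carrier M \<Longrightarrow> f (a \<odot>\<^bsub>M\<^esub> u) = a \<odot>\<^bsub>N\<^esub> f u"
    "u \<in> hcomp M d \<Longrightarrow> f u \<in> hcomp N d"
  using assms unfolding graded_hom_def by blast+

lemma graded_hom_zero:
  assumes "graded_hom R M N f" "Module.module R M" "Module.module R N"
  shows "f \<zero>\<^bsub>M\<^esub> = \<zero>\<^bsub>N\<^esub>"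
proof -
  interpret M: Module.module R M by fact
  interpret N: Module.module R N by fact
  have "f (\<zero>\<^bsub>R\<^esub> \<odot>\<^bsub>M\<^esub> \<zero>\<^bsub>M\<^esub>) = \<zero>\<^bsub>R\<^esub> \<odot>\<^bsub>N\<^esub> f \<zero>\<^bsub>M\<^esub>"
    by (rule graded_homD(3)[OF assms(1)]) auto
  then show ?thesis using graded_homD(1)[OF assms(1), of "\<zero>\<^bsub>M\<^esub>"] by simp
qed

lemma quotient_moduleI:
  assumes "Module.module R M" "N \<subseteq> carrier M" "\<zero>\<^bsub>M\<^esub> \<in> N"
    "\<And>u v. u \<in> N \<Longrightarrow> v \<in> N \<Longrightarrow> u \<oplus>\<^bsub>M\<^esub> v \<in> N"
    "\<And>a u. a \<in> carrier R \<Longrightarrow> u \<in> N \<Longrightarrow> a \<odot>\<^bsub>M\<^esub> u \<in> N"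
  shows "quotient_module R M N"
proof -
  interpret Module.module R M by fact
  have "\<ominus>\<^bsub>M\<^esub> u \<in> N" if "u \<in> N" for u
    using assms(5)[of "\<ominus>\<^bsub>R\<^esub> \<one>\<^bsub>R\<^esub>" u] that assms(2) by (auto simp: smult_l_minus)
  then have "subgroup N (add_monoid M)"
    using assms by (intro M.add.subgroupI) (auto simp: a_inv_def)
  then show ?thesis
    using assms by (intro quotient_module.intro quotient_module_axioms.intro) auto
qed

lemma graded_iso_quotients:
  assumes M: "quotient_module R M P" and N: "quotient_module R N P'"
    and f: "graded_hom R M N f" "f ` carrier M = carrier N"
    and P: "\<And>u. u \<in> carrier M \<Longrightarrow> f u \<in> P' \<longleftrightarrow> u \<in> P"
    and hM: "\<And>d. hcomp M d \<subseteq> carrier M"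
  shows "graded_iso R (quot_gmod M P) (quot_gmod N P')"
proof -
  interpret M: quotient_module R M P by fact
  interpret N: quotient_module R N P' by fact
  note fD = graded_homD[OF f(1)]
  have f_minus: "f (u \<ominus>\<^bsub>M\<^esub> v) = f u \<ominus>\<^bsub>N\<^esub> f v" if "u \<in> carrier M" "v \<in> carrier M" for u v
  proof -
    have "f (u \<ominus>\<^bsub>M\<^esub> v) \<oplus>\<^bsub>N\<^esub> f v = f u"
      using that by (subst fD(2)[symmetric]) (auto simp: M.M.minus_eq M.M.a_assoc M.M.l_neg)
    moreover have "f (u \<ominus>\<^bsub>M\<^esub> v) \<oplus>\<^bsub>N\<^esub> f v \<ominus>\<^bsub>N\<^esub> f v = f (u \<ominus>\<^bsub>M\<^esub> v)"
      using that fD(1) by (simp add: N.M.minus_eq N.M.a_assoc N.M.r_neg)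
    ultimately show ?thesis by simp
  qed
  \<comment> \<open>Defined on sets instead of representatives: P' plus the image of a coset is the
    full coset of the image of any member, so independence of the representative is built
    in.\<close>
  define \<Phi> where "\<Phi> C = P' <+>\<^bsub>N\<^esub> f ` C" for C
  have \<Phi>: "\<Phi> (P +>\<^bsub>M\<^esub> u) = P' +>\<^bsub>N\<^esub> f u" if u: "u \<in> carrier M" for u
  proof
    show "\<Phi> (P +>\<^bsub>M\<^esub> u) \<subseteq> P' +>\<^bsub>N\<^esub> f u"
    proof
      fix x assume "x \<in> \<Phi> (P +>\<^bsub>M\<^esub> u)"
      then obtain h k where hk: "h \<in> P'" "k \<in> P" "x = h \<oplus>\<^bsub>N\<^esub> f (k \<oplus>\<^bsub>M\<^esub> u)"
        by (auto simp: \<Phi>_def set_add_def' a_r_coset_def')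
      have k: "k \<in> carrier M" "f k \<in> P'" using hk(2) M.N_carrier P by auto
      have "x = (h \<oplus>\<^bsub>N\<^esub> f k) \<oplus>\<^bsub>N\<^esub> f u"
        unfolding hk(3) using N.N_carrier[OF hk(1)] N.N_carrier[OF k(2)] k(1) u fD(1)[OF u]
        by (simp add: N.M.a_assoc fD(2))
      moreover have "h \<oplus>\<^bsub>N\<^esub> f k \<in> P'" using hk k by simp
      ultimately show "x \<in> P' +>\<^bsub>N\<^esub> f u" by (auto simp: a_r_coset_def')
    qed
    show "P' +>\<^bsub>N\<^esub> f u \<subseteq> \<Phi> (P +>\<^bsub>M\<^esub> u)"
    proof
      fix x assume "x \<in> P' +>\<^bsub>N\<^esub> f u"
      then obtain h where "h \<in> P'" "x = h \<oplus>\<^bsub>N\<^esub> f u" by (auto simp: a_r_coset_def')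
      then show "x \<in> \<Phi> (P +>\<^bsub>M\<^esub> u)"
        using M.N.a_rcos_self[OF u] by (auto simp: \<Phi>_def set_add_def')
    qed
  qed
  have "graded_hom R M.Q N.Q \<Phi>"
    unfolding graded_hom_def
  proof (intro conjI ballI allI)
    show "\<Phi> \<in> carrier M.Q \<rightarrow> carrier N.Q"
      by (auto simp: M.carrier_Q \<Phi> intro!: N.coset_in_Q fD)
    show "\<Phi> (x \<oplus>\<^bsub>M.Q\<^esub> y) = \<Phi> x \<oplus>\<^bsub>N.Q\<^esub> \<Phi> y" if "x \<in> carrier M.Q" "y \<in> carrier M.Q" for x y
      using that by (auto simp: M.carrier_Q \<Phi> M.add_Q N.add_Q fD)
    show "\<Phi> (a \<odot>\<^bsub>M.Q\<^esub> x) = a \<odot>\<^bsub>N.Q\<^esub> \<Phi> x" if "a \<in> carrier R" "x \<in> carrier M.Q" for a x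
      using that by (auto simp: M.carrier_Q \<Phi> M.smult_Q N.smult_Q fD)
    show "\<Phi> ` hcomp M.Q d \<subseteq> hcomp N.Q d" for d
      using hM[of d] fD(4)[of _ d] by (auto simp: M.hcomp_Q N.hcomp_Q \<Phi> subset_iff)
  qed
  moreover have "bij_betw \<Phi> (carrier M.Q) (carrier N.Q)"
  proof (rule bij_betw_imageI)
    show "inj_on \<Phi> (carrier M.Q)"
    proof (rule inj_onI)
      fix x y assume xy: "x \<in> carrier M.Q" "y \<in> carrier M.Q" "\<Phi> x = \<Phi> y"
      then obtain u v where uv: "u \<in> carrier M" "v \<in> carrier M" "x = P +>\<^bsub>M\<^esub> u" "y = P +>\<^bsub>M\<^esub> v"
        by (auto simp: M.carrier_Q)
      then have "f (u \<ominus>\<^bsub>M\<^esub> v) \<in> P'"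
        using xy(3) fD(1) by (simp add: \<Phi> N.coset_eq_iff f_minus)
      then show "x = y" using uv P[of "u \<ominus>\<^bsub>M\<^esub> v"] by (simp add: M.coset_eq_iff)
    qed
    show "\<Phi> ` carrier M.Q = carrier N.Q"
    proof -
      have "\<Phi> ` carrier M.Q = (\<lambda>u. P' +>\<^bsub>N\<^esub> f u) ` carrier M"
        by (simp add: M.carrier_Q image_image \<Phi>)
      then show ?thesis by (simp add: N.carrier_Q f(2)[symmetric] image_image)
    qed
  qed
  ultimately show ?thesis unfolding graded_iso_def by blast
qed

section \<open>Torsion modulo the truncated ideal\<close>

lemma torsion_quotient_module:
  fixes M :: "(('n::finite, 'm::finite, 'k::field) cox, 'b) gmod"
  assumes M: "Module.module cox_ring M" and B: "is_ideal B"
  shows "quotient_module cox_ring M (torsion cox_ring B M)"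
proof (rule quotient_moduleI[OF M])
  interpret Module.module cox_ring M by fact
  show "torsion cox_ring B M \<subseteq> carrier M" by (auto simp: torsion_def)
  show "\<zero>\<^bsub>M\<^esub> \<in> torsion cox_ring B M" by (auto simp: torsion_def cox_simps)
  fix u v assume "u \<in> torsion cox_ring B M" "v \<in> torsion cox_ring B M"
  then obtain s t where s: "u \<in> carrier M" "\<And>b. b \<in> ideal_power cox_ring B s \<Longrightarrow> b \<odot>\<^bsub>M\<^esub> u = \<zero>\<^bsub>M\<^esub>"
    and t: "v \<in> carrier M" "\<And>b. b \<in> ideal_power cox_ring B t \<Longrightarrow> b \<odot>\<^bsub>M\<^esub> v = \<zero>\<^bsub>M\<^esub>"
    by (auto simp: torsion_def)
  have "b \<odot>\<^bsub>M\<^esub> (u \<oplus>\<^bsub>M\<^esub> v) = \<zero>\<^bsub>M\<^esub>" if "b \<in> ideal_power cox_ring B (max s t)" for b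
  proof -
    have "b \<in> ideal_power cox_ring B s" "b \<in> ideal_power cox_ring B t"
      using that ideal_power_antimono[OF B, of s "max s t"] ideal_power_antimono[OF B, of t "max s t"]
      by auto
    then show ?thesis using s t by (simp add: smult_r_distr cox_simps)
  qed
  then show "u \<oplus>\<^bsub>M\<^esub> v \<in> torsion cox_ring B M" using s t by (auto simp: torsion_def)
next
  interpret Module.module cox_ring M by fact
  fix a :: "('n, 'm, 'k) cox" and u assume a: "a \<in> carrier cox_ring" and "u \<in> torsion cox_ring B M"
  then obtain s where s: "u \<in> carrier M" "\<And>b. b \<in> ideal_power cox_ring B s \<Longrightarrow> b \<odot>\<^bsub>M\<^esub> u = \<zero>\<^bsub>M\<^esub>"
    by (auto simp: torsion_def)
  have "b \<odot>\<^bsub>M\<^esub> (a \<odot>\<^bsub>M\<^esub> u) = \<zero>\<^bsub>M\<^esub>" if "b \<in> ideal_power cox_ring B s" for b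
  proof -
    have "b \<odot>\<^bsub>M\<^esub> (a \<odot>\<^bsub>M\<^esub> u) = (a \<otimes>\<^bsub>cox_ring\<^esub> b) \<odot>\<^bsub>M\<^esub> u"
      using smult_assoc1[of b a u] s(1) by (simp add: cox_simps mult.commute)
    also have "\<dots> = a \<odot>\<^bsub>M\<^esub> (b \<odot>\<^bsub>M\<^esub> u)" using s(1) by (intro smult_assoc1) (auto simp: cox_simps)
    finally show ?thesis using s(2)[OF that] a by simp
  qed
  then show "a \<odot>\<^bsub>M\<^esub> u \<in> torsion cox_ring B M" using s(1) a by (auto simp: torsion_def)
qed

lemma module_cox: "Module.module cox_ring (cox_ring :: (('n::finite, 'm::finite, 'k::field) cox, _) gmod)"
  by (rule moduleI) (auto simp: cox_simps algebra_simps cox.is_cring cox.is_abelian_group)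

lemma quotient_module_cox:
  assumes "is_ideal I"
  shows "quotient_module cox_ring (cox_ring :: (('n::finite, 'm::finite, 'k::field) cox, _) gmod) I"
  using is_idealD[OF assms] by (intro quotient_moduleI module_cox) (auto simp: cox_simps)

lemma cox_minus: "f \<ominus>\<^bsub>cox_ring\<^esub> g = f - g"
  by (simp add: cox.minus_eq cox_a_inv cox_simps)

lemma truncation_torsion_iso:
  fixes M :: "(('n::finite, 'm::finite, 'k::field) cox, 'b) gmod"
  assumes M: "Module.module cox_ring M" "\<And>d. hcomp M d \<subseteq> carrier M"
    and I: "is_ideal I"
    and iso: "graded_iso cox_ring M (quot_gmod cox_ring (I \<inter> ideal_power cox_ring x_ideal t))"
  shows "graded_iso cox_ring
      (quot_gmod M (torsion cox_ring irrelevant_ideal M))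
      (quot_gmod (quot_gmod cox_ring I) (torsion cox_ring irrelevant_ideal (quot_gmod cox_ring I)))"
proof -
  let ?B = "irrelevant_ideal :: ('n, 'm, 'k) cox set"
  define J where "J = I \<inter> ideal_power cox_ring x_ideal t"
  have J: "is_ideal J"
    using I is_ideal_power[OF is_ideal_x_ideal, of t] unfolding J_def is_ideal_def by blast
  interpret I: quotient_module cox_ring cox_ring I by (rule quotient_module_cox[OF I])
  interpret J: quotient_module cox_ring cox_ring J by (rule quotient_module_cox[OF J])
  obtain f where f: "graded_hom cox_ring M J.Q f" "bij_betw f (carrier M) (carrier J.Q)"
    using iso unfolding graded_iso_def J_def by blast
  note fD = graded_homD[OF f(1)]
  \<comment> \<open>The projection S/J -> S/I on cosets; as J is contained in I, adding
    \<open>I\<close> to a coset of \<open>J\<close> gives a coset of \<open>I\<close>.\<close>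
  define q where "q C = I <+>\<^bsub>cox_ring\<^esub> C" for C
  have q: "q (J +>\<^bsub>cox_ring\<^esub> s) = I +>\<^bsub>cox_ring\<^esub> s" for s
  proof
    show "q (J +>\<^bsub>cox_ring\<^esub> s) \<subseteq> I +>\<^bsub>cox_ring\<^esub> s"
    proof
      fix x assume "x \<in> q (J +>\<^bsub>cox_ring\<^esub> s)"
      then obtain h k where "h \<in> I" "k \<in> J" "x = h + (k + s)"
        by (auto simp: q_def set_add_def' a_r_coset_def' cox_simps)
      moreover from this have "h + k \<in> I" using is_idealD(2)[OF I] by (auto simp: J_def)
      ultimately show "x \<in> I +>\<^bsub>cox_ring\<^esub> s"
        by (auto simp: a_r_coset_def' cox_simps add.assoc[symmetric])
    qed
    show "I +>\<^bsub>cox_ring\<^esub> s \<subseteq> q (J +>\<^bsub>cox_ring\<^esub> s)"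
    proof
      fix x assume "x \<in> I +>\<^bsub>cox_ring\<^esub> s"
      then obtain h where "h \<in> I" "x = h \<oplus>\<^bsub>cox_ring\<^esub> s" by (auto simp: a_r_coset_def')
      then show "x \<in> q (J +>\<^bsub>cox_ring\<^esub> s)"
        using J.N.a_rcos_self[of s] by (auto simp: q_def set_add_def' cox_simps(1))
    qed
  qed
  have lift: "\<exists>s. x = J +>\<^bsub>cox_ring\<^esub> s" if "x \<in> carrier J.Q" for x
    using that by (auto simp: J.carrier_Q)
  have hom: "graded_hom cox_ring M I.Q (\<lambda>u. q (f u))"
    unfolding graded_hom_def
  proof (intro conjI ballI allI)
    show "(\<lambda>u. q (f u)) \<in> carrier M \<rightarrow> carrier I.Q"
      using fD(1) lift by (fastforce simp: q I.carrier_Q cox_simps)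
    fix u v assume uv: "u \<in> carrier M" "v \<in> carrier M"
    obtain x y where "f u = J +>\<^bsub>cox_ring\<^esub> x" "f v = J +>\<^bsub>cox_ring\<^esub> y"
      using lift fD(1) uv by meson
    then show "q (f (u \<oplus>\<^bsub>M\<^esub> v)) = q (f u) \<oplus>\<^bsub>I.Q\<^esub> q (f v)"
      using uv by (simp add: fD(2) q J.add_Q I.add_Q cox_simps(1))
  next
    fix a :: "('n, 'm, 'k) cox" and u assume a: "a \<in> carrier cox_ring" and u: "u \<in> carrier M"
    obtain x where "f u = J +>\<^bsub>cox_ring\<^esub> x" using lift fD(1) u by meson
    then show "q (f (a \<odot>\<^bsub>M\<^esub> u)) = a \<odot>\<^bsub>I.Q\<^esub> q (f u)"
      using u by (simp add: fD(3) q J.smult_Q I.smult_Q cox_simps(1))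
  next
    fix d
    show "(\<lambda>u. q (f u)) ` hcomp M d \<subseteq> hcomp I.Q d"
    proof
      fix y assume "y \<in> (\<lambda>u. q (f u)) ` hcomp M d"
      then obtain u where "u \<in> hcomp M d" "y = q (f u)" by blast
      then have "f u \<in> (\<lambda>u. J +>\<^bsub>cox_ring\<^esub> u) ` hcomp cox_ring d"
        using fD(4)[of u d] by (simp add: J.hcomp_Q)
      then show "y \<in> hcomp I.Q d" using \<open>y = q (f u)\<close> by (auto simp: q I.hcomp_Q)
    qed
  qed
  have surj: "(\<lambda>u. q (f u)) ` carrier M = carrier I.Q"
  proof -
    have "(\<lambda>u. q (f u)) ` carrier M = q ` carrier J.Q"
      using f(2) by (simp add: bij_betw_def image_image[symmetric])
    also have "\<dots> = carrier I.Q" by (simp add: J.carrier_Q I.carrier_Q image_image q)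
    finally show ?thesis .
  qed
  have tors: "q (f u) \<in> torsion cox_ring ?B I.Q \<longleftrightarrow> u \<in> torsion cox_ring ?B M" if u: "u \<in> carrier M" for u
  proof -
    obtain x where x: "f u = J +>\<^bsub>cox_ring\<^esub> x" using lift fD(1) u by meson
    have zM: "b \<odot>\<^bsub>M\<^esub> u = \<zero>\<^bsub>M\<^esub> \<longleftrightarrow> b * x \<in> J" for b
    proof -
      interpret M: Module.module cox_ring M by fact
      have bu: "b \<odot>\<^bsub>M\<^esub> u \<in> carrier M" using u by (simp add: cox_simps(1))
      have "b \<odot>\<^bsub>M\<^esub> u = \<zero>\<^bsub>M\<^esub> \<longleftrightarrow> f (b \<odot>\<^bsub>M\<^esub> u) = f \<zero>\<^bsub>M\<^esub>"
        using f(2) bu by (auto simp: bij_betw_def inj_on_def)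
      also have "\<dots> \<longleftrightarrow> J +>\<^bsub>cox_ring\<^esub> (b * x) = \<zero>\<^bsub>J.Q\<^esub>"
        using u fD(3)[of b u] J.smult_Q[of b x] graded_hom_zero[OF f(1) M(1) J.module_Q]
        by (simp add: x cox_simps)
      finally show ?thesis using J.coset_eq_zero_iff[of "b * x"] by (simp add: cox_simps(1))
    qed
    have zI: "b \<odot>\<^bsub>I.Q\<^esub> (I +>\<^bsub>cox_ring\<^esub> x) = \<zero>\<^bsub>I.Q\<^esub> \<longleftrightarrow> b * x \<in> I" for b
      using I.smult_Q[of b x] I.coset_eq_zero_iff[of "b * x"] by (simp add: cox_simps)
    have pow: "b \<in> ideal_power cox_ring x_ideal t" if "b \<in> ideal_power cox_ring ?B t" for b
      using that ideal_power_mono[of ?B x_ideal t] by (auto simp: irrelevant_ideal_def)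
    have "(\<exists>s. \<forall>b\<in>ideal_power cox_ring ?B s. b * x \<in> I) \<longleftrightarrow>
        (\<exists>s. \<forall>b\<in>ideal_power cox_ring ?B s. b * x \<in> J)"
    proof
      assume "\<exists>s. \<forall>b\<in>ideal_power cox_ring ?B s. b * x \<in> I"
      then obtain s where s: "\<And>b. b \<in> ideal_power cox_ring ?B s \<Longrightarrow> b * x \<in> I" by blast
      \<comment> \<open>The exponent \<open>max s t\<close> serves both factors of the intersection:
        power \<open>s\<close> puts the product into \<open>I\<close>, power \<open>t\<close> puts
        \<open>b\<close> itself into the power of the x-ideal.\<close>
      have "b * x \<in> J" if b: "b \<in> ideal_power cox_ring ?B (max s t)" for b
      proof -
        have bs: "b \<in> ideal_power cox_ring ?B s" and bt: "b \<in> ideal_power cox_ring ?B t"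
          using b ideal_power_antimono[OF is_ideal_irrelevant, of s "max s t"]
            ideal_power_antimono[OF is_ideal_irrelevant, of t "max s t"] by auto
        show ?thesis
          unfolding J_def
          by (intro IntI s bs is_idealD(4)[OF is_ideal_power[OF is_ideal_x_ideal]] pow bt)
      qed
      then show "\<exists>s. \<forall>b\<in>ideal_power cox_ring ?B s. b * x \<in> J" by blast
    qed (auto simp: J_def)
    then show ?thesis
      using u by (simp add: torsion_def x q zI zM I.coset_in_Q cox_simps(1))
  qed
  show ?thesis
    by (rule graded_iso_quotients[OF torsion_quotient_module torsion_quotient_module hom surj tors M(2)])
      (auto intro: M I.module_Q is_ideal_irrelevant)
qed

section \<open>Coordinates with respect to a homogeneous basis\<close>

locale based_module = Module.module cox_ring M
  for M :: "(('n::finite, 'm::finite, 'k::field) cox, 'b) gmod" +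
  fixes E :: "'b set"
  assumes finite_E: "finite E" and E_carrier: "E \<subseteq> carrier M"
    and basis: "u \<in> carrier M \<Longrightarrow>
      \<exists>!c. (\<forall>e. c e \<in> carrier cox_ring) \<and> {e. c e \<noteq> \<zero>\<^bsub>cox_ring\<^esub>} \<subseteq> E \<and>
        finite {e. c e \<noteq> \<zero>\<^bsub>cox_ring\<^esub>} \<and>
        u = (\<Oplus>\<^bsub>M\<^esub> e\<in>{e. c e \<noteq> \<zero>\<^bsub>cox_ring\<^esub>}. c e \<odot>\<^bsub>M\<^esub> e)"
begin

definition lin :: "('b \<Rightarrow> ('n, 'm, 'k) cox) \<Rightarrow> 'b" where
  "lin c = (\<Oplus>\<^bsub>M\<^esub> e\<in>E. c e \<odot>\<^bsub>M\<^esub> e)"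

text \<open>Coordinates are total functions vanishing off the basis, the same shape as
  \<open>free i\<close> in \<open>matrix_complex\<close>.\<close>

definition cfun :: "('b \<Rightarrow> ('n, 'm, 'k) cox) set" where
  "cfun = {c. \<forall>e. e \<notin> E \<longrightarrow> c e = 0}"

definition coord :: "'b \<Rightarrow> 'b \<Rightarrow> ('n, 'm, 'k) cox" where
  "coord u = (THE c. c \<in> cfun \<and> u = lin c)"

lemma smult_carrier: "u \<in> carrier M \<Longrightarrow> a \<odot>\<^bsub>M\<^esub> u \<in> carrier M"
  by (rule smult_closed) (simp_all add: cox_simps)

lemma smult_E: "e \<in> E \<Longrightarrow> a \<odot>\<^bsub>M\<^esub> e \<in> carrier M"
  using E_carrier smult_carrier by blast

lemma lin_carrier: "lin c \<in> carrier M"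
  unfolding lin_def by (rule M.finsum_closed) (auto intro: smult_E)

lemma basis_lin: "u \<in> carrier M \<Longrightarrow> \<exists>!c. c \<in> cfun \<and> u = lin c"
proof -
  assume u: "u \<in> carrier M"
  have "(\<Oplus>\<^bsub>M\<^esub> e\<in>{e. c e \<noteq> \<zero>\<^bsub>cox_ring\<^esub>}. c e \<odot>\<^bsub>M\<^esub> e) = lin c"
    if "{e. c e \<noteq> \<zero>\<^bsub>cox_ring\<^esub>} \<subseteq> E" for c
    unfolding lin_def
  proof (rule M.add.finprod_mono_neutral_cong_left[OF finite_E that])
    fix e assume "e \<in> E - {e. c e \<noteq> \<zero>\<^bsub>cox_ring\<^esub>}"
    then show "c e \<odot>\<^bsub>M\<^esub> e = \<zero>\<^bsub>M\<^esub>" using E_carrier smult_l_null by auto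
  qed (auto intro: smult_E)
  moreover have "c \<in> cfun \<longleftrightarrow> {e. c e \<noteq> \<zero>\<^bsub>cox_ring\<^esub>} \<subseteq> E" for c
    by (auto simp: cfun_def cox_simps)
  moreover have "finite {e. c e \<noteq> \<zero>\<^bsub>cox_ring\<^esub>}" if "c \<in> cfun" for c
    using finite_E by (rule finite_subset[rotated]) (use that in \<open>auto simp: cfun_def cox_simps\<close>)
  ultimately have "((\<forall>e. c e \<in> carrier cox_ring) \<and> {e. c e \<noteq> \<zero>\<^bsub>cox_ring\<^esub>} \<subseteq> E \<and>
      finite {e. c e \<noteq> \<zero>\<^bsub>cox_ring\<^esub>} \<and>
      u = (\<Oplus>\<^bsub>M\<^esub> e\<in>{e. c e \<noteq> \<zero>\<^bsub>cox_ring\<^esub>}. c e \<odot>\<^bsub>M\<^esub> e)) \<longleftrightarrow> c \<in> cfun \<and> u = lin c" for c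
    by (auto simp: cox_simps(1))
  with basis[OF u] show ?thesis by simp
qed

lemma coord: "u \<in> carrier M \<Longrightarrow> coord u \<in> cfun" "u \<in> carrier M \<Longrightarrow> lin (coord u) = u"
  unfolding coord_def using theI'[OF basis_lin, of u] by simp_all

lemma coord_lin: "c \<in> cfun \<Longrightarrow> coord (lin c) = c"
  using basis_lin[OF lin_carrier[of c]] coord[OF lin_carrier[of c]] by metis

lemma lin_add: "lin (c + c') = lin c \<oplus>\<^bsub>M\<^esub> lin c'"
proof -
  have "lin c \<oplus>\<^bsub>M\<^esub> lin c' = (\<Oplus>\<^bsub>M\<^esub> e\<in>E. c e \<odot>\<^bsub>M\<^esub> e \<oplus>\<^bsub>M\<^esub> c' e \<odot>\<^bsub>M\<^esub> e)"
    unfolding lin_def by (rule M.finsum_addf[symmetric]) (auto intro: smult_E)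
  also have "\<dots> = lin (c + c')"
    unfolding lin_def
  proof (rule M.finsum_cong')
    fix e assume "e \<in> E"
    then show "c e \<odot>\<^bsub>M\<^esub> e \<oplus>\<^bsub>M\<^esub> c' e \<odot>\<^bsub>M\<^esub> e = (c + c') e \<odot>\<^bsub>M\<^esub> e"
      using smult_l_distr[of "c e" "c' e" e] E_carrier by (auto simp: cox_simps)
  qed (auto intro: smult_E)
  finally show ?thesis by simp
qed

lemma lin_fscale: "lin (fscale a c) = a \<odot>\<^bsub>M\<^esub> lin c"
proof -
  have "a \<odot>\<^bsub>M\<^esub> lin c = (\<Oplus>\<^bsub>M\<^esub> e\<in>E. a \<odot>\<^bsub>M\<^esub> (c e \<odot>\<^bsub>M\<^esub> e))"
    unfolding lin_def
    by (rule finsum_smult_ldistr[OF finite_E]) (auto intro: smult_E simp: cox_simps(1))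
  also have "\<dots> = lin (fscale a c)"
    unfolding lin_def
  proof (rule M.finsum_cong')
    fix e assume "e \<in> E"
    then show "a \<odot>\<^bsub>M\<^esub> (c e \<odot>\<^bsub>M\<^esub> e) = fscale a c e \<odot>\<^bsub>M\<^esub> e"
      using smult_assoc1[of a "c e" e] E_carrier by (auto simp: cox_simps fscale_def)
  qed (auto intro: smult_E)
  finally show ?thesis by simp
qed

lemma cfun_closed:
  "c \<in> cfun \<Longrightarrow> c' \<in> cfun \<Longrightarrow> c + c' \<in> cfun" "c \<in> cfun \<Longrightarrow> fscale a c \<in> cfun" "0 \<in> cfun"
  by (auto simp: cfun_def fscale_def)

lemma coord_add:
  "u \<in> carrier M \<Longrightarrow> v \<in> carrier M \<Longrightarrow> coord (u \<oplus>\<^bsub>M\<^esub> v) = coord u + coord v"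
  using coord_lin[of "coord u + coord v"] coord by (simp add: lin_add cfun_closed)

lemma coord_smult: "u \<in> carrier M \<Longrightarrow> coord (a \<odot>\<^bsub>M\<^esub> u) = fscale a (coord u)"
  using coord_lin[of "fscale a (coord u)"] coord by (simp add: lin_fscale cfun_closed)

lemma lin_zero: "lin 0 = \<zero>\<^bsub>M\<^esub>"
  using lin_fscale[of 0 0] smult_l_null[OF lin_carrier[of 0]]
  by (simp add: cox_simps fscale_def zero_fun_def)

lemma coord_zero: "coord \<zero>\<^bsub>M\<^esub> = 0"
  using coord_lin[OF cfun_closed(3)] by (simp add: lin_zero)

lemma carrier_trivial_iff: "carrier M = {\<zero>\<^bsub>M\<^esub>} \<longleftrightarrow> E = {}"
proof
  assume z: "carrier M = {\<zero>\<^bsub>M\<^esub>}"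
  show "E = {}"
  proof (rule ccontr)
    assume "E \<noteq> {}"
    then obtain e where e: "e \<in> E" by blast
    define c where "c = (\<lambda>e'. if e' = e then 1 else (0 :: ('n, 'm, 'k) cox))"
    have "c \<in> cfun" using e by (auto simp: cfun_def c_def)
    then have "c = coord (lin c)" by (rule coord_lin[symmetric])
    also have "lin c = \<zero>\<^bsub>M\<^esub>" using z lin_carrier[of c] by simp
    also have "coord \<zero>\<^bsub>M\<^esub> = 0" by (rule coord_zero)
    finally have "c e = 0 e" by (rule fun_cong)
    then show False by (simp add: c_def)
  qed
next
  assume "E = {}"
  then have "lin c = \<zero>\<^bsub>M\<^esub>" for c unfolding lin_def by simp
  then have "u = \<zero>\<^bsub>M\<^esub>" if "u \<in> carrier M" for u
    using coord(2)[OF that] by simp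
  then show "carrier M = {\<zero>\<^bsub>M\<^esub>}" by auto
qed

text \<open>The target is described as the image under \<open>T\<close> of a commutative monoid, so
  that one induction serves both coordinate vectors (\<open>T\<close> the identity) and cosets of an
  ideal.\<close>

lemma lin_image:
  assumes add: "\<And>u v. u \<in> carrier M \<Longrightarrow> v \<in> carrier M \<Longrightarrow> \<Psi> (u \<oplus>\<^bsub>M\<^esub> v) = pl (\<Psi> u) (\<Psi> v)"
    and zero: "\<Psi> \<zero>\<^bsub>M\<^esub> = T 0"
    and smult: "\<And>a e. e \<in> E \<Longrightarrow> \<Psi> (a \<odot>\<^bsub>M\<^esub> e) = T (g a e)"
    and pl: "\<And>x y. pl (T x) (T y) = T (x + y)"
  shows "\<Psi> (lin c) = T (\<Sum>e\<in>E. (g (c e) e :: 'z::comm_monoid_add))"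
proof -
  have "S \<subseteq> E \<Longrightarrow> \<Psi> (\<Oplus>\<^bsub>M\<^esub> e\<in>S. c e \<odot>\<^bsub>M\<^esub> e) = T (\<Sum>e\<in>S. g (c e) e)" if "finite S" for S
    using that
  proof induction
    case empty
    then show ?case by (simp add: zero)
  next
    case (insert x S)
    then have "(\<Oplus>\<^bsub>M\<^esub> e\<in>insert x S. c e \<odot>\<^bsub>M\<^esub> e) = c x \<odot>\<^bsub>M\<^esub> x \<oplus>\<^bsub>M\<^esub> (\<Oplus>\<^bsub>M\<^esub> e\<in>S. c e \<odot>\<^bsub>M\<^esub> e)"
      by (intro M.finsum_insert) (auto intro: smult_E)
    moreover have "(\<Oplus>\<^bsub>M\<^esub> e\<in>S. c e \<odot>\<^bsub>M\<^esub> e) \<in> carrier M"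
      using insert by (intro M.finsum_closed) (auto intro: smult_E)
    ultimately show ?case
      using insert by (simp add: add smult pl smult_E)
  qed
  then show ?thesis unfolding lin_def using finite_E by simp
qed

text \<open>The way minimality enters: it puts the matrix entries of the differentials into
  \<open>maxI\<close>.\<close>

lemma coord_ideal_smult:
  assumes u: "u \<in> ideal_smult maximal_ideal M"
  shows "coord u e \<in> maxI"
proof -
  obtain r :: nat and a v where av: "\<forall>i<r. a i \<in> maximal_ideal \<and> v i \<in> carrier M"
    "u = (\<Oplus>\<^bsub>M\<^esub> i\<in>{..<r}. a i \<odot>\<^bsub>M\<^esub> v i)"
    using u by (auto simp: ideal_smult_def)
  have "S \<subseteq> {..<r} \<Longrightarrow> coord (\<Oplus>\<^bsub>M\<^esub> i\<in>S. a i \<odot>\<^bsub>M\<^esub> v i) e \<in> maxI" if "finite S" for S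
    using that
  proof induction
    case empty
    then show ?case by (simp add: coord_zero is_idealD(1)[OF is_ideal_maxI])
  next
    case (insert x S)
    then have x: "a x \<in> maximal_ideal" "v x \<in> carrier M" using av(1) by auto
    have "(\<Oplus>\<^bsub>M\<^esub> i\<in>insert x S. a i \<odot>\<^bsub>M\<^esub> v i) = a x \<odot>\<^bsub>M\<^esub> v x \<oplus>\<^bsub>M\<^esub> (\<Oplus>\<^bsub>M\<^esub> i\<in>S. a i \<odot>\<^bsub>M\<^esub> v i)"
      using insert av(1) by (intro M.finsum_insert) (auto intro!: smult_carrier)
    moreover have "(\<Oplus>\<^bsub>M\<^esub> i\<in>S. a i \<odot>\<^bsub>M\<^esub> v i) \<in> carrier M"
      using insert av(1) by (intro M.finsum_closed) (auto intro!: smult_carrier)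
    ultimately have "coord (\<Oplus>\<^bsub>M\<^esub> i\<in>insert x S. a i \<odot>\<^bsub>M\<^esub> v i) e =
        a x * coord (v x) e + coord (\<Oplus>\<^bsub>M\<^esub> i\<in>S. a i \<odot>\<^bsub>M\<^esub> v i) e"
      using x by (simp add: coord_add coord_smult smult_carrier fscale_def)
    also have "\<dots> \<in> maxI"
      using insert x(1) maximal_ideal_subset
      by (intro is_idealD(2)[OF is_ideal_maxI] is_idealD(4)[OF is_ideal_maxI]) auto
    finally show ?case .
  qed
  then show ?thesis using av(2) by simp
qed

end

section \<open>From a minimal free resolution of a cyclic module to a matrix complex\<close>

lemma sum_fun_apply: "(\<Sum>a\<in>A. f a) x = (\<Sum>a\<in>A. f a x :: 'c::comm_monoid_add)"
  by (induction A rule: infinite_finite_induct) auto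

lemma sub_gmod_simps:
  "carrier (sub_gmod M K) = K" "u \<oplus>\<^bsub>sub_gmod M K\<^esub> v = u \<oplus>\<^bsub>M\<^esub> v" "\<zero>\<^bsub>sub_gmod M K\<^esub> = \<zero>\<^bsub>M\<^esub>"
  "a \<odot>\<^bsub>sub_gmod M K\<^esub> u = a \<odot>\<^bsub>M\<^esub> u" "hcomp (sub_gmod M K) d = K \<inter> hcomp M d"
  by (simp_all add: sub_gmod_def)

lemma module_sub_gmod:
  assumes M: "Module.module R M" and "K \<subseteq> carrier M" "\<zero>\<^bsub>M\<^esub> \<in> K"
    "\<And>u v. u \<in> K \<Longrightarrow> v \<in> K \<Longrightarrow> u \<oplus>\<^bsub>M\<^esub> v \<in> K"
    "\<And>a u. a \<in> carrier R \<Longrightarrow> u \<in> K \<Longrightarrow> a \<odot>\<^bsub>M\<^esub> u \<in> K"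
  shows "Module.module R (sub_gmod M K)"
proof -
  interpret Module.module R M by fact
  have K: "u \<in> K \<Longrightarrow> u \<in> carrier M" for u using assms(2) by blast
  show ?thesis
  proof (rule moduleI)
    show "abelian_group (sub_gmod M K)"
    proof (rule abelian_groupI; unfold sub_gmod_simps)
      fix u assume u: "u \<in> K"
      have "\<ominus>\<^bsub>M\<^esub> u = (\<ominus>\<^bsub>R\<^esub> \<one>\<^bsub>R\<^esub>) \<odot>\<^bsub>M\<^esub> u" using K[OF u] by (simp add: smult_l_minus)
      then have "\<ominus>\<^bsub>M\<^esub> u \<in> K" using assms(5)[of "\<ominus>\<^bsub>R\<^esub> \<one>\<^bsub>R\<^esub>" u] u by simp
      then show "\<exists>y\<in>K. y \<oplus>\<^bsub>M\<^esub> u = \<zero>\<^bsub>M\<^esub>" using K[OF u] by (intro bexI[of _ "\<ominus>\<^bsub>M\<^esub> u"]) (auto simp: M.l_neg)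
    qed (use assms K in \<open>auto simp: M.a_ac\<close>)
  qed (use assms K in \<open>auto simp: sub_gmod_simps R.is_cring smult_l_distr smult_r_distr smult_assoc1\<close>)
qed

locale cyclic_resolution =
  fixes F :: "nat \<Rightarrow> (('n::finite, 'm::finite, 'k::field) cox, 'b) gmod" and D and K
  assumes res: "minimal_free_resolution cox_ring maximal_ideal F D (quot_gmod cox_ring K)"
    and K: "is_ideal K"
begin

lemma cplx: "free_complex cox_ring F D"
  using res by (simp add: minimal_free_resolution_def)

lemma module_F: "Module.module cox_ring (F i)"
  using cplx by (auto simp: free_complex_def graded_module_def)

lemma hcomp_F: "hcomp (F i) d \<subseteq> carrier (F i)"
proof -
  have "additive_subgroup (hcomp (F i) d) (F i)"
    using cplx unfolding free_complex_def graded_module_def by blast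
  then show ?thesis by (rule additive_subgroup.a_subset)
qed

lemma D_hom: "graded_hom cox_ring (F (Suc i)) (F i) (D i)"
  using cplx by (auto simp: free_complex_def)

lemma D_D: "u \<in> carrier (F (Suc (Suc i))) \<Longrightarrow> D i (D (Suc i) u) = \<zero>\<^bsub>F i\<^esub>"
  using cplx by (auto simp: free_complex_def numeral_2_eq_2)

lemmas D_simps = graded_homD[OF D_hom]

lemma D_zero: "D i \<zero>\<^bsub>F (Suc i)\<^esub> = \<zero>\<^bsub>F i\<^esub>"
  by (rule graded_hom_zero[OF D_hom module_F module_F])

abbreviation im where "im i \<equiv> D i ` carrier (F (Suc i))"

lemma im_closed:
  "im i \<subseteq> carrier (F i)" "\<zero>\<^bsub>F i\<^esub> \<in> im i"
  "u \<in> im i \<Longrightarrow> v \<in> im i \<Longrightarrow> u \<oplus>\<^bsub>F i\<^esub> v \<in> im i" "u \<in> im i \<Longrightarrow> a \<odot>\<^bsub>F i\<^esub> u \<in> im i"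
proof -
  interpret S: Module.module cox_ring "F (Suc i)" by (rule module_F)
  show "im i \<subseteq> carrier (F i)" using D_simps(1) by auto
  show "\<zero>\<^bsub>F i\<^esub> \<in> im i" using D_zero[of i] by (metis S.M.zero_closed imageI)
  show "u \<oplus>\<^bsub>F i\<^esub> v \<in> im i" if "u \<in> im i" "v \<in> im i"
    using that by (auto simp: D_simps(2)[symmetric])
  show "a \<odot>\<^bsub>F i\<^esub> u \<in> im i" if "u \<in> im i"
  proof -
    obtain w where w: "w \<in> carrier (F (Suc i))" "u = D i w" using \<open>u \<in> im i\<close> by blast
    then have "a \<odot>\<^bsub>F i\<^esub> u = D i (a \<odot>\<^bsub>F (Suc i)\<^esub> w)" using D_simps(3)[of a w] by (simp add: cox_simps)
    then show ?thesis using w(1) S.smult_closed[of a w] by (simp add: cox_simps)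
  qed
qed

lemma cycles_closed:
  "cycles F D i \<subseteq> carrier (F i)" "im i \<subseteq> cycles F D i"
  "u \<in> cycles F D i \<Longrightarrow> v \<in> cycles F D i \<Longrightarrow> u \<oplus>\<^bsub>F i\<^esub> v \<in> cycles F D i"
  "u \<in> cycles F D i \<Longrightarrow> a \<odot>\<^bsub>F i\<^esub> u \<in> cycles F D i"
proof -
  interpret S: Module.module cox_ring "F i" by (rule module_F)
  have sm: "a \<odot>\<^bsub>F i\<^esub> w \<in> carrier (F i)" if "w \<in> carrier (F i)" for a w
    using S.smult_closed[of a w] that by (simp add: cox_simps)
  show "cycles F D i \<subseteq> carrier (F i)" by (auto simp: cycles_def split: nat.splits)
  show "im i \<subseteq> cycles F D i" using D_D im_closed(1)[of i] by (auto simp: cycles_def split: nat.splits)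
  show "u \<oplus>\<^bsub>F i\<^esub> v \<in> cycles F D i" if "u \<in> cycles F D i" "v \<in> cycles F D i"
  proof (cases i)
    case 0
    then show ?thesis using that S.M.add.m_closed[of u v] by (simp add: cycles_def)
  next
    case (Suc j)
    interpret T: Module.module cox_ring "F j" by (rule module_F)
    show ?thesis using that S.M.add.m_closed[of u v] Suc by (simp add: cycles_def D_simps)
  qed
  show "a \<odot>\<^bsub>F i\<^esub> u \<in> cycles F D i" if "u \<in> cycles F D i"
  proof (cases i)
    case 0
    then show ?thesis using that sm by (simp add: cycles_def)
  next
    case (Suc j)
    interpret T: Module.module cox_ring "F j" by (rule module_F)
    show ?thesis
      using that sm Suc D_simps(3)[of a u j] T.smult_r_null[of a] by (simp add: cycles_def cox_simps)
  qed
qed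

lemma quotient_module_homology:
  "quotient_module cox_ring (sub_gmod (F i) (cycles F D i)) (im i)"
proof -
  have z: "\<zero>\<^bsub>F i\<^esub> \<in> cycles F D i" using im_closed(2) cycles_closed(2) by blast
  have "Module.module cox_ring (sub_gmod (F i) (cycles F D i))"
    by (rule module_sub_gmod[OF module_F]) (auto intro: cycles_closed z subsetD[OF cycles_closed(1)])
  then show ?thesis
    by (rule quotient_moduleI; unfold sub_gmod_simps)
      (rule cycles_closed im_closed; assumption)+
qed

lemma homology_eq: "homology F D i = quot_gmod (sub_gmod (F i) (cycles F D i)) (im i)"
  by (simp add: homology_def)

lemma module_homology: "Module.module cox_ring (homology F D i)"
  unfolding homology_eq by (rule quotient_module.module_Q[OF quotient_module_homology])

lemma hcomp_homology: "hcomp (homology F D i) d \<subseteq> carrier (homology F D i)"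
  unfolding homology_eq
  using quotient_module.hcomp_Q[OF quotient_module_homology] quotient_module.carrier_Q[OF quotient_module_homology]
  by (auto simp: sub_gmod_simps)

lemma homology_trivial: "i > 0 \<Longrightarrow> carrier (homology F D i) = {\<zero>\<^bsub>homology F D i\<^esub>}"
  using res by (simp add: minimal_free_resolution_def)

lemma exactness:
  assumes "u \<in> carrier (F (Suc i))" "D i u = \<zero>\<^bsub>F i\<^esub>"
  shows "u \<in> im (Suc i)"
proof -
  interpret H: quotient_module cox_ring "sub_gmod (F (Suc i)) (cycles F D (Suc i))" "im (Suc i)"
    by (rule quotient_module_homology)
  have u: "u \<in> carrier (sub_gmod (F (Suc i)) (cycles F D (Suc i)))"
    using assms by (simp add: sub_gmod_simps cycles_def)
  show ?thesis
    using H.coset_in_Q[OF u] H.coset_eq_zero_iff[OF u] homology_trivial[of "Suc i"]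
    by (simp add: homology_eq)
qed

text \<open>\<open>g\<close> is the projection of F_0 onto H_0 followed by the isomorphism that the
  resolution supplies, so its kernel is the image of the first differential.\<close>

lemma presentation:
  obtains g where "\<And>u. u \<in> carrier (F 0) \<Longrightarrow> g u \<in> carrier (quot_gmod cox_ring K)"
    "\<And>u v. u \<in> carrier (F 0) \<Longrightarrow> v \<in> carrier (F 0) \<Longrightarrow>
      g (u \<oplus>\<^bsub>F 0\<^esub> v) = g u \<oplus>\<^bsub>quot_gmod cox_ring K\<^esub> g v"
    "\<And>a u. u \<in> carrier (F 0) \<Longrightarrow> g (a \<odot>\<^bsub>F 0\<^esub> u) = a \<odot>\<^bsub>quot_gmod cox_ring K\<^esub> g u"
    "g ` carrier (F 0) = carrier (quot_gmod cox_ring K)"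
    "\<And>u. u \<in> carrier (F 0) \<Longrightarrow> g u = \<zero>\<^bsub>quot_gmod cox_ring K\<^esub> \<longleftrightarrow> u \<in> im 0"
proof -
  interpret H: quotient_module cox_ring "sub_gmod (F 0) (cycles F D 0)" "im 0"
    by (rule quotient_module_homology)
  interpret KQ: quotient_module cox_ring cox_ring K by (rule quotient_module_cox[OF K])
  obtain f where f: "graded_hom cox_ring H.Q KQ.Q f" "bij_betw f (carrier H.Q) (carrier KQ.Q)"
    using res by (auto simp: minimal_free_resolution_def graded_iso_def homology_eq)
  note fD = graded_homD[OF f(1)]
  have c0: "carrier (sub_gmod (F 0) (cycles F D 0)) = carrier (F 0)"
    by (simp add: sub_gmod_simps cycles_def)
  define g where "g u = f (im 0 +>\<^bsub>sub_gmod (F 0) (cycles F D 0)\<^esub> u)" for u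
  show thesis
  proof (rule that[of g])
    show "g u \<in> carrier KQ.Q" if "u \<in> carrier (F 0)" for u
      unfolding g_def using that by (intro fD H.coset_in_Q) (simp add: c0)
    show "g (u \<oplus>\<^bsub>F 0\<^esub> v) = g u \<oplus>\<^bsub>KQ.Q\<^esub> g v" if uv: "u \<in> carrier (F 0)" "v \<in> carrier (F 0)" for u v
      unfolding g_def using H.add_Q[of u v, symmetric] uv
      by (simp add: c0 sub_gmod_simps(2) fD(2) H.coset_in_Q)
    show "g (a \<odot>\<^bsub>F 0\<^esub> u) = a \<odot>\<^bsub>KQ.Q\<^esub> g u" if u: "u \<in> carrier (F 0)" for a u
      unfolding g_def using H.smult_Q[of a u, symmetric] u
      by (simp add: c0 sub_gmod_simps(4) cox_simps(1) fD(3) H.coset_in_Q)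
    show "g ` carrier (F 0) = carrier KQ.Q"
      using f(2) by (simp add: bij_betw_def H.carrier_Q c0 g_def image_image)
    show "g u = \<zero>\<^bsub>KQ.Q\<^esub> \<longleftrightarrow> u \<in> im 0" if "u \<in> carrier (F 0)" for u
    proof -
      interpret HM: Module.module cox_ring H.Q by (rule H.module_Q)
      have "g u = \<zero>\<^bsub>KQ.Q\<^esub> \<longleftrightarrow> f (im 0 +>\<^bsub>sub_gmod (F 0) (cycles F D 0)\<^esub> u) = f \<zero>\<^bsub>H.Q\<^esub>"
        using graded_hom_zero[OF f(1) H.module_Q KQ.module_Q] by (simp add: g_def)
      also have "\<dots> \<longleftrightarrow> im 0 +>\<^bsub>sub_gmod (F 0) (cycles F D 0)\<^esub> u = \<zero>\<^bsub>H.Q\<^esub>"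
        using f(2) H.coset_in_Q[of u] that HM.M.zero_closed by (auto simp: bij_betw_def c0 inj_on_def)
      finally show ?thesis using H.coset_eq_zero_iff[of u] that by (simp add: c0)
    qed
  qed
qed

lemma bases:
  obtains E where "\<And>i. based_module (F i) (E i)"
proof -
  have "\<forall>i. \<exists>E. based_module (F i) E"
  proof
    fix i
    obtain E where E: "finite E" "homogeneous_basis cox_ring (F i) E"
      using res unfolding minimal_free_resolution_def by blast
    have "E \<subseteq> carrier (F i)" using E(2) hcomp_F unfolding homogeneous_basis_def by blast
    then have "based_module (F i) E"
      using E module_F by (intro based_module.intro based_module_axioms.intro) (auto simp: homogeneous_basis_def)
    then show "\<exists>E. based_module (F i) E" ..
  qed
  then show thesis using that by metis
qed

lemma length_eq:
  assumes pts: "cone_points P Q W t d c j0 j1" and J_eq: "K = cone_points.J W t"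
    and card: "CARD('n) = n + 1" "CARD('m) = m + 1"
  shows "complex_length F (n + m)"
proof -
  interpret cone_points P Q W t d c j0 j1 by fact
  obtain E where bE: "\<And>i. based_module (F i) (E i)" using bases by blast
  interpret B: based_module "F i" "E i" for i by (rule bE)
  interpret JQ: quotient_module cox_ring cox_ring K by (rule quotient_module_cox[OF K])
  \<comment> \<open>Rows outside the basis are set to 0: the support condition of
    \<open>matrix_complex\<close> must hold for every \<open>e\<close>, and only for basis elements
    is \<open>D i e\<close> known to lie in \<open>F i\<close>.\<close>
  define A where "A i e e' = (if e \<in> E (Suc i) then B.coord i (D i e) e' else 0)" for i e e'
  have DE: "D i e \<in> carrier (F i)" if "e \<in> E (Suc i)" for i e
    using that B.E_carrier[of "Suc i"] D_simps(1) by blast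
  have mc: "matrix_complex E A"
  proof (rule matrix_complex.intro)
    show "finite (E i)" for i by (rule B.finite_E)
    show "A i e e' = 0" if "e' \<notin> E i" for i e e'
      using B.coord(1)[OF DE, of e i] that by (auto simp: A_def B.cfun_def)
  qed
  interpret MC: matrix_complex E A by (rule mc)
  have free: "MC.free i = B.cfun i" for i by (auto simp: MC.supp_def B.cfun_def)
  have diff: "MC.diff i f = B.coord i (D i (B.lin (Suc i) f))" for i f
  proof -
    have "B.coord i (D i (B.lin (Suc i) f)) = (\<lambda>x. x) (\<Sum>e\<in>E (Suc i). fscale (f e) (B.coord i (D i e)))"
    proof (rule B.lin_image[where \<Psi> = "\<lambda>u. B.coord i (D i u)" and pl = "(+)" and T = "\<lambda>x. x" and
          g = "\<lambda>a e. fscale a (B.coord i (D i e))"])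
      show "B.coord i (D i \<zero>\<^bsub>F (Suc i)\<^esub>) = 0" by (simp add: D_zero B.coord_zero)
      show "B.coord i (D i (u \<oplus>\<^bsub>F (Suc i)\<^esub> v)) = B.coord i (D i u) + B.coord i (D i v)"
        if "u \<in> carrier (F (Suc i))" "v \<in> carrier (F (Suc i))" for u v
        using that by (simp add: D_simps B.coord_add)
      show "B.coord i (D i (a \<odot>\<^bsub>F (Suc i)\<^esub> e)) = fscale a (B.coord i (D i e))" if "e \<in> E (Suc i)" for a e
        using D_simps(3)[of a e i] that B.E_carrier[of "Suc i"] DE[OF that]
        by (simp add: B.coord_smult cox_simps(1) subset_iff)
    qed simp
    then show ?thesis
      by (auto simp: MC.diff_def A_def fscale_def fun_eq_iff sum_fun_apply)
  qed
  obtain g where g: "\<And>u. u \<in> carrier (F 0) \<Longrightarrow> g u \<in> carrier JQ.Q"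
    "\<And>u v. u \<in> carrier (F 0) \<Longrightarrow> v \<in> carrier (F 0) \<Longrightarrow> g (u \<oplus>\<^bsub>F 0\<^esub> v) = g u \<oplus>\<^bsub>JQ.Q\<^esub> g v"
    "\<And>a u. u \<in> carrier (F 0) \<Longrightarrow> g (a \<odot>\<^bsub>F 0\<^esub> u) = a \<odot>\<^bsub>JQ.Q\<^esub> g u"
    "g ` carrier (F 0) = carrier JQ.Q"
    "\<And>u. u \<in> carrier (F 0) \<Longrightarrow> g u = \<zero>\<^bsub>JQ.Q\<^esub> \<longleftrightarrow> u \<in> im 0"
    using presentation by blast
  have "\<forall>e\<in>E 0. \<exists>x. g e = K +>\<^bsub>cox_ring\<^esub> x"
    using g(1)[unfolded JQ.carrier_Q] B.E_carrier[of 0] by blast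
  \<comment> \<open>Ring representatives of the images of the basis elements; they express
    \<open>g\<close> in coordinates.\<close>
  then obtain s where s: "\<And>e. e \<in> E 0 \<Longrightarrow> g e = K +>\<^bsub>cox_ring\<^esub> s e" by metis
  have g_lin: "g (B.lin 0 f) = K +>\<^bsub>cox_ring\<^esub> (\<Sum>e\<in>E 0. f e * s e)" for f
  proof (rule B.lin_image[where pl = "\<lambda>x y. x \<oplus>\<^bsub>JQ.Q\<^esub> y" and T = "\<lambda>x. K +>\<^bsub>cox_ring\<^esub> x" and
        g = "\<lambda>a e. a * s e"])
    show "g \<zero>\<^bsub>F 0\<^esub> = K +>\<^bsub>cox_ring\<^esub> 0"
      using g(5)[of "\<zero>\<^bsub>F 0\<^esub>"] im_closed(2)[of 0] JQ.coset_zero JQ.zero_Q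
      by (simp add: cox_simps(5))
    show "g (u \<oplus>\<^bsub>F 0\<^esub> v) = g u \<oplus>\<^bsub>JQ.Q\<^esub> g v"
      if "u \<in> carrier (F 0)" "v \<in> carrier (F 0)" for u v using that by (rule g(2))
    show "g (a \<odot>\<^bsub>F 0\<^esub> e) = K +>\<^bsub>cox_ring\<^esub> (a * s e)" if e: "e \<in> E 0" for a e
    proof -
      have "e \<in> carrier (F 0)" using e B.E_carrier by blast
      then show ?thesis using g(3)[of e a] JQ.smult_Q[of a "s e"] by (simp add: s[OF e] cox_simps)
    qed
    show "(K +>\<^bsub>cox_ring\<^esub> x) \<oplus>\<^bsub>JQ.Q\<^esub> (K +>\<^bsub>cox_ring\<^esub> y) = K +>\<^bsub>cox_ring\<^esub> (x + y)" for x y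
      using JQ.add_Q[of x y] by (simp add: cox_simps(1,2))
  qed
  have lin_coord_D: "D i (B.lin (Suc i) f) \<in> carrier (F i)" for i f
    by (rule D_simps(1)[OF B.lin_carrier])
  have dd: "MC.diff i (MC.diff (Suc i) f) = 0" for i f
    unfolding diff by (simp add: B.coord(2) lin_coord_D D_D B.lin_carrier B.coord_zero)
  have ex: "f \<in> MC.diff (Suc i) ` MC.free (Suc (Suc i))"
    if f: "f \<in> MC.free (Suc i)" "MC.diff i f = 0" for i f
  proof -
    have "D i (B.lin (Suc i) f) = B.lin i 0"
      using f(2) B.coord(2)[OF lin_coord_D] unfolding diff by metis
    then have "B.lin (Suc i) f \<in> im (Suc i)"
      by (intro exactness B.lin_carrier) (simp add: B.lin_zero)
    then obtain v where v: "v \<in> carrier (F (Suc (Suc i)))" "B.lin (Suc i) f = D (Suc i) v" by blast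
    have "f = B.coord (Suc i) (B.lin (Suc i) f)" using f(1) by (simp add: free B.coord_lin)
    also have "\<dots> = MC.diff (Suc i) (B.coord (Suc (Suc i)) v)"
      unfolding diff using v by (simp add: B.coord(2))
    finally show ?thesis using B.coord(1)[OF v(1)] by (auto simp: free)
  qed
  have h0: "(\<Sum>e\<in>E 0. f e * s e) \<in> K \<longleftrightarrow> f \<in> MC.diff 0 ` MC.free 1" if f: "f \<in> MC.free 0" for f
  proof -
    have "(\<Sum>e\<in>E 0. f e * s e) \<in> K \<longleftrightarrow> g (B.lin 0 f) = \<zero>\<^bsub>JQ.Q\<^esub>"
      using JQ.coset_eq_zero_iff[of "\<Sum>e\<in>E 0. f e * s e"] by (simp add: g_lin cox_simps(1))
    also have "\<dots> \<longleftrightarrow> B.lin 0 f \<in> im 0" by (rule g(5)[OF B.lin_carrier])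
    also have "\<dots> \<longleftrightarrow> f \<in> MC.diff 0 ` MC.free 1"
    proof
      assume "B.lin 0 f \<in> im 0"
      then obtain v where v: "v \<in> carrier (F (Suc 0))" "B.lin 0 f = D 0 v" by blast
      have "f = B.coord 0 (B.lin 0 f)" using f by (simp add: free B.coord_lin)
      also have "\<dots> = MC.diff 0 (B.coord (Suc 0) v)"
        unfolding diff using v by (simp add: B.coord(2))
      finally show "f \<in> MC.diff 0 ` MC.free 1" using B.coord(1)[OF v(1)] by (auto simp: free)
    next
      assume "f \<in> MC.diff 0 ` MC.free 1"
      then obtain h where "f = B.coord 0 (D 0 (B.lin (Suc 0) h))" by (auto simp: diff)
      then have "B.lin 0 f = D 0 (B.lin (Suc 0) h)" by (simp add: B.coord(2) lin_coord_D)
      then show "B.lin 0 f \<in> im 0" using B.lin_carrier by blast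
    qed
    finally show ?thesis .
  qed
  have "K +>\<^bsub>cox_ring\<^esub> 1 \<in> g ` carrier (F 0)"
    unfolding g(4) by (rule JQ.coset_in_Q) (simp add: cox_simps(1))
  \<comment> \<open>A preimage of the class of 1, whose coordinates give \<open>f1\<close>; nothing
    here presumes that F_0 has rank one.\<close>
  then obtain u where u: "u \<in> carrier (F 0)" "g u = K +>\<^bsub>cox_ring\<^esub> 1" by blast
  define f1 where "f1 = B.coord 0 u"
  have f1: "f1 \<in> MC.free 0" using B.coord(1)[OF u(1)] by (simp add: free f1_def)
  have "K +>\<^bsub>cox_ring\<^esub> (\<Sum>e\<in>E 0. f1 e * s e) = K +>\<^bsub>cox_ring\<^esub> 1"
    using g_lin[of f1] u by (simp add: f1_def B.coord(2))
  then have f1': "(\<Sum>e\<in>E 0. f1 e * s e) - 1 \<in> K"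
    using JQ.coset_eq_iff[of "\<Sum>e\<in>E 0. f1 e * s e" 1] by (simp add: cox_simps(1) cox_minus)
  have entries: "A i e e' \<in> maxI" for i e e'
  proof (cases "e \<in> E (Suc i)")
    case True
    then have "D i e \<in> D i ` carrier (F (i + 1))" using B.E_carrier[of "Suc i"] by auto
    then have "D i e \<in> ideal_smult maximal_ideal (F i)"
      using res unfolding minimal_free_resolution_def by blast
    then show ?thesis using True by (simp add: A_def B.coord_ideal_smult)
  next
    case False
    then show ?thesis by (simp add: A_def is_idealD(1)[OF is_ideal_maxI])
  qed
  have "E (n + m) \<noteq> {} \<and> (\<forall>i>n + m. E i = {})"
    by (rule resolution_length[OF card mc dd ex h0[unfolded J_eq] f1 f1'[unfolded J_eq] entries])
  then show ?thesis
    unfolding complex_length_def by (simp add: B.carrier_trivial_iff)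
qed

end

theorem theorem1p1:
  fixes n m l t :: nat
    and X :: "(('n::finite, 'k::alg_closed_field) proj_space \<times> ('m::finite, 'k) proj_space) set"
    and F :: "nat \<Rightarrow> (('n, 'm, 'k) cox, 'b) gmod"
    and D :: "nat \<Rightarrow> 'b \<Rightarrow> 'b"
  assumes "CARD('n) = n + 1" and "CARD('m) = m + 1"
    and "n \<ge> 1" and "m \<ge> 1"
    and "finite X" and "X \<noteq> {}"
    and "l = card (fst ` X)"
    and "int t \<ge> int l - 1"
    and "minimal_free_resolution cox_ring maximal_ideal F D
           (quot_gmod cox_ring (vanishing_ideal X \<inter> ideal_power cox_ring x_ideal t))"
  shows "virtual_resolution cox_ring irrelevant_ideal F D
           (quot_gmod cox_ring (vanishing_ideal X)) \<and>
         complex_length F (n + m)"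
proof -
  have inf: "infinite (UNIV :: 'k set)" by (rule infinite_alg_closed_field)
  define W where "W = (\<lambda>(p, q). (coords p, coords q)) ` X"
  define P where "P = coords ` fst ` X"
  define Q where "Q = coords ` snd ` X"
  have fin: "finite P" "finite Q" using \<open>finite X\<close> by (simp_all add: P_def Q_def)
  have W: "W \<subseteq> P \<times> Q" "W \<noteq> {}"
    using \<open>X \<noteq> {}\<close> by (force simp: W_def P_def Q_def)+
  have np: "nonproportional P" "nonproportional Q"
    unfolding P_def Q_def by (rule nonproportional_coords)+
  obtain d where d: "\<And>p. p \<in> P \<Longrightarrow> (\<Sum>i\<in>UNIV. d i * p i) \<noteq> 0"
    using avoid_hyperplanes[OF inf fin(1)] np(1) by (auto simp: nonproportional_def)
  obtain c where c: "\<And>q. q \<in> Q \<Longrightarrow> (\<Sum>j\<in>UNIV. c j * q j) \<noteq> 0"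
    using avoid_hyperplanes[OF inf fin(2)] np(2) by (auto simp: nonproportional_def)
  obtain q where "q \<in> Q" using \<open>X \<noteq> {}\<close> by (auto simp: Q_def)
  have "\<exists>j0. c j0 \<noteq> 0"
  proof (rule ccontr)
    assume "\<nexists>j0. c j0 \<noteq> 0"
    then show False using c[OF \<open>q \<in> Q\<close>] by simp
  qed
  then obtain j0 where j0: "c j0 \<noteq> 0" by blast
  \<comment> \<open>This is where m >= 1 supplies a second y-variable.\<close>
  have "\<exists>j1. j1 \<noteq> j0"
  proof (rule ccontr)
    assume "\<nexists>j1. j1 \<noteq> j0"
    then have "(UNIV :: 'm set) = {j0}" by auto
    then have "CARD('m) = card {j0}" by (rule arg_cong)
    then show False using \<open>CARD('m) = m + 1\<close> \<open>m \<ge> 1\<close> by simp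
  qed
  then obtain j1 where j1: "j1 \<noteq> j0" by blast
  have "card P \<le> card (fst ` X)"
    unfolding P_def using \<open>finite X\<close> by (intro card_image_le) simp
  then have card_P: "card P \<le> t + 1" using \<open>l = card (fst ` X)\<close> \<open>int t \<ge> int l - 1\<close> by linarith
  have pts: "cone_points P Q W t d c j0 j1"
    by (intro cone_points.intro inf fin W np d c card_P j0 j1)
  define I where "I = vanishing_ideal X"
  define J where "J = I \<inter> ideal_power cox_ring x_ideal t"
  have I_eq: "I = cone_ideal W" unfolding I_def W_def by (rule vanishing_ideal_eq[OF inf])
  have I: "is_ideal I" unfolding I_eq by (rule is_ideal_cone)
  have J_eq: "J = cone_points.J W t"
    unfolding J_def I_eq cone_points.J_def[OF pts] by (simp add: ideal_power_x_ideal)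
  have res: "minimal_free_resolution cox_ring maximal_ideal F D (quot_gmod cox_ring J)"
    using assms(9) by (simp add: I_def J_def)
  interpret cyclic_resolution F D J
  proof
    show "minimal_free_resolution cox_ring maximal_ideal F D (quot_gmod cox_ring J)" by (rule res)
    show "is_ideal J" unfolding J_eq by (rule cone_points.is_ideal_J[OF pts])
  qed
  have len: "complex_length F (n + m)"
    using pts J_eq assms(1,2) by (rule length_eq)
  have hom: "b \<odot>\<^bsub>homology F D i\<^esub> u = \<zero>\<^bsub>homology F D i\<^esub>"
    if "i > 0" "u \<in> carrier (homology F D i)" for i b u
  proof -
    interpret Module.module cox_ring "homology F D i" by (rule module_homology)
    show ?thesis using that homology_trivial[of i] by (simp add: cox_simps(1))
  qed
  have iso: "graded_iso cox_ring
      (quot_gmod (homology F D 0) (torsion cox_ring irrelevant_ideal (homology F D 0)))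
      (quot_gmod (quot_gmod cox_ring I) (torsion cox_ring irrelevant_ideal (quot_gmod cox_ring I)))"
  proof (rule truncation_torsion_iso[OF module_homology hcomp_homology I])
    show "graded_iso cox_ring (homology F D 0)
        (quot_gmod cox_ring (I \<inter> ideal_power cox_ring x_ideal t))"
      using res unfolding minimal_free_resolution_def J_def by (elim conjE)
  qed
  \<comment> \<open>Higher homology is zero, so the exponent 0 already works, although the zeroth
    power of B is all of S.\<close>
  have "virtual_resolution cox_ring irrelevant_ideal F D (quot_gmod cox_ring I)"
    unfolding virtual_resolution_def
    by (intro conjI cplx iso allI impI exI[of _ 0] ballI hom)
  with len show ?thesis unfolding I_def by (intro conjI)
qed

end
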